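(* Let $K\ge2$, $0<v_1<\dots<v_K$, and consider privacy parameters $\beta\in[0,\min_k\bar\beta_k)$. For an aggregated market $x^*$ let $m_{x^*}(\beta)=\max\{u_c:(u_c,u_p)\in\mathcal S_\beta\}$ be the maximum consumer utility over all segmentations and optimal pricing rules. (i) Assume $v_1$ is an optimal uniform price in the non-private case, i.e. $v_1\in\arg\max_{v\in\mathcal V}\mathcal U_p(v,x^* )$, and that $$v_{i+1}\ \ge\ \frac{K+1-i}{K-i}\,v_i\quad\text{for all } i\in[K-1].$$ Then $m_{x^*}(\beta)$ is a decreasing function of $\beta$. (ii) Assume $$v_{i+1}\ \le\ \frac{K+1-i}{K-i}\,v_i\quad\text{for all } i\in[K-1].$$ Then there exist $\tilde\alpha\in(0,1)$ and $\tilde\beta>0$ (with $\tilde\beta<\min_k\bar\beta_k$) such that, for every aggregated market $x^*$ for which $v_K$ is an optimal uniform price in the non-private case (i.e. $v_K\in\arg\max_{v\in\mathcal V}\mathcal U_p(v,x^* )$) and $x^*(v_K)\ge\tilde\alpha$, the function $m_{x^*}(\beta)$ is increasing in $\beta$ over $[0,\tilde\beta]$.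
   Context: "Increasing"/"decreasing" are in the weak sense. $[n]=\{1,\dots,n\}$; $\mathcal V=\{v_1,\dots,v_K\}$; a market is a probability distribution $x$ on $\mathcal V$; $\mathcal X$ is the simplex of all markets, $\mathrm{Unif}(\mathcal X)$ the uniform distribution on it. The aggregated market is $x^*\in\mathcal X$. A segmentation is a finitely supported probability distribution $\sigma$ on $\mathcal X$ with $\sum_x\sigma(x)x=x^*$; $\Sigma$ is the set of segmentations. For a price $p\ge0$ and market $x$: $\mathcal U_p(p,x)=p\sum_k x(v_k)\mathbf 1(p\le v_k)$ and $\mathcal U_c(p,x)=\sum_k x(v_k)(v_k-p)\mathbf 1(p\le v_k)$. Privacy mechanism: $\mathcal M_\beta(x)$ equals $x$ with probability $1-\beta$ and, with probability $\beta$, is an independent draw from $\mathrm{Unif}(\mathcal X)$. The producer has prior $\mathrm{Unif}(\mathcal X)$; after observing $\hat x$ the posterior is $\pi_\beta(\cdot|\hat x)=(1-\beta)\delta_{\hat x}+\beta\,\mathrm{Unif}(\mathcal X)$. Put $\mathcal U_p(p|\hat x)=\mathbb E_{x\sim\pi_\beta(\cdot|\hat x)}[\mathcal U_p(p,x)]$. A price $p$ is optimal given $\hat x$ if $\mathcal U_p(p|\hat x)\ge\mathcal U_p(p'|\hat x)$ for all $p'\ge0$ (optimal prices lie in $\mathcal V$). An optimal pricing rule is a (measurable) map $\phi:\mathcal X\to\Delta(\mathcal V)$ such that for each $\hat x$ the support of $\phi(\hat x)$ consists only of prices optimal given $\hat x$. For $\bullet\in\{p,c\}$ let $U_\bullet^\phi(x)=\mathbb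 E_{\hat x\sim\mathcal M_\beta(x)}\mathbb E_{q\sim\phi(\hat x)}[\mathcal U_\bullet(q,x)]$. Then $\mathcal S_\beta$ is the set of pairs $\big(\sum_x\sigma(x)U_c^\phi(x),\ \sum_x\sigma(x)U_p^\phi(x)\big)$ over all $\sigma\in\Sigma$ and all optimal pricing rules $\phi$ (for parameter $\beta$). For $i\in[K]$, $\bar\beta_i\in(0,1]$ is the unique solution of $$\frac{\bar\beta_i}{1-\bar\beta_i}=\min_{j\in[K]}\frac{K\big(v_i-\mathbf 1(j<i)v_j\big)}{\big[(K+1-j)v_j-(K+1-i)v_i\big]_+},$$ where $[z]_+=\max\{z,0\}$, a positive number divided by $0$ is $+\infty$, and $\bar\beta_i=1$ if the right-hand side is $+\infty$. *)

theory Defs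
  imports "HOL-Probability.Probability"
begin

text \<open>
  A market, i.e. a probability distribution on \<open>{v 1, \<dots>, v K}\<close>, is represented by its vector of
  masses: \<open>x k\<close> is the mass of \<open>v k\<close>, and \<open>x\<close> is \<open>undefined\<close> outside \<open>{1..K}\<close>.
\<close>

type_synonym market = "nat \<Rightarrow> real"

definition markets :: "nat \<Rightarrow> market set" where
  "markets K = {x \<in> extensional {1..K}. (\<forall>k\<in>{1..K}. 0 \<le> x k) \<and> (\<Sum>k=1..K. x k) = 1}"

definition market_space :: "nat \<Rightarrow> market measure" where
  "market_space K = restrict_space (\<Pi>\<^sub>M k\<in>{1..K}. borel) (markets K)"

text \<open>
  The simplex is parametrised affinely by its first \<open>K - 1\<close> coordinates, so the uniform
  distribution on it is the image of normalised Lebesgue measure on the solid simplex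
  \<open>{y. 0 \<le> y, y 1 + \<dots> + y (K - 1) \<le> 1}\<close>.
\<close>

definition solid_simplex :: "nat \<Rightarrow> market measure" where
  "solid_simplex K =
     restrict_space (\<Pi>\<^sub>M k\<in>{1..<K}. lborel)
       {y. (\<forall>k\<in>{1..<K}. 0 \<le> y k) \<and> (\<Sum>k=1..<K. y k) \<le> 1}"

definition unif_market :: "nat \<Rightarrow> market measure" where
  "unif_market K =
     distr (uniform_measure (solid_simplex K) (space (solid_simplex K))) (market_space K)
       (\<lambda>y. \<lambda>k\<in>{1..K}. if k < K then y k else 1 - (\<Sum>j=1..<K. y j))"

definition producer_utility :: "nat \<Rightarrow> (nat \<Rightarrow> real) \<Rightarrow> real \<Rightarrow> market \<Rightarrow> real" where
  "producer_utility K v p x = p * (\<Sum>k=1..K. x k * of_bool (p \<le> v k))"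

definition consumer_utility :: "nat \<Rightarrow> (nat \<Rightarrow> real) \<Rightarrow> real \<Rightarrow> market \<Rightarrow> real" where
  "consumer_utility K v p x = (\<Sum>k=1..K. x k * (v k - p) * of_bool (p \<le> v k))"

definition mechanism :: "nat \<Rightarrow> real \<Rightarrow> market \<Rightarrow> market measure" where
  "mechanism K \<beta> x =
     measure_pmf (bernoulli_pmf \<beta>) \<bind>
       (\<lambda>resample. if resample then unif_market K else return (market_space K) x)"

text \<open>
  Under the uniform prior, the posterior \<open>(1 - \<beta>) \<delta>\<^sub>x + \<beta> Unif\<close> after observing \<open>x\<close> is the same
  mixture as the output distribution of the mechanism at \<open>x\<close>.
\<close>

definition posterior :: "nat \<Rightarrow> real \<Rightarrow> market \<Rightarrow> market measure" where
  "posterior K \<beta> x = mechanism K \<beta> x"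

definition posterior_revenue :: "nat \<Rightarrow> (nat \<Rightarrow> real) \<Rightarrow> real \<Rightarrow> real \<Rightarrow> market \<Rightarrow> real" where
  "posterior_revenue K v \<beta> p xh = (\<integral>x. producer_utility K v p x \<partial>posterior K \<beta> xh)"

definition optimal_price :: "nat \<Rightarrow> (nat \<Rightarrow> real) \<Rightarrow> real \<Rightarrow> market \<Rightarrow> real \<Rightarrow> bool" where
  "optimal_price K v \<beta> xh p \<longleftrightarrow>
     is_arg_max (\<lambda>q. posterior_revenue K v \<beta> q xh) (\<lambda>q. 0 \<le> q) p"

text \<open>Only the values of a pricing rule on \<^term>\<open>markets K\<close> matter.\<close>

definition optimal_pricing_rule ::
    "nat \<Rightarrow> (nat \<Rightarrow> real) \<Rightarrow> real \<Rightarrow> (market \<Rightarrow> real pmf) \<Rightarrow> bool" where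
  "optimal_pricing_rule K v \<beta> \<phi> \<longleftrightarrow>
     (\<forall>k\<in>{1..K}. (\<lambda>xh. pmf (\<phi> xh) (v k)) \<in> borel_measurable (market_space K)) \<and>
     (\<forall>xh\<in>markets K. set_pmf (\<phi> xh) \<subseteq> v ` {1..K} \<and>
        (\<forall>q\<in>set_pmf (\<phi> xh). optimal_price K v \<beta> xh q))"

definition segmentation :: "nat \<Rightarrow> market \<Rightarrow> market pmf \<Rightarrow> bool" where
  "segmentation K xs \<sigma> \<longleftrightarrow>
     finite (set_pmf \<sigma>) \<and> set_pmf \<sigma> \<subseteq> markets K \<and>
     (\<forall>k\<in>{1..K}. (\<Sum>x\<in>set_pmf \<sigma>. pmf \<sigma> x * x k) = xs k)"

text \<open>Here \<open>u\<close> is either \<^term>\<open>consumer_utility K v\<close> or \<^term>\<open>producer_utility K v\<close>.\<close>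

definition expected_utility ::
    "nat \<Rightarrow> real \<Rightarrow> (market \<Rightarrow> real pmf) \<Rightarrow> (real \<Rightarrow> market \<Rightarrow> real) \<Rightarrow> market \<Rightarrow> real" where
  "expected_utility K \<beta> \<phi> u x =
     (\<integral>xh. measure_pmf.expectation (\<phi> xh) (\<lambda>q. u q x) \<partial>mechanism K \<beta> x)"

definition utility_set :: "nat \<Rightarrow> (nat \<Rightarrow> real) \<Rightarrow> market \<Rightarrow> real \<Rightarrow> (real \<times> real) set" where
  "utility_set K v xs \<beta> =
     {(\<Sum>x\<in>set_pmf \<sigma>. pmf \<sigma> x * expected_utility K \<beta> \<phi> (consumer_utility K v) x,
       \<Sum>x\<in>set_pmf \<sigma>. pmf \<sigma> x * expected_utility K \<beta> \<phi> (producer_utility K v) x)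
      | \<sigma> \<phi>. segmentation K xs \<sigma> \<and> optimal_pricing_rule K v \<beta> \<phi>}"

definition max_consumer_utility :: "nat \<Rightarrow> (nat \<Rightarrow> real) \<Rightarrow> market \<Rightarrow> real \<Rightarrow> real" where
  "max_consumer_utility K v xs \<beta> = (GREATEST u. u \<in> fst ` utility_set K v xs \<beta>)"

text \<open>
  On \<^typ>\<open>ereal\<close>, a positive number divided by \<open>0\<close> is \<open>\<infinity>\<close>. Hence the term for \<open>j = i\<close> is \<open>\<infinity>\<close>,
  and the solution is \<open>1\<close> if the minimum is \<open>\<infinity>\<close>.
\<close>

definition beta_bar :: "nat \<Rightarrow> (nat \<Rightarrow> real) \<Rightarrow> nat \<Rightarrow> real" where
  "beta_bar K v i =
     (THE b. b \<in> {0<..1} \<and>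
        ereal b / ereal (1 - b) =
          (MIN j\<in>{1..K}.
             ereal (real K * (v i - of_bool (j < i) * v j)) /
             ereal (max 0 ((real K + 1 - real j) * v j - (real K + 1 - real i) * v i))))"

end

theory Submission
  imports Defs
begin

text \<open>
  All optimal rules are dominated by the one that charges the lowest optimal price, so the maximal
  consumer utility is \<open>(1 - \<beta>) F \<beta> + \<beta> G \<beta>\<close>, where \<open>F \<beta>\<close> is the best segmentation of \<open>xs\<close> and
  \<open>G \<beta>\<close> is the surplus of \<open>xs\<close> under the price set on a uniformly random market. The revenue of
  \<open>v i\<close> on the uniform market is \<open>weight i / K\<close> with \<open>weight i = (K + 1 - i) v i\<close>; both conditions on
  \<open>v\<close> say that \<open>weight\<close> is monotone, so that noise moves all prices in one direction.

  If \<open>weight\<close> decreases, then \<open>F\<close> and \<open>G\<close> increase, and \<open>F \<le> G\<close> for small \<open>\<beta>\<close> when \<open>xs\<close> is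
  concentrated on \<open>v K\<close>, because then \<open>F 0\<close> is nearly \<open>0\<close> while \<open>G 0\<close> is not.

  If \<open>weight\<close> increases, then \<open>G\<close> decreases, but \<open>G \<le> F\<close> may fail. Instead, for \<open>\<beta> \<le> \<beta>'\<close> one
  shows \<open>(1 - \<beta>') F \<beta>' + (\<beta>' - \<beta>) G \<beta>' \<le> (1 - \<beta>) F \<beta>\<close>. The segments that are optimal at
  \<open>\<beta>'\<close> are mixed with further pieces of \<open>xs\<close> that take the place of the lost noise; these
  pieces exist by a transport argument, and their surplus exceeds \<open>G \<beta>'\<close> because a random market
  has a price below \<open>v r\<close> with probability at most \<open>(r - 1) / K\<close>. The latter is a cyclic shift
  argument in the style of the ballot theorem.
\<close>

text \<open>The price drawn on a random market does not depend on the segment, and surplus is linear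
  in the market; this is why the noise contributes a term \<open>G\<close> that the segmentation
  cannot influence. In the case of increasing \<open>weight\<close>, the pieces that replace lost
  noise must not disturb the prices: the piece \<open>U i\<close> has the same mass
  \<open>m i\<close> as segment \<open>i\<close>, and its demand curve lies below that of the
  uniform market and touches it at \<open>i\<close>. Such pieces can add up to \<open>xs\<close>
  only if the demand of \<open>xs\<close> at \<open>v r\<close> is at most
  \<open>(K + 1 - r) / K\<close>, and this is what optimality of \<open>v 1\<close> provides. The
  bound \<open>\<beta> < beta_bar K v i\<close> enters as the statement that on a point mass at
  \<open>v i\<close> the price \<open>v i\<close> still beats every higher one; it allows segments
  to be cleaned of consumers who do not buy. The fraction \<open>(K + 1 - r) / K\<close> then occurs
  twice: it bounds from above the share of the consumers from \<open>v r\<close> on that lie in the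
  rows \<open>i \<ge> r\<close> of \<open>U\<close>, and from below the probability that a random
  market is priced at \<open>v r\<close> or higher.\<close>

declare One_nat_def [simp del]

section \<open>The uniform distribution on markets\<close>

abbreviation cube_measure :: "nat \<Rightarrow> market measure" where
  "cube_measure K \<equiv> \<Pi>\<^sub>M k\<in>{1..<K}. lborel"

definition solid_points :: "nat \<Rightarrow> market set" where
  "solid_points K = {y \<in> space (cube_measure K). (\<forall>k\<in>{1..<K}. 0 \<le> y k) \<and> (\<Sum>k=1..<K. y k) \<le> 1}"

definition lift_market :: "nat \<Rightarrow> market \<Rightarrow> market" where
  "lift_market K y = (\<lambda>k\<in>{1..K}. if k < K then y k else 1 - (\<Sum>j=1..<K. y j))"

interpretation lborel_product: product_sigma_finite "\<lambda>_::nat. lborel :: real measure"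
  by standard

lemma solid_points_sets [measurable]: "solid_points K \<in> sets (cube_measure K)"
  unfolding solid_points_def by measurable

lemma space_solid_simplex: "space (solid_simplex K) = solid_points K"
  by (auto simp: solid_simplex_def solid_points_def space_restrict_space)

lemma sum_split_last:
  fixes f :: "nat \<Rightarrow> real"
  assumes "1 \<le> K"
  shows "(\<Sum>k=1..K. f k) = (\<Sum>k=1..<K. f k) + f K"
proof -
  have "{1..K} = insert K {1..<K}"
    using assms by auto
  then show ?thesis
    by simp
qed

lemma lift_market_sum:
  assumes "1 \<le> K"
  shows "(\<Sum>k=1..K. lift_market K y k) = 1"
  using assms by (simp add: sum_split_last lift_market_def)

lemma lift_market_mem:
  assumes "1 \<le> K" "y \<in> solid_points K"
  shows "lift_market K y \<in> markets K"
  using assms lift_market_sum[OF assms(1), of y]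
  by (auto simp: markets_def solid_points_def) (auto simp: lift_market_def)

lemma lift_market_measurable:
  "lift_market K \<in> cube_measure K \<rightarrow>\<^sub>M (\<Pi>\<^sub>M k\<in>{1..K}. borel)"
  unfolding lift_market_def
proof (rule measurable_restrict)
  fix k assume "k \<in> {1..K}"
  then show "(\<lambda>y. if k < K then y k else 1 - (\<Sum>j=1..<K. y j)) \<in> cube_measure K \<rightarrow>\<^sub>M borel"
    by (cases "k < K") (auto intro!: borel_measurable_diff borel_measurable_sum
        measurable_component_singleton)
qed

lemma solid_simplex_eq: "solid_simplex K = restrict_space (cube_measure K) (solid_points K)"
proof -
  have "solid_points K = {y. (\<forall>k\<in>{1..<K}. 0 \<le> y k) \<and> (\<Sum>k=1..<K. y k) \<le> 1} \<inter> space (cube_measure K)"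
    by (auto simp: solid_points_def)
  then show ?thesis
    by (simp add: solid_simplex_def restrict_space_def Int_assoc)
qed

lemma lift_market_measurable_solid:
  assumes "1 \<le> K"
  shows "lift_market K \<in> solid_simplex K \<rightarrow>\<^sub>M market_space K"
  unfolding solid_simplex_eq market_space_def
  using assms lift_market_mem lift_market_measurable
  by (intro measurable_restrict_space2 measurable_restrict_space1)
    (auto simp: space_restrict_space)

lemma space_market_space: "space (market_space K) = markets K"
  by (auto simp: market_space_def space_restrict_space space_PiM markets_def PiE_def)

lemma box_in_cube:
  assumes "\<And>k. k \<in> {1..<K} \<Longrightarrow> a k \<le> b k"
  shows "emeasure (cube_measure K) (PiE {1..<K} (\<lambda>k. {a k..b k})) = (\<Prod>k=1..<K. ennreal (b k - a k))"
  using assms by (subst lborel_product.emeasure_PiM) auto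

lemma solid_points_finite: "emeasure (cube_measure K) (solid_points K) \<noteq> \<infinity>"
proof -
  have "solid_points K \<subseteq> PiE {1..<K} (\<lambda>k. {0..1})"
  proof
    fix y assume y: "y \<in> solid_points K"
    then have "y k \<le> 1" if "k \<in> {1..<K}" for k
      using that member_le_sum[of k "{1..<K}" y] by (auto simp: solid_points_def)
    then show "y \<in> PiE {1..<K} (\<lambda>k. {0..1})"
      using y by (auto simp: solid_points_def space_PiM PiE_def)
  qed
  then have "emeasure (cube_measure K) (solid_points K)
      \<le> emeasure (cube_measure K) (PiE {1..<K} (\<lambda>k. {0..1}))"
    by (intro emeasure_mono) auto
  also have "\<dots> = 1"
    using box_in_cube[of K "\<lambda>_. 0" "\<lambda>_. 1"] by simp
  finally show ?thesis
    by (auto simp: top_unique)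
qed

lemma corner_sets:
  assumes "2 \<le> K"
  shows "{y \<in> solid_points K. c \<le> y 1} \<in> sets (cube_measure K)"
proof -
  have "1 \<in> {1..<K}"
    using assms by auto
  then show ?thesis
    unfolding solid_points_def by measurable
qed

lemma corner_box_pos:
  assumes "0 < \<epsilon>" "\<epsilon> \<le> 1" "2 \<le> K"
  shows "0 < emeasure (cube_measure K) {y \<in> solid_points K. 1 - \<epsilon> \<le> y 1}"
proof -
  \<comment> \<open>The first coordinate leaves at least \<open>\<epsilon> / 2\<close> of the total
    mass, and the \<open>K - 2\<close> others take at most \<open>\<epsilon> / (2 * K)\<close>
    each.\<close>
  define a b :: "nat \<Rightarrow> real" where "a = (\<lambda>k. if k = 1 then 1 - \<epsilon> else 0)"
    and "b = (\<lambda>k. if k = 1 then 1 - \<epsilon> / 2 else \<epsilon> / (2 * K))"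
  let ?B = "PiE {1..<K} (\<lambda>k. {a k..b k})"
  have ab: "a k < b k" if "k \<in> {1..<K}" for k
    using assms by (auto simp: a_def b_def)
  have "0 < (\<Prod>k=1..<K. ennreal (b k - a k))"
    using ab by (auto simp: zero_less_iff_neq_zero prod_zero_iff ennreal_eq_0_iff not_le)
  also have "\<dots> = emeasure (cube_measure K) ?B"
    using ab by (intro box_in_cube[symmetric]) (auto intro: less_imp_le)
  also have "\<dots> \<le> emeasure (cube_measure K) {y \<in> solid_points K. 1 - \<epsilon> \<le> y 1}"
  proof (rule emeasure_mono)
    show "?B \<subseteq> {y \<in> solid_points K. 1 - \<epsilon> \<le> y 1}"
    proof
      fix y assume y: "y \<in> ?B"
      have le: "a k \<le> y k" "y k \<le> b k" if "k \<in> {1..<K}" for k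
        using y that by (auto simp: PiE_def Pi_def)
      have "{1..<K} = insert 1 {2..<K}"
        using assms by auto
      then have "(\<Sum>k=1..<K. y k) = y 1 + (\<Sum>k=2..<K. y k)"
        by simp
      also have "\<dots> \<le> b 1 + (\<Sum>k=2..<K. \<epsilon> / (2 * K))"
        using le assms by (intro add_mono sum_mono) (fastforce simp: b_def)+
      also have "\<dots> \<le> 1"
        using assms by (auto simp: b_def field_simps of_nat_diff)
      finally have "(\<Sum>k=1..<K. y k) \<le> 1" .
      moreover have "0 \<le> y k" if "k \<in> {1..<K}" for k
        using le(1)[OF that] assms by (auto simp: a_def split: if_splits)
      ultimately show "y \<in> {y \<in> solid_points K. 1 - \<epsilon> \<le> y 1}"
        using y le(1)[of 1] assms by (auto simp: solid_points_def a_def space_PiM PiE_def)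
    qed
    show "{y \<in> solid_points K. 1 - \<epsilon> \<le> y 1} \<in> sets (cube_measure K)"
      using assms by (intro corner_sets) auto
  qed
  finally show ?thesis .
qed

lemma solid_points_pos:
  assumes "2 \<le> K"
  shows "emeasure (cube_measure K) (solid_points K) \<noteq> 0"
proof -
  have "0 < emeasure (cube_measure K) {y \<in> solid_points K. 1 - 1 \<le> y 1}"
    using assms by (intro corner_box_pos) auto
  also have "\<dots> \<le> emeasure (cube_measure K) (solid_points K)"
    by (intro emeasure_mono) auto
  finally show ?thesis
    by auto
qed

lemma solid_total:
  "emeasure (solid_simplex K) (space (solid_simplex K)) = emeasure (cube_measure K) (solid_points K)"
  by (subst space_solid_simplex, subst solid_simplex_eq, subst emeasure_restrict_space) auto

lemma unif_market_eq:
  "unif_market K =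
    distr (uniform_measure (solid_simplex K) (space (solid_simplex K))) (market_space K) (lift_market K)"
  by (simp add: unif_market_def lift_market_def[abs_def])

lemma sets_unif_market [simp, measurable_cong]: "sets (unif_market K) = sets (market_space K)"
  by (simp add: unif_market_def)

lemma space_unif_market [simp]: "space (unif_market K) = markets K"
  by (simp add: unif_market_def space_market_space)

text \<open>Moves computations to the cube, where Fubini applies one coordinate at a time.\<close>

lemma nn_integral_unif_market:
  assumes K: "2 \<le> K" and g: "g \<in> borel_measurable (market_space K)"
  shows "(\<integral>\<^sup>+x. g x \<partial>unif_market K) =
    (\<integral>\<^sup>+y. g (lift_market K y) * indicator (solid_points K) y \<partial>cube_measure K)
      / emeasure (cube_measure K) (solid_points K)"
proof -
  have m: "lift_market K \<in> solid_simplex K \<rightarrow>\<^sub>M market_space K"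
    using K by (intro lift_market_measurable_solid) auto
  have "(\<integral>\<^sup>+x. g x \<partial>unif_market K) =
      (\<integral>\<^sup>+y. g (lift_market K y) \<partial>uniform_measure (solid_simplex K) (space (solid_simplex K)))"
    unfolding unif_market_eq using m g by (subst nn_integral_distr) auto
  also have "\<dots> = (\<integral>\<^sup>+y. g (lift_market K y) * indicator (space (solid_simplex K)) y \<partial>solid_simplex K)
      / emeasure (cube_measure K) (solid_points K)"
    using measurable_compose[OF m g]
    by (subst nn_integral_uniform_measure) (auto simp: solid_total)
  also have "(\<integral>\<^sup>+y. g (lift_market K y) * indicator (space (solid_simplex K)) y \<partial>solid_simplex K)
      = (\<integral>\<^sup>+y. g (lift_market K y) \<partial>solid_simplex K)"
    by (intro nn_integral_cong) auto
  also have "\<dots> = (\<integral>\<^sup>+y. g (lift_market K y) * indicator (solid_points K) y \<partial>cube_measure K)"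
    unfolding solid_simplex_eq by (subst nn_integral_restrict_space) auto
  finally show ?thesis .
qed

lemma prob_space_unif_market:
  assumes "2 \<le> K"
  shows "prob_space (unif_market K)"
  unfolding unif_market_eq
proof (rule prob_space.prob_space_distr)
  show "prob_space (uniform_measure (solid_simplex K) (space (solid_simplex K)))"
    using assms solid_points_pos solid_points_finite
    by (intro prob_space_uniform_measure) (auto simp: solid_total)
  show "lift_market K \<in> uniform_measure (solid_simplex K) (space (solid_simplex K)) \<rightarrow>\<^sub>M market_space K"
    using lift_market_measurable_solid[of K] assms by (simp cong: measurable_cong_sets)
qed

section \<open>Symmetry of the uniform distribution\<close>

lemma nn_integral_cube_split:
  assumes j: "j \<in> {1..<K}" and f: "f \<in> borel_measurable (cube_measure K)"
  shows "(\<integral>\<^sup>+y. f y \<partial>cube_measure K) =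
    (\<integral>\<^sup>+y. (\<integral>\<^sup>+t. f (y(j := t)) \<partial>lborel) \<partial>(\<Pi>\<^sub>M k\<in>{1..<K} - {j}. lborel))"
proof -
  have eq: "{1..<K} = insert j ({1..<K} - {j})"
    using j by auto
  have "f \<in> borel_measurable (\<Pi>\<^sub>M k\<in>insert j ({1..<K} - {j}). lborel)"
    using f eq by simp
  from lborel_product.product_nn_integral_insert[OF _ _ this] show ?thesis
    using eq by simp
qed

text \<open>In the coordinates of the solid simplex the last mass is 1 minus the sum, so this is the
  exchange of the masses of \<open>v j\<close> and \<open>v K\<close>; the new last mass becomes
  \<open>y j\<close> by itself.\<close>

definition reflect :: "nat \<Rightarrow> nat \<Rightarrow> market \<Rightarrow> market" where
  "reflect K j y = y(j := 1 - (\<Sum>k=1..<K. y k))"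

lemma reflect_measurable [measurable]:
  assumes "j \<in> {1..<K}"
  shows "reflect K j \<in> cube_measure K \<rightarrow>\<^sub>M cube_measure K"
proof -
  have eq: "insert j {1..<K} = {1..<K}"
    using assms by auto
  have "(\<lambda>y. 1 - (\<Sum>k=1..<K. y k)) \<in> cube_measure K \<rightarrow>\<^sub>M lborel"
    by measurable
  then have "(\<lambda>y. y(j := 1 - (\<Sum>k=1..<K. y k))) \<in> cube_measure K \<rightarrow>\<^sub>M (\<Pi>\<^sub>M k\<in>insert j {1..<K}. lborel)"
    by (intro measurable_fun_upd[where J="{1..<K}"]) auto
  then show ?thesis
    unfolding reflect_def eq .
qed

text \<open>With the other coordinates fixed, coordinate \<open>j\<close> undergoes
  \<open>t \<mapsto> c - t\<close>, a reflection of the real line, which preserves Lebesgue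
  measure.\<close>

lemma nn_integral_reflect:
  assumes j: "j \<in> {1..<K}" and f: "f \<in> borel_measurable (cube_measure K)"
  shows "(\<integral>\<^sup>+y. f (reflect K j y) \<partial>cube_measure K) = (\<integral>\<^sup>+y. f y \<partial>cube_measure K)"
proof -
  have "(\<integral>\<^sup>+t. f (reflect K j (y(j := t))) \<partial>lborel) = (\<integral>\<^sup>+t. f (y(j := t)) \<partial>lborel)"
    if y: "y \<in> space (\<Pi>\<^sub>M k\<in>{1..<K} - {j}. lborel)" for y
  proof -
    define c where "c = 1 - (\<Sum>k\<in>{1..<K} - {j}. y k)"
    have "(\<Sum>k=1..<K. (y(j := t)) k) = t + (\<Sum>k\<in>{1..<K} - {j}. y k)" for t
      using j by (subst sum.remove[of _ j]) (auto intro!: sum.cong)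
    then have refl: "reflect K j (y(j := t)) = y(j := c + (-1) * t)" for t
      by (auto simp: reflect_def c_def)
    have "(\<lambda>t. y(j := t)) \<in> borel \<rightarrow>\<^sub>M (\<Pi>\<^sub>M k\<in>{1..<K}. lborel)"
    proof -
      have eq: "insert j ({1..<K} - {j}) = {1..<K}"
        using j by auto
      have "(\<lambda>t. y(j := t)) \<in> borel \<rightarrow>\<^sub>M (\<Pi>\<^sub>M k\<in>insert j ({1..<K} - {j}). lborel)"
        using y by (intro measurable_fun_upd[where J="{1..<K} - {j}"]) auto
      then show ?thesis
        unfolding eq .
    qed
    then have "(\<lambda>t. f (y(j := t))) \<in> borel_measurable borel"
      using f by (rule measurable_compose)
    from nn_integral_real_affine[OF this, of "-1" c] show ?thesis
      unfolding refl by simp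
  qed
  then show ?thesis
    using f nn_integral_cube_split[OF j f]
      nn_integral_cube_split[OF j measurable_compose[OF reflect_measurable[OF j] f]]
    by (simp cong: nn_integral_cong)
qed

definition swap_last :: "nat \<Rightarrow> nat \<Rightarrow> market \<Rightarrow> market" where
  "swap_last K j x = x(j := x K, K := x j)"

lemma swap_last_markets:
  assumes "x \<in> markets K" "j \<in> {1..<K}"
  shows "swap_last K j x \<in> markets K"
proof -
  have "(\<Sum>k=1..K. swap_last K j x k) = (\<Sum>k=1..K. x (Transposition.transpose j K k))"
    using assms by (intro sum.cong) (auto simp: swap_last_def Transposition.transpose_def)
  also have "\<dots> = (\<Sum>k=1..K. x k)"
    using assms by (intro sum.reindex_bij_betw bij_betw_transpose_iff) auto
  finally show ?thesis
    using assms by (auto simp: markets_def swap_last_def extensional_def)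
qed

lemma swap_last_measurable [measurable]:
  assumes "j \<in> {1..<K}"
  shows "swap_last K j \<in> market_space K \<rightarrow>\<^sub>M market_space K"
proof -
  have "swap_last K j \<in> (\<Pi>\<^sub>M k\<in>{1..K}. borel) \<rightarrow>\<^sub>M (\<Pi>\<^sub>M k\<in>{1..K}. (borel :: real measure))"
  proof -
    have 1: "(\<lambda>x. x(j := x K)) \<in> (\<Pi>\<^sub>M k\<in>{1..K}. borel) \<rightarrow>\<^sub>M (\<Pi>\<^sub>M k\<in>insert j {1..K}. (borel :: real measure))"
      using assms by (intro measurable_fun_upd[where J="{1..K}"]) auto
    have "(\<lambda>x. (x(j := x K))(K := x j)) \<in> (\<Pi>\<^sub>M k\<in>{1..K}. borel) \<rightarrow>\<^sub>M (\<Pi>\<^sub>M k\<in>insert K (insert j {1..K}). (borel :: real measure))"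
      using assms 1 by (intro measurable_fun_upd[where J="insert j {1..K}"]) (auto simp: insert_absorb)
    then show ?thesis
      using assms by (simp add: swap_last_def[abs_def] insert_absorb)
  qed
  then show ?thesis
    unfolding market_space_def using assms swap_last_markets
    by (intro measurable_restrict_space3) auto
qed

lemma reflect_solid_points:
  assumes j: "j \<in> {1..<K}" and y: "y \<in> solid_points K"
  shows "reflect K j y \<in> solid_points K"
    and "lift_market K (reflect K j y) = swap_last K j (lift_market K y)"
proof -
  have s: "(\<Sum>k=1..<K. reflect K j y k) = 1 - y j"
  proof -
    have "(\<Sum>k=1..<K. reflect K j y k)
        = (1 - (\<Sum>k=1..<K. y k)) + (\<Sum>k\<in>{1..<K} - {j}. reflect K j y k)"
      using j by (subst sum.remove[of _ j]) (auto simp: reflect_def)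
    also have "(\<Sum>k\<in>{1..<K} - {j}. reflect K j y k) = (\<Sum>k\<in>{1..<K} - {j}. y k)"
      by (intro sum.cong) (auto simp: reflect_def)
    also have "(\<Sum>k=1..<K. y k) = y j + (\<Sum>k\<in>{1..<K} - {j}. y k)"
      using j by (subst sum.remove[of _ j]) auto
    finally show ?thesis
      by simp
  qed
  show "reflect K j y \<in> solid_points K"
    using s y j by (auto simp: solid_points_def reflect_def space_PiM PiE_def extensional_def)
  show "lift_market K (reflect K j y) = swap_last K j (lift_market K y)"
  proof
    fix k
    show "lift_market K (reflect K j y) k = swap_last K j (lift_market K y) k"
      using s j by (cases "k = j"; cases "k = K") (auto simp: lift_market_def swap_last_def reflect_def)
  qed
qed

lemma reflect_invol:
  assumes j: "j \<in> {1..<K}"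
  shows "reflect K j (reflect K j y) = y"
proof -
  have "(\<Sum>k=1..<K. reflect K j y k)
      = (1 - (\<Sum>k=1..<K. y k)) + (\<Sum>k\<in>{1..<K} - {j}. y k)"
    using j by (subst sum.remove[of _ j]) (auto simp: reflect_def intro!: sum.cong)
  also have "(\<Sum>k=1..<K. y k) = y j + (\<Sum>k\<in>{1..<K} - {j}. y k)"
    using j by (subst sum.remove[of _ j]) auto
  finally have "(\<Sum>k=1..<K. reflect K j y k) = 1 - y j"
    by simp
  then show ?thesis
    by (simp add: reflect_def[of K j "reflect K j y"]) (simp add: reflect_def)
qed

text \<open>Pulled back to the cube, exchanging two masses becomes \<open>reflect\<close>, which
  preserves both Lebesgue measure and the solid simplex.\<close>

lemma distr_swap_last:
  assumes K: "2 \<le> K" and j: "j \<in> {1..<K}"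
  shows "distr (unif_market K) (market_space K) (swap_last K j) = unif_market K"
proof (rule measure_eqI)
  fix A assume "A \<in> sets (distr (unif_market K) (market_space K) (swap_last K j))"
  then have A [measurable]: "A \<in> sets (market_space K)"
    by simp
  \<comment> \<open>Off the solid simplex \<open>lift_market\<close> leaves
    \<open>markets K\<close>, so measurability is first obtained on the restricted space and then
    extended by 0.\<close>
  have m: "(\<lambda>y. indicator A (lift_market K y) * indicator (solid_points K) y :: ennreal)
      \<in> borel_measurable (cube_measure K)" (is "?h \<in> _")
  proof -
    have "(\<lambda>y. indicator A (lift_market K y) :: ennreal) \<in> borel_measurable (solid_simplex K)"
      using K by (intro measurable_compose[OF lift_market_measurable_solid]) auto
    then show ?thesis
      unfolding solid_simplex_eq by (subst (asm) borel_measurable_restrict_space_iff_ennreal) auto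
  qed
  have "emeasure (distr (unif_market K) (market_space K) (swap_last K j)) A
      = (\<integral>\<^sup>+x. indicator A x \<partial>distr (unif_market K) (market_space K) (swap_last K j))"
    by simp
  also have "\<dots> = (\<integral>\<^sup>+x. indicator A (swap_last K j x) \<partial>unif_market K)"
    using j by (subst nn_integral_distr) auto
  also have "\<dots> = (\<integral>\<^sup>+y. indicator A (swap_last K j (lift_market K y)) * indicator (solid_points K) y
      \<partial>cube_measure K) / emeasure (cube_measure K) (solid_points K)"
    using K j by (subst nn_integral_unif_market) auto
  also have "(\<integral>\<^sup>+y. indicator A (swap_last K j (lift_market K y)) * indicator (solid_points K) y
      \<partial>cube_measure K) = (\<integral>\<^sup>+y. ?h (reflect K j y) \<partial>cube_measure K)"
  proof (rule nn_integral_cong)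
    fix y
    show "indicator A (swap_last K j (lift_market K y)) * indicator (solid_points K) y = ?h (reflect K j y)"
      using reflect_solid_points[OF j, of y] reflect_solid_points[OF j, of "reflect K j y"]
        reflect_invol[OF j, of y]
      by (cases "y \<in> solid_points K") (auto simp: indicator_def)
  qed
  also have "\<dots> = (\<integral>\<^sup>+y. ?h y \<partial>cube_measure K)"
    using j m by (rule nn_integral_reflect)
  also have "\<dots> / emeasure (cube_measure K) (solid_points K) = (\<integral>\<^sup>+x. indicator A x \<partial>unif_market K)"
    using K by (subst nn_integral_unif_market) auto
  finally show "emeasure (distr (unif_market K) (market_space K) (swap_last K j)) A = emeasure (unif_market K) A"
    by simp
qed simp

section \<open>Demand at each price: ties, and markets near a vertex\<close>

definition tail :: "nat \<Rightarrow> market \<Rightarrow> nat \<Rightarrow> real" where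
  "tail K x i = (\<Sum>k=i..K. x k)"

lemma market_component_measurable:
  assumes "k \<in> {1..K}"
  shows "(\<lambda>x. x k) \<in> borel_measurable (market_space K)"
  unfolding market_space_def using assms
  by (intro measurable_restrict_space1 measurable_component_singleton)

lemma tail_measurable:
  assumes "1 \<le> i"
  shows "(\<lambda>x. tail K x i) \<in> borel_measurable (market_space K)"
  unfolding tail_def using assms by (intro borel_measurable_sum market_component_measurable) auto

lemma tail_lift_market:
  assumes "1 \<le> i" "i \<le> K"
  shows "tail K (lift_market K y) i = 1 - (\<Sum>k=1..<i. y k)"
proof -
  have "{1..K} = {1..<i} \<union> {i..K}"
    using assms by auto
  then have "1 = (\<Sum>k=1..<i. lift_market K y k) + tail K (lift_market K y) i"
    using lift_market_sum[of K y] assms by (simp add: tail_def sum.union_disjoint ivl_disj_int)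
  also have "(\<Sum>k=1..<i. lift_market K y k) = (\<Sum>k=1..<i. y k)"
    using assms by (intro sum.cong) (auto simp: lift_market_def)
  finally show ?thesis
    by simp
qed

text \<open>In the coordinate \<open>y l\<close> the tail at \<open>j > l\<close> has slope
  \<open>-1\<close>, while the tail at \<open>l\<close> is constant. For \<open>c \<noteq> 0\<close>
  a tie thus determines \<open>y l\<close>, which is a null event on every line in direction
  \<open>l\<close>.\<close>

lemma AE_unif_market_no_tie:
  assumes K: "2 \<le> K" and lj: "1 \<le> l" "l < j" "j \<le> K" and c: "c \<noteq> 0"
  shows "AE x in unif_market K. c * tail K x j \<noteq> d * tail K x l"
proof -
  define E where "E = {x \<in> space (market_space K). c * tail K x j = d * tail K x l}"
  have E [measurable]: "E \<in> sets (market_space K)"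
  proof -
    have [measurable]: "(\<lambda>x. tail K x j) \<in> borel_measurable (market_space K)"
        "(\<lambda>x. tail K x l) \<in> borel_measurable (market_space K)"
      using lj by (auto intro!: tail_measurable)
    show ?thesis
      unfolding E_def by measurable
  qed
  define D where "D = {y \<in> space (cube_measure K). c * (1 - (\<Sum>k=1..<j. y k)) = d * (1 - (\<Sum>k=1..<l. y k))}"
  have D [measurable]: "D \<in> sets (cube_measure K)"
  proof -
    have "(\<lambda>y. \<Sum>k=1..<j. y k) \<in> borel_measurable (cube_measure K)"
        "(\<lambda>y. \<Sum>k=1..<l. y k) \<in> borel_measurable (cube_measure K)"
      using lj by (auto intro!: borel_measurable_sum measurable_component_singleton)
    then show ?thesis
      unfolding D_def by measurable
  qed
  have l: "l \<in> {1..<K}"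
    using lj by auto
  have inner: "(\<integral>\<^sup>+t. indicator D (y(l := t)) \<partial>lborel) = 0" for y
  proof -
    define a b where "a = (\<Sum>k\<in>{1..<j} - {l}. y k)" and "b = (\<Sum>k=1..<l. y k)"
    have "t = 1 - a - d * (1 - b) / c" if "y(l := t) \<in> D" for t
    proof -
      have "(\<Sum>k=1..<j. (y(l := t)) k) = t + a"
        unfolding a_def using lj by (subst sum.remove[of _ l]) (auto intro!: sum.cong)
      moreover have "(\<Sum>k=1..<l. (y(l := t)) k) = b"
        unfolding b_def by (intro sum.cong) auto
      ultimately have "c * (1 - (t + a)) = d * (1 - b)"
        using that by (simp add: D_def)
      then show ?thesis
        using c by (simp add: field_simps)
    qed
    then have "(\<integral>\<^sup>+t. indicator D (y(l := t)) \<partial>lborel) \<le> (\<integral>\<^sup>+t. indicator {1 - a - d * (1 - b) / c} t \<partial>lborel)"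
      by (intro nn_integral_mono) (auto simp: indicator_def)
    then show ?thesis
      by simp
  qed
  have "emeasure (unif_market K) E = (\<integral>\<^sup>+x. indicator E x \<partial>unif_market K)"
    by simp
  also have "\<dots> = (\<integral>\<^sup>+y. indicator E (lift_market K y) * indicator (solid_points K) y \<partial>cube_measure K)
      / emeasure (cube_measure K) (solid_points K)"
    using K by (subst nn_integral_unif_market) auto
  also have "(\<integral>\<^sup>+y. indicator E (lift_market K y) * indicator (solid_points K) y \<partial>cube_measure K)
      \<le> (\<integral>\<^sup>+y. indicator D y \<partial>cube_measure K)"
    using lj by (intro nn_integral_mono) (auto simp: indicator_def E_def D_def tail_lift_market)
  also have "\<dots> = 0"
    using nn_integral_cube_split[OF l, of "indicator D"] inner by simp
  finally have "emeasure (unif_market K) E = 0"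
    by (simp add: divide_right_mono_ennreal)
  then have "AE x in unif_market K. x \<notin> E"
    by (intro AE_not_in) (auto simp: null_sets_def)
  then show ?thesis
    by (rule AE_mp) (auto simp: E_def space_market_space)
qed

lemma unif_market_corner_pos:
  assumes "0 < \<epsilon>" "\<epsilon> \<le> 1" "2 \<le> K"
  shows "0 < measure (unif_market K) {x \<in> markets K. 1 - \<epsilon> \<le> x 1}"
proof -
  interpret prob_space "unif_market K"
    using assms by (intro prob_space_unif_market)
  let ?A = "{x \<in> markets K. 1 - \<epsilon> \<le> x 1}"
  have "1 \<in> {1..K}"
    using assms by auto
  then have [measurable]: "(\<lambda>x. x 1) \<in> borel_measurable (market_space K)"
    by (rule market_component_measurable)
  have A [measurable]: "?A \<in> sets (market_space K)"
    unfolding space_market_space[symmetric] by measurable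
  have "0 < emeasure (cube_measure K) {y \<in> solid_points K. 1 - \<epsilon> \<le> y 1}"
    using assms by (rule corner_box_pos)
  also have "\<dots> = (\<integral>\<^sup>+y. indicator {y \<in> solid_points K. 1 - \<epsilon> \<le> y 1} y \<partial>cube_measure K)"
    using corner_sets[of K "1 - \<epsilon>"] assms by (subst nn_integral_indicator) auto
  also have "\<dots> = (\<integral>\<^sup>+y. indicator ?A (lift_market K y) * indicator (solid_points K) y \<partial>cube_measure K)"
    using assms lift_market_mem[of K]
    by (intro nn_integral_cong) (auto simp: indicator_def lift_market_def)
  finally have "0 < (\<integral>\<^sup>+x. indicator ?A x \<partial>unif_market K)"
    using assms solid_points_finite[of K]
    by (subst nn_integral_unif_market) (auto simp: ennreal_zero_less_divide top.not_eq_extremum)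
  then show ?thesis
    by (simp add: emeasure_eq_measure)
qed

section \<open>Cyclic shifts and running means\<close>

lemma sum_lessThan_add:
  fixes f :: "nat \<Rightarrow> real"
  shows "(\<Sum>t<a + b. f t) = (\<Sum>t<a. f t) + (\<Sum>t<b. f (a + t))"
  by (induction b) (auto simp: ac_simps)

text \<open>Whole periods split off, each contributing at most \<open>\<mu> * K\<close>.\<close>

lemma periodic_sum_le:
  fixes \<xi> :: "nat \<Rightarrow> real" and \<mu> :: real
  assumes per: "\<And>n. \<xi> (n + K) = \<xi> n" and K: "1 \<le> K"
    and le: "\<And>n. n \<in> {1..K} \<Longrightarrow> (\<Sum>t<n. \<xi> (s + t)) \<le> \<mu> * n"
  shows "(\<Sum>t<n. \<xi> (s + t)) \<le> \<mu> * n"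
proof (induction n rule: less_induct)
  case (less n)
  show ?case
  proof (cases "n \<le> K")
    case True
    then show ?thesis
      using le[of n] by (cases "n = 0") auto
  next
    case False
    define n' where "n' = n - K"
    have n: "n = K + n'" "n' < n"
      using False K by (auto simp: n'_def)
    have "(\<Sum>t<n. \<xi> (s + t)) = (\<Sum>t<K. \<xi> (s + t)) + (\<Sum>t<n'. \<xi> (s + t + K))"
      unfolding n(1) by (subst sum_lessThan_add) (simp add: ac_simps)
    also have "\<dots> \<le> \<mu> * K + \<mu> * n'"
      using le[of K] less.IH[OF n(2)] K per by simp
    finally show ?thesis
      by (simp add: n(1) algebra_simps)
  qed
qed

text \<open>In the application the sequence is the market read cyclically from \<open>v K\<close>
  downwards. A mean of length \<open>n\<close> is then the average mass of the top \<open>n\<close>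
  values after a rotation by \<open>s\<close>, and \<open>m = K + 1 - r\<close> separates averages
  starting at \<open>v r\<close> or higher from those starting lower.\<close>

definition early_peak :: "nat \<Rightarrow> nat \<Rightarrow> (nat \<Rightarrow> real) \<Rightarrow> nat \<Rightarrow> bool" where
  "early_peak K m \<xi> s \<longleftrightarrow>
     (\<exists>n\<in>{1..m}. \<forall>n'\<in>{m<..K}. (\<Sum>t<n'. \<xi> (s + t)) / n' \<le> (\<Sum>t<n. \<xi> (s + t)) / n)"

text \<open>
  If the running mean from \<open>s\<close> peaks at some length \<open>L > m\<close>, then \<open>s + L - 1, \<dots>, s + L - m\<close> are
  starting points with an early peak: from there the walk already exceeds slope \<open>\<mu>\<close> at \<open>s + L\<close>.
\<close>
lemma card_early_peak:
  fixes \<xi> :: "nat \<Rightarrow> real"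
  assumes per: "\<And>n. \<xi> (n + K) = \<xi> n" and m: "1 \<le> m" "m \<le> K"
  shows "m \<le> card {s. s < K \<and> early_peak K m \<xi> s}"
proof (cases "\<forall>s<K. early_peak K m \<xi> s")
  case True
  then have "{s. s < K \<and> early_peak K m \<xi> s} = {..<K}"
    by auto
  then show ?thesis
    using m by simp
next
  case False
  then obtain s where s: "s < K" "\<not> early_peak K m \<xi> s"
    by auto
  define P where "P = (\<lambda>s n. \<Sum>t<n. \<xi> (s + t))"
  have P_add: "P s (a + b) = P s a + P (s + a) b" for s a b
    unfolding P_def by (subst sum_lessThan_add) (simp add: ac_simps)
  have per_mod: "\<xi> (n mod K) = \<xi> n" for n
  proof -
    have "\<xi> (i + q * K) = \<xi> i" for i q
    proof (induction q)
      case (Suc q)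
      have "\<xi> (i + Suc q * K) = \<xi> (i + q * K + K)"
        by (simp add: algebra_simps)
      then show ?case
        using Suc per by simp
    qed simp
    from this[of "n mod K" "n div K"] show ?thesis
      by simp
  qed
  have P_mod: "P (n mod K) l = P n l" for n l
    unfolding P_def
  proof (rule sum.cong)
    fix t
    show "\<xi> (n mod K + t) = \<xi> (n + t)"
      using per_mod[of "n mod K + t"] per_mod[of "n + t"] by (simp add: mod_add_left_eq)
  qed simp
  have ne: "{m<..K} \<noteq> {}"
    using s m unfolding early_peak_def by (metis atLeastAtMost_iff empty_iff order_refl)
  let ?I = "(\<lambda>n. P s n / n) ` {m<..K}"
  have "Max ?I \<in> ?I"
    using ne by (intro Max_in) auto
  then obtain L where L: "L \<in> {m<..K}" and L_eq: "Max ?I = P s L / L"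
    by blast
  have L_max: "P s n / n \<le> P s L / L" if "n \<in> {m<..K}" for n
    unfolding L_eq[symmetric] using that by (intro Max_ge) auto
  define \<mu> where "\<mu> = P s L / L"
  \<comment> \<open>For \<open>n \<le> m\<close> the failure of \<open>early_peak\<close> at
    \<open>s\<close> yields a length above \<open>m\<close> with a larger mean, which is at most
    \<open>\<mu>\<close> by the choice of \<open>L\<close>.\<close>
  have "P s n \<le> \<mu> * n" if n: "n \<in> {1..K}" for n
  proof -
    have "P s n / n \<le> \<mu>"
    proof (cases "n \<le> m")
      case True
      then have "n \<in> {1..m}"
        using n by simp
      then have "\<exists>n'\<in>{m<..K}. P s n / n < P s n' / n'"
        using s(2) unfolding early_peak_def P_def by (simp add: not_le)
      then obtain n' where "n' \<in> {m<..K}" "P s n / n < P s n' / n'"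
        by blast
      then show ?thesis
        using L_max[of n'] by (simp add: \<mu>_def)
    next
      case False
      then show ?thesis
        using L_max[of n] n by (simp add: \<mu>_def)
    qed
    then show ?thesis
      using n by (simp add: field_simps)
  qed
  then have bound: "P s n \<le> \<mu> * n" for n
    unfolding P_def by (intro periodic_sum_le[of \<xi> K s \<mu> n]) (use per m in auto)
  have PL: "P s L = \<mu> * L"
    using L by (auto simp: \<mu>_def)
  have good: "early_peak K m \<xi> ((s + L - i) mod K)" if i: "i \<in> {1..m}" for i
  proof -
    define a where "a = L - i"
    have a: "s + L - i = s + a" "a + i = L"
      using i L by (auto simp: a_def)
    \<comment> \<open>\<open>g\<close> is how far the walk from \<open>s\<close> lies below the line
      of slope \<open>\<mu>\<close> after \<open>a\<close> steps. Seen from \<open>s + a\<close> it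
      can exceed this slope by at most \<open>g\<close>, and does so after exactly \<open>i\<close>
      steps, where it meets the line at length \<open>L\<close>. In a mean longer than
      \<open>i\<close> the excess \<open>g\<close> counts less.\<close>
    define g where "g = \<mu> * a - P s a"
    have "0 \<le> g"
      using bound[of a] by (simp add: g_def)
    have Pi: "P (s + a) i = \<mu> * i + g"
    proof -
      have "real L = real a + real i"
        using a(2) by (simp flip: of_nat_add)
      then show ?thesis
        using P_add[of s a i] PL unfolding a(2) by (simp add: g_def algebra_simps)
    qed
    have "P (s + a) n' / n' \<le> P (s + a) i / i" if n': "n' \<in> {m<..K}" for n'
    proof -
      have "P (s + a) n' \<le> \<mu> * n' + g"
        using P_add[of s a n'] bound[of "a + n'"] by (simp add: g_def algebra_simps)
      then have "P (s + a) n' / n' \<le> \<mu> + g / n'"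
        using n' by (simp add: field_simps)
      also have "\<dots> \<le> \<mu> + g / i"
        using \<open>0 \<le> g\<close> n' i by (intro add_left_mono divide_left_mono) auto
      also have "\<dots> = P (s + a) i / i"
        unfolding Pi using i by (simp add: field_simps)
      finally show ?thesis .
    qed
    then have "\<forall>n'\<in>{m<..K}. P ((s + a) mod K) n' / n' \<le> P ((s + a) mod K) i / i"
      by (simp add: P_mod)
    then show ?thesis
      using i unfolding early_peak_def P_def a(1) by auto
  qed
  have inj: "inj_on (\<lambda>i. (s + L - i) mod K) {1..m}"
  proof (rule linorder_inj_onI')
    fix i j assume ij: "i \<in> {1..m}" "j \<in> {1..m}" "i < j"
    show "(s + L - i) mod K \<noteq> (s + L - j) mod K"
    proof
      assume "(s + L - i) mod K = (s + L - j) mod K"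
      then have "K dvd (s + L - i) - (s + L - j)"
        using ij by (subst mod_eq_dvd_iff_nat[symmetric]) auto
      moreover have "(s + L - i) - (s + L - j) = j - i"
        using ij L by auto
      ultimately show False
        using ij m by (auto dest!: dvd_imp_le)
    qed
  qed
  have "m = card ((\<lambda>i. (s + L - i) mod K) ` {1..m})"
    using inj by (simp add: card_image)
  also have "\<dots> \<le> card {s. s < K \<and> early_peak K m \<xi> s}"
    using good m by (intro card_mono) auto
  finally show ?thesis .
qed

section \<open>Cyclic rotation of random markets\<close>

definition rotate_market :: "nat \<Rightarrow> market \<Rightarrow> market" where
  "rotate_market K x = (\<lambda>k\<in>{1..K}. if k = 1 then x K else x (k - 1))"

lemma rotate_market_preserves:
  assumes K: "2 \<le> K"
  shows "rotate_market K \<in> market_space K \<rightarrow>\<^sub>M market_space K"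
    and "distr (unif_market K) (market_space K) (rotate_market K) = unif_market K"
proof -
  text \<open>The rotation is the product of the transpositions \<open>(1 K), \<dots>, (K - 1 K)\<close>.\<close>
  have *: "\<exists>f \<in> market_space K \<rightarrow>\<^sub>M market_space K.
      distr (unif_market K) (market_space K) f = unif_market K \<and>
      (\<forall>x\<in>markets K. f x = (\<lambda>k\<in>{1..K}. if k = K then x m else if k = 1 then x K else if k \<le> m then x (k - 1) else x k))"
    if "1 \<le> m" "m < K" for m
    using that
  proof (induction m rule: dec_induct)
    case base
    have "swap_last K 1 x = (\<lambda>k\<in>{1..K}. if k = K then x 1 else if k = 1 then x K else if k \<le> 1 then x (k - 1) else x k)"
      if "x \<in> markets K" for x
      using that K by (fastforce simp: swap_last_def markets_def extensional_def)
    then show ?case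
      using K distr_swap_last[of K 1] swap_last_measurable[of 1 K]
      by (intro bexI[of _ "swap_last K 1"]) auto
  next
    case (step m)
    then have "m < K"
      by simp
    from step.IH[OF this] obtain f where f: "f \<in> market_space K \<rightarrow>\<^sub>M market_space K"
      "distr (unif_market K) (market_space K) f = unif_market K"
      "\<And>x. x \<in> markets K \<Longrightarrow> f x = (\<lambda>k\<in>{1..K}. if k = K then x m else if k = 1 then x K else if k \<le> m then x (k - 1) else x k)"
      by blast
    have j: "Suc m \<in> {1..<K}"
      using step by auto
    have "distr (unif_market K) (market_space K) (swap_last K (Suc m) \<circ> f)
        = distr (distr (unif_market K) (market_space K) f) (market_space K) (swap_last K (Suc m))"
      using f j by (subst distr_distr) auto
    also have "\<dots> = unif_market K"
      using f j K by (simp add: distr_swap_last)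
    finally have "distr (unif_market K) (market_space K) (swap_last K (Suc m) \<circ> f) = unif_market K" .
    moreover have "(swap_last K (Suc m) \<circ> f) x
        = (\<lambda>k\<in>{1..K}. if k = K then x (Suc m) else if k = 1 then x K else if k \<le> Suc m then x (k - 1) else x k)"
      if "x \<in> markets K" for x
      using that j step.hyps by (auto simp: swap_last_def f(3) fun_eq_iff)
    ultimately show ?case
      using f j by (intro bexI[of _ "swap_last K (Suc m) \<circ> f"]) (auto intro!: measurable_comp simp del: comp_apply)
  qed
  obtain f where f: "f \<in> market_space K \<rightarrow>\<^sub>M market_space K"
      "distr (unif_market K) (market_space K) f = unif_market K"
      "\<And>x. x \<in> markets K \<Longrightarrow> f x = (\<lambda>k\<in>{1..K}. if k = K then x (K - 1) else if k = 1 then x K else if k \<le> K - 1 then x (k - 1) else x k)"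
  proof -
    have "1 \<le> K - 1" "K - 1 < K"
      using K by auto
    from *[OF this] show ?thesis
      using that by blast
  qed
  have eq: "f x = rotate_market K x" if "x \<in> markets K" for x
    using that K by (auto simp: f(3) rotate_market_def fun_eq_iff)
  show "rotate_market K \<in> market_space K \<rightarrow>\<^sub>M market_space K"
    using f(1) eq by (subst measurable_cong[of _ _ f]) (auto simp: space_market_space)
  show "distr (unif_market K) (market_space K) (rotate_market K) = unif_market K"
    using f(2) eq distr_cong[of "unif_market K" "unif_market K" "market_space K" "market_space K" "rotate_market K" f]
    by simp
qed

text \<open>Counted downwards from \<open>K\<close>, positions are shifted by
  \<open>t \<mapsto> t + 1\<close> modulo \<open>K\<close>, the form that \<open>early_peak\<close>
  expects.\<close>

lemma rotate_market_iterate: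
  assumes "t < K"
  shows "((rotate_market K ^^ s) x) (K - t) = x (K - (s + t) mod K)"
  using assms
proof (induction s arbitrary: t)
  case (Suc s)
  show ?case
  proof (cases "Suc t < K")
    case True
    then have "((rotate_market K ^^ Suc s) x) (K - t) = ((rotate_market K ^^ s) x) (K - (t + 1))"
      by (auto simp: rotate_market_def)
    then show ?thesis
      using Suc.IH[OF True] by (simp add: Suc_eq_plus1 ac_simps del: funpow.simps)
  next
    case False
    then have t: "t = K - 1" "1 \<le> K"
      using Suc.prems by auto
    then have "((rotate_market K ^^ Suc s) x) (K - t) = ((rotate_market K ^^ s) x) (K - 0)"
      by (auto simp: rotate_market_def)
    also have "\<dots> = x (K - (s + 0) mod K)"
      using t by (intro Suc.IH) auto
    also have "(s + 0) mod K = (Suc s + t) mod K"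
      using t by simp
    finally show ?thesis .
  qed
qed simp

lemma tail_rev:
  assumes "n \<le> K"
  shows "tail K x (K + 1 - n) = (\<Sum>t<n. x (K - t))"
  unfolding tail_def using assms
  by (intro sum.reindex_bij_witness[of _ "\<lambda>t. K - t" "\<lambda>k. K - k"]) auto

text \<open>\<open>tail K x i / (real K + 1 - real i)\<close> is the average mass of the values from
  \<open>v i\<close> up. If \<open>weight\<close> increases, an index whose average is larger than
  that of every lower index also has the higher score, so up to ties this event excludes prices
  below \<open>v r\<close>.\<close>

definition high_mean :: "nat \<Rightarrow> nat \<Rightarrow> market \<Rightarrow> bool" where
  "high_mean K r x \<longleftrightarrow>
     (\<exists>j\<in>{r..K}. \<forall>l\<in>{1..<r}. tail K x l / (real K + 1 - real l) \<le> tail K x j / (real K + 1 - real j))"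

text \<open>A running mean of length \<open>n\<close> is the average from index
  \<open>K + 1 - n\<close> up; the lengths up to \<open>K + 1 - r\<close> are the indices from
  \<open>r\<close> on.\<close>

lemma high_mean_rotate:
  assumes r: "1 \<le> r" "r \<le> K" and ep: "early_peak K (K + 1 - r) (\<lambda>t. x (K - t mod K)) s"
  shows "high_mean K r ((rotate_market K ^^ s) x)"
proof -
  let ?y = "(rotate_market K ^^ s) x"
  have tl: "tail K ?y l = (\<Sum>t<K + 1 - l. x (K - (s + t) mod K))" if "1 \<le> l" "l \<le> K" for l
    using that tail_rev[of "K + 1 - l" K ?y] by (auto simp: rotate_market_iterate)
  obtain n where n: "n \<in> {1..K + 1 - r}" and le: "\<And>n'. n' \<in> {K + 1 - r<..K} \<Longrightarrow>
      (\<Sum>t<n'. x (K - (s + t) mod K)) / n' \<le> (\<Sum>t<n. x (K - (s + t) mod K)) / n"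
    using ep unfolding early_peak_def by blast
  show ?thesis
    unfolding high_mean_def
  proof (intro bexI ballI)
    show "K + 1 - n \<in> {r..K}"
      using n by auto
    fix l assume l: "l \<in> {1..<r}"
    have "(\<Sum>t<K + 1 - l. x (K - (s + t) mod K)) / real (K + 1 - l)
        \<le> (\<Sum>t<n. x (K - (s + t) mod K)) / n"
      using l r by (intro le) auto
    moreover have "tail K ?y (K + 1 - n) = (\<Sum>t<n. x (K - (s + t) mod K))"
    proof -
      have "1 \<le> K + 1 - n" "K + 1 - n \<le> K" "K + 1 - (K + 1 - n) = n"
        using n r by auto
      with tl[of "K + 1 - n"] show ?thesis
        by simp
    qed
    moreover have "real K + 1 - real (K + 1 - n) = n"
    proof -
      have "n \<le> K + 1"
        using n by auto
      then show ?thesis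
        by (simp add: of_nat_diff)
    qed
    ultimately show "tail K ?y l / (real K + 1 - real l) \<le> tail K ?y (K + 1 - n) / (real K + 1 - real (K + 1 - n))"
      using l r by (simp add: tl of_nat_diff)
  qed
qed

lemma high_mean_sets [measurable]:
  assumes "1 \<le> r"
  shows "{x \<in> markets K. high_mean K r x} \<in> sets (market_space K)"
proof -
  have *: "Measurable.pred (market_space K)
      (\<lambda>x. tail K x l / (real K + 1 - real l) \<le> tail K x j / (real K + 1 - real j))"
    if "1 \<le> l" "1 \<le> j" for l j
  proof -
    have [measurable]: "(\<lambda>x. tail K x l) \<in> borel_measurable (market_space K)"
        "(\<lambda>x. tail K x j) \<in> borel_measurable (market_space K)"
      using that by (auto intro!: tail_measurable)
    show ?thesis
      unfolding pred_def by (intro borel_measurable_le borel_measurable_divide borel_measurable_const) measurable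
  qed
  have "Measurable.pred (market_space K) (high_mean K r)"
    unfolding high_mean_def using assms by (intro pred_intros_finite *) auto
  then show ?thesis
    by (simp add: pred_def space_market_space)
qed

text \<open>All \<open>K\<close> rotations of a random market have the same law, so \<open>K\<close>
  times the probability is the expected number of rotations in the event. By
  \<open>card_early_peak\<close> this number is at least \<open>K + 1 - r\<close> for every
  market.\<close>

lemma prob_high_mean:
  assumes K: "2 \<le> K" and r: "1 \<le> r" "r \<le> K"
  shows "(real K + 1 - real r) / K \<le> measure (unif_market K) {x \<in> markets K. high_mean K r x}"
proof -
  interpret prob_space "unif_market K"
    using K by (rule prob_space_unif_market)
  define H where "H = {x \<in> markets K. high_mean K r x}"
  have H [measurable]: "H \<in> sets (market_space K)"
    unfolding H_def using r by (intro high_mean_sets)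
  have rot: "rotate_market K ^^ s \<in> market_space K \<rightarrow>\<^sub>M market_space K \<and>
      distr (unif_market K) (market_space K) (rotate_market K ^^ s) = unif_market K" for s
  proof (induction s)
    case 0
    show ?case
      by (auto simp: id_def distr_id2)
  next
    case (Suc s)
    then have "distr (unif_market K) (market_space K) (rotate_market K \<circ> (rotate_market K ^^ s))
        = distr (distr (unif_market K) (market_space K) (rotate_market K ^^ s)) (market_space K) (rotate_market K)"
      using rotate_market_preserves[OF K] by (subst distr_distr) auto
    then show ?case
      using Suc rotate_market_preserves[OF K] unfolding funpow.simps(2)
      by (intro conjI measurable_comp[of _ _ "market_space K"]) (auto simp del: comp_apply)
  qed
  have rot_m [measurable]: "rotate_market K ^^ s \<in> market_space K \<rightarrow>\<^sub>M market_space K" for s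
    using rot by blast
  have eq: "prob H = (\<integral>x. indicator H ((rotate_market K ^^ s) x) \<partial>unif_market K)" for s
  proof -
    have "prob H = (\<integral>x. indicator H x \<partial>distr (unif_market K) (market_space K) (rotate_market K ^^ s))"
      using rot[of s] by (simp add: Int_absorb2 H_def)
    also have "\<dots> = (\<integral>x. indicator H ((rotate_market K ^^ s) x) \<partial>unif_market K)"
      by (subst integral_distr) auto
    finally show ?thesis .
  qed
  have int: "integrable (unif_market K) (\<lambda>x. indicator H ((rotate_market K ^^ s) x) :: real)" for s
    by (intro integrable_const_bound[where B=1]) (auto intro!: measurable_compose[OF rot_m])
  have "real K + 1 - real r = (\<integral>x. real K + 1 - real r \<partial>unif_market K)"
    using prob_space by simp
  also have "\<dots> \<le> (\<integral>x. (\<Sum>s<K. indicator H ((rotate_market K ^^ s) x)) \<partial>unif_market K)"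
  proof (rule integral_mono)
    fix x assume "x \<in> space (unif_market K)"
    then have x: "x \<in> markets K"
      by simp
    let ?S = "{s. s < K \<and> early_peak K (K + 1 - r) (\<lambda>t. x (K - t mod K)) s}"
    have "real K + 1 - real r = real (K + 1 - r)"
      using r by (simp add: of_nat_diff)
    also have "\<dots> \<le> real (card ?S)"
      using r by (subst of_nat_le_iff, intro card_early_peak) auto
    also have "\<dots> = (\<Sum>s\<in>?S. 1)"
      by simp
    also have "\<dots> = (\<Sum>s\<in>?S. indicator H ((rotate_market K ^^ s) x))"
    proof (rule sum.cong)
      fix s assume "s \<in> ?S"
      then have "high_mean K r ((rotate_market K ^^ s) x)"
        using r by (intro high_mean_rotate) auto
      moreover have "(rotate_market K ^^ s) x \<in> markets K"
        using measurable_space[OF rot_m] x by (simp add: space_market_space)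
      ultimately show "1 = indicator H ((rotate_market K ^^ s) x)"
        by (simp add: H_def)
    qed simp
    also have "\<dots> \<le> (\<Sum>s<K. indicator H ((rotate_market K ^^ s) x))"
      by (intro sum_mono2) auto
    finally show "real K + 1 - real r \<le> (\<Sum>s<K. indicator H ((rotate_market K ^^ s) x))" .
  qed (use int in auto)
  also have "\<dots> = (\<Sum>s<K. prob H)"
    using int eq by (subst Bochner_Integration.integral_sum) auto
  finally show ?thesis
    using K by (simp add: H_def field_simps)
qed

section \<open>A transport problem with interval constraints\<close>

lemma bounded_split:
  fixes c :: "nat \<Rightarrow> real"
  assumes "finite I" and c: "\<And>i. i \<in> I \<Longrightarrow> 0 \<le> c i" and R: "0 \<le> R" "R \<le> sum c I"
  obtains J where "\<And>i. i \<in> I \<Longrightarrow> 0 \<le> J i" "\<And>i. i \<in> I \<Longrightarrow> J i \<le> c i" "sum J I = R"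
proof (cases "sum c I = 0")
  case True
  then show ?thesis
    using R c by (intro that[of "\<lambda>_. 0"]) auto
next
  case False
  then have pos: "0 < sum c I"
    using R by auto
  show ?thesis
  proof (rule that[of "\<lambda>i. c i * (R / sum c I)"])
    fix i assume i: "i \<in> I"
    show "0 \<le> c i * (R / sum c I)"
      using c[OF i] R pos by simp
    show "c i * (R / sum c I) \<le> c i"
      using c[OF i] R pos by (intro mult_right_le_one_le) auto
  next
    show "(\<Sum>i\<in>I. c i * (R / sum c I)) = R"
      unfolding sum_distrib_right[symmetric] using pos by simp
  qed
qed

lemma tail_fun_upd_above:
  "r < q \<Longrightarrow> tail K (f(r := a)) q = tail K f q"
  unfolding tail_def by (intro sum.cong) auto

lemma tail_rec:
  assumes "r \<le> K"
  shows "tail K f r = f r + tail K f (Suc r)"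
proof -
  have "{r..K} = insert r {Suc r..K}"
    using assms by auto
  then show ?thesis
    by (simp add: tail_def)
qed

lemma tail_fun_upd_same:
  "r \<le> K \<Longrightarrow> tail K (f(r := a)) r = a + tail K f (Suc r)"
  by (simp add: tail_rec[of r] tail_fun_upd_above)

text \<open>
  The columns \<open>k\<close> are filled from \<open>K\<close> downwards. At column \<open>r\<close>, the mass \<open>x r\<close> goes first to the
  rows \<open>r, r - 1, \<dots>, 1\<close> in this order, each up to its cap; row \<open>r\<close> has its last chance to reach
  its cap. Hall's condition for the intervals \<open>{p..r}\<close> of remaining columns is the invariant.
\<close>
lemma interval_transport:
  fixes m x :: "nat \<Rightarrow> real"
  assumes m_nonneg: "\<And>i. i \<in> {1..K} \<Longrightarrow> 0 \<le> m i" and m_sum: "(\<Sum>i=1..K. m i) = 1"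
    and x_nonneg: "\<And>k. k \<in> {1..K} \<Longrightarrow> 0 \<le> x k"
    and dom: "\<And>r. r \<in> {1..K} \<Longrightarrow> tail K x r \<le> (real K + 1 - real r) / K"
    and hall: "\<And>p t. 1 \<le> p \<Longrightarrow> p \<le> t \<Longrightarrow> t \<le> K \<Longrightarrow>
      (\<Sum>i=p..t. m i * ((real t + 1 - real i) / K)) \<le> (\<Sum>k=p..t. x k)"
  obtains U where
    "\<And>i k. i \<in> {1..K} \<Longrightarrow> k \<in> {1..K} \<Longrightarrow> 0 \<le> U i k"
    "\<And>k. k \<in> {1..K} \<Longrightarrow> (\<Sum>i=1..K. U i k) = x k"
    "\<And>i r. i \<in> {1..K} \<Longrightarrow> r \<in> {1..K} \<Longrightarrow> tail K (U i) r \<le> m i * ((real K + 1 - real r) / K)"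
    "\<And>i. i \<in> {1..K} \<Longrightarrow> tail K (U i) i = m i * ((real K + 1 - real i) / K)"
proof -
  define e where "e = (\<lambda>r::nat. (real K + 1 - real r) / K)"
  \<comment> \<open>What a row \<open>i \<le> r\<close> still lacks,
    \<open>m i * e i - tail K (U i) (Suc r)\<close>, has to come from the columns \<open>i\<close>
    to \<open>r\<close>; hence the rows from \<open>p\<close> on compete for the columns from
    \<open>p\<close> on.\<close>
  define Inv where "Inv = (\<lambda>r (U :: nat \<Rightarrow> nat \<Rightarrow> real).
      (\<forall>i\<in>{1..K}. \<forall>k\<in>{Suc r..K}. 0 \<le> U i k) \<and>
      (\<forall>k\<in>{Suc r..K}. (\<Sum>i=1..K. U i k) = x k) \<and>
      (\<forall>i\<in>{1..K}. \<forall>q\<in>{Suc r..K}. tail K (U i) q \<le> m i * e q) \<and>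
      (\<forall>i\<in>{Suc r..K}. tail K (U i) i = m i * e i) \<and>
      (\<forall>p\<in>{1..r}. (\<Sum>i=p..r. m i * e i - tail K (U i) (Suc r)) \<le> (\<Sum>k=p..r. x k)))"
  have "\<exists>U. Inv (K - n) U" if "n \<le> K" for n
    using that
  proof (induction n)
    case 0
    have "tail K f (Suc K) = 0" for f
      by (simp add: tail_def)
    then have "Inv K (\<lambda>_ _. 0)"
      using hall[of _ K] by (auto simp: Inv_def e_def)
    then show ?case
      by auto
  next
    case (Suc n)
    define r where "r = K - n"
    have r: "1 \<le> r" "r \<le> K" "K - Suc n = r - 1"
      using Suc.prems by (auto simp: r_def)
    obtain U where U: "Inv r U"
      using Suc by (auto simp: r_def)
    define s where "s = (\<lambda>i. tail K (U i) (Suc r))"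
    define c where "c = (\<lambda>i. m i * e r - s i)"
    have e_dec: "e (Suc r) \<le> e r"
      using r by (auto simp: e_def divide_right_mono)
    have c_nonneg: "0 \<le> c i" if i: "i \<in> {1..K}" for i
    proof (cases "r < K")
      case True
      then have "s i \<le> m i * e (Suc r)"
        using U i by (auto simp: Inv_def s_def)
      also have "\<dots> \<le> m i * e r"
        using m_nonneg[OF i] e_dec by (rule mult_left_mono[rotated])
      finally show ?thesis
        by (simp add: c_def)
    next
      case False
      then have "s i = 0"
        using r by (simp add: s_def tail_def)
      then show ?thesis
        using m_nonneg[OF i] r by (simp add: c_def e_def)
    qed
    define C where "C = (\<lambda>p. \<Sum>i=p..r. c i)"
    \<comment> \<open>\<open>G p\<close> is what the rows \<open>p\<close> to \<open>r\<close> get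
      together from column \<open>r\<close> if higher rows are served first; the share of row
      \<open>i\<close> is \<open>G i - G (Suc i)\<close>.\<close>
    define G where "G = (\<lambda>p. min (x r) (C p))"
    have C_rec: "C i = c i + C (Suc i)" if "i \<le> r" for i
      using that unfolding C_def by (simp add: sum.atLeast_Suc_atMost)
    have C_nonneg: "0 \<le> C p" if "1 \<le> p" for p
      unfolding C_def using that r by (intro sum_nonneg c_nonneg) auto
    have xr: "0 \<le> x r"
      using x_nonneg r by auto
    have s_sum: "(\<Sum>i=1..K. s i) = tail K x (Suc r)"
    proof -
      have "(\<Sum>i=1..K. s i) = (\<Sum>k=Suc r..K. \<Sum>i=1..K. U i k)"
        unfolding s_def tail_def by (rule sum.swap)
      also have "\<dots> = tail K x (Suc r)"
        unfolding tail_def using U by (intro sum.cong) (auto simp: Inv_def)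
      finally show ?thesis .
    qed
    have split: "{1..K} = {1..r} \<union> {Suc r..K}"
      using r by auto
    \<comment> \<open>What the rows up to \<open>r\<close> cannot absorb fits into the rows above:
      as the \<open>m i\<close> sum to 1, all caps together leave room
      \<open>e r - tail K x (Suc r)\<close>, and this is at least \<open>x r\<close> by
      \<open>dom\<close>.\<close>
    have rest: "x r - G 1 \<le> (\<Sum>i=Suc r..K. c i)"
    proof -
      have "(\<Sum>i=1..K. c i) = e r - tail K x (Suc r)"
        by (simp add: c_def sum_subtractf s_sum m_sum flip: sum_distrib_right)
      moreover have "tail K x r \<le> e r"
        using dom[of r] r by (simp add: e_def)
      ultimately have "x r \<le> (\<Sum>i=1..K. c i)"
        using tail_rec[of r K x] r by simp
      also have "\<dots> = C 1 + (\<Sum>i=Suc r..K. c i)"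
        unfolding C_def split by (intro sum.union_disjoint) auto
      finally have "x r \<le> C 1 + (\<Sum>i=Suc r..K. c i)" .
      moreover have "0 \<le> (\<Sum>i=Suc r..K. c i)"
        using r by (intro sum_nonneg c_nonneg) auto
      ultimately show ?thesis
        by (auto simp: G_def min_def)
    qed
    obtain J' where J': "\<And>i. i \<in> {Suc r..K} \<Longrightarrow> 0 \<le> J' i" "\<And>i. i \<in> {Suc r..K} \<Longrightarrow> J' i \<le> c i"
        "sum J' {Suc r..K} = x r - G 1"
      using r rest by (rule_tac bounded_split[of "{Suc r..K}" c "x r - G 1"])
        (auto simp: G_def intro!: c_nonneg)
    define J where "J = (\<lambda>i. if i \<le> r then G i - G (Suc i) else J' i)"
    have J: "0 \<le> J i \<and> J i \<le> c i" if i: "i \<in> {1..K}" for i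
    proof (cases "i \<le> r")
      case True
      then show ?thesis
        using C_rec[OF True] c_nonneg[OF i] by (auto simp: J_def G_def min_def)
    next
      case False
      then show ?thesis
        using J' i by (auto simp: J_def)
    qed
    have J_sum: "(\<Sum>i=p..r. J i) = G p" if "p \<le> Suc r" for p
    proof -
      have "(\<Sum>i=p..r. J i) = (\<Sum>i=p..r. G i - G (Suc i))"
        by (intro sum.cong) (auto simp: J_def)
      also have "\<dots> = G p - G (Suc r)"
        using that sum_Suc_diff[of p r "\<lambda>i. - G i"] by simp
      also have "G (Suc r) = 0"
        using xr by (simp add: G_def C_def)
      finally show ?thesis
        by simp
    qed
    have J_total: "(\<Sum>i=1..K. J i) = x r"
    proof -
      have "(\<Sum>i=1..K. J i) = (\<Sum>i=1..r. J i) + (\<Sum>i=Suc r..K. J i)"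
        unfolding split by (intro sum.union_disjoint) auto
      also have "(\<Sum>i=Suc r..K. J i) = sum J' {Suc r..K}"
        by (intro sum.cong) (auto simp: J_def)
      finally show ?thesis
        using J_sum[of 1] J' by simp
    qed
    \<comment> \<open>The invariant at \<open>p = r\<close> says that column \<open>r\<close> alone
      can fill row \<open>r\<close>; being served first, that row meets its cap exactly.\<close>
    have c_le: "c r \<le> x r"
    proof -
      have "(\<Sum>i=r..r. m i * e i - tail K (U i) (Suc r)) \<le> (\<Sum>k=r..r. x k)"
        using U r unfolding Inv_def by (meson atLeastAtMost_iff order_refl)
      then show ?thesis
        by (simp add: c_def s_def)
    qed
    have Jr: "J r = c r"
      using J_sum[of r] c_le by (simp add: G_def C_def)
    define V where "V = (\<lambda>i. (U i)(r := J i))"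
    have tail_V: "tail K (V i) q = tail K (U i) q" if "Suc r \<le> q" for i q
      using that by (simp add: V_def tail_fun_upd_above)
    have tail_Vr: "tail K (V i) r = J i + s i" for i
      using r by (simp add: V_def tail_fun_upd_same s_def)
    \<comment> \<open>Either the rows \<open>p\<close> to \<open>r\<close> use up column
      \<open>r\<close>, and both sides of the invariant drop by \<open>x r\<close>; or they all
      reach their caps, and what they lack, \<open>m i * (r - i) / K\<close>, is the original
      condition \<open>hall\<close> for \<open>t = r - 1\<close>.\<close>
    have inv: "(\<Sum>i=p..r - 1. m i * e i - (J i + s i)) \<le> (\<Sum>k=p..r - 1. x k)" if p: "p \<in> {1..r - 1}" for p
    proof -
      have up: "{p..r} = insert r {p..r - 1}"
        using p by auto
      have "r \<notin> {p..r - 1}"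
        using r by auto
      then have add: "(\<Sum>i=p..r. f i) = f r + (\<Sum>i=p..r - 1. f i)" for f :: "nat \<Rightarrow> real"
        unfolding up by simp
      have "(\<Sum>i=p..r - 1. m i * e i - (J i + s i)) = (\<Sum>i=p..r. m i * e i - (J i + s i))"
        using Jr by (simp add: add c_def)
      also have "\<dots> = (\<Sum>i=p..r. m i * e i - s i) - G p"
      proof -
        have "p \<le> Suc r"
          using p by auto
        from J_sum[OF this] show ?thesis
          by (simp add: sum_subtractf sum.distrib)
      qed
      also have "\<dots> \<le> (\<Sum>k=p..r - 1. x k)"
      proof (cases "x r \<le> C p")
        case True
        have "(\<Sum>i=p..r. m i * e i - s i) \<le> (\<Sum>k=p..r. x k)"
          using U p by (auto simp: Inv_def s_def)
        then show ?thesis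
          using True by (simp add: G_def add[of x])
      next
        case False
        have "(\<Sum>i=p..r. m i * e i - s i) - C p = (\<Sum>i=p..r. m i * ((real r - real i) / K))"
          unfolding C_def sum_subtractf[symmetric]
          by (intro sum.cong) (auto simp: c_def e_def diff_divide_distrib add_divide_distrib algebra_simps)
        also have "\<dots> = (\<Sum>i=p..r - 1. m i * ((real (r - 1) + 1 - real i) / K))"
          using r by (simp add: add of_nat_diff)
        also have "\<dots> \<le> (\<Sum>k=p..r - 1. x k)"
          using p r by (intro hall) auto
        finally show ?thesis
          using False by (simp add: G_def)
      qed
      finally show ?thesis .
    qed
    have Suc_r: "Suc (r - 1) = r"
      using r by simp
    have "Inv (r - 1) V"
      unfolding Inv_def Suc_r
    proof (intro conjI ballI)
      fix i k assume ik: "i \<in> {1..K}" "k \<in> {r..K}"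
      show "0 \<le> V i k"
        using ik J[OF ik(1)] U by (cases "k = r") (auto simp: V_def Inv_def)
    next
      fix k assume k: "k \<in> {r..K}"
      show "(\<Sum>i=1..K. V i k) = x k"
        using k J_total U by (cases "k = r") (auto simp: V_def Inv_def)
    next
      fix i q assume iq: "i \<in> {1..K}" "q \<in> {r..K}"
      show "tail K (V i) q \<le> m i * e q"
      proof (cases "q = r")
        case True
        then show ?thesis
          using J[OF iq(1)] by (simp add: tail_Vr c_def)
      next
        case False
        then show ?thesis
          using U iq by (simp add: tail_V Inv_def)
      qed
    next
      fix i assume i: "i \<in> {r..K}"
      show "tail K (V i) i = m i * e i"
        using U i Jr by (cases "i = r") (auto simp: tail_V tail_Vr Inv_def c_def)
    next
      fix p assume "p \<in> {1..r - 1}"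
      then show "(\<Sum>i=p..r - 1. m i * e i - tail K (V i) r) \<le> (\<Sum>k=p..r - 1. x k)"
        unfolding tail_Vr by (rule inv)
    qed
    then show ?case
      using r by auto
  qed
  from this[of K] obtain U where "Inv 0 U"
    by auto
  then show ?thesis
    by (intro that[of U]) (auto simp: Inv_def e_def)
qed

section \<open>Plans\<close>

locale value_grid =
  fixes K :: nat and v :: "nat \<Rightarrow> real"
  assumes K: "2 \<le> K" and v_1: "0 < v 1" and v_mono: "strict_mono_on {1..K} v"
begin

definition weight :: "nat \<Rightarrow> real" where
  "weight i = (real K + 1 - real i) * v i"

text \<open>The total mass \<open>tail K y 1\<close> in the noise term makes the score linear in
  \<open>y\<close>, so that it applies to unnormalised segments; on a market it is the posterior
  revenue of \<open>v i\<close>.\<close>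

definition score :: "real \<Rightarrow> market \<Rightarrow> nat \<Rightarrow> real" where
  "score \<beta> y i = (1 - \<beta>) * (v i * tail K y i) + \<beta> * (weight i / K * tail K y 1)"

definition surplus :: "nat \<Rightarrow> market \<Rightarrow> real" where
  "surplus i y = (\<Sum>k=1..K. y k * max 0 (v k - v i))"

text \<open>
  A plan splits the market \<open>xs\<close> into unnormalised segments \<open>Y i\<close>, on which the price index \<open>i\<close>
  beats all higher ones. Lower prices may be better still; that only helps the consumers.
\<close>
definition plans :: "real \<Rightarrow> market \<Rightarrow> (nat \<Rightarrow> market) set" where
  "plans \<beta> xs = {Y. (\<forall>i\<in>{1..K}. \<forall>k\<in>{1..K}. 0 \<le> Y i k) \<and>
     (\<forall>k\<in>{1..K}. (\<Sum>i=1..K. Y i k) = xs k) \<and>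
     (\<forall>i\<in>{1..K}. \<forall>j\<in>{i<..K}. score \<beta> (Y i) j \<le> score \<beta> (Y i) i)}"

definition plan_value :: "(nat \<Rightarrow> market) \<Rightarrow> real" where
  "plan_value Y = (\<Sum>i=1..K. surplus i (Y i))"

section \<open>Elementary properties of tails, scores and surpluses\<close>

lemma v_less: "1 \<le> i \<Longrightarrow> i < j \<Longrightarrow> j \<le> K \<Longrightarrow> v i < v j"
  using v_mono by (auto simp: strict_mono_on_def)

lemma v_le: "1 \<le> i \<Longrightarrow> i \<le> j \<Longrightarrow> j \<le> K \<Longrightarrow> v i \<le> v j"
  using v_less[of i j] by (cases "i = j") auto

lemma v_pos: "1 \<le> i \<Longrightarrow> i \<le> K \<Longrightarrow> 0 < v i"
  using v_le[of 1 i] v_1 by auto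

lemma weight_nonneg: "i \<in> {1..K} \<Longrightarrow> 0 \<le> weight i"
  using v_pos[of i] by (auto simp: weight_def)

lemma tail_nonneg: "(\<And>k. k \<in> {1..K} \<Longrightarrow> 0 \<le> y k) \<Longrightarrow> 1 \<le> i \<Longrightarrow> 0 \<le> tail K y i"
  unfolding tail_def by (intro sum_nonneg) auto

lemma tail_antimono:
  "(\<And>k. k \<in> {1..K} \<Longrightarrow> 0 \<le> y k) \<Longrightarrow> 1 \<le> i \<Longrightarrow> i \<le> j \<Longrightarrow> tail K y j \<le> tail K y i"
  unfolding tail_def by (intro sum_mono2) auto

lemma tail_market: "x \<in> markets K \<Longrightarrow> tail K x 1 = 1"
  by (simp add: tail_def markets_def)

lemma tail_sum: "tail K (\<lambda>k. \<Sum>a\<in>A. c a * f a k) i = (\<Sum>a\<in>A. c a * tail K (f a) i)"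
  unfolding tail_def by (simp add: sum_distrib_left) (rule sum.swap)

lemma tail_lincomb: "tail K (\<lambda>k. a * f k + b * g k) i = a * tail K f i + b * tail K g i"
  unfolding tail_def by (simp add: sum.distrib sum_distrib_left)

lemma score_sum: "score \<beta> (\<lambda>k. \<Sum>a\<in>A. c a * f a k) i = (\<Sum>a\<in>A. c a * score \<beta> (f a) i)"
  unfolding score_def tail_sum
  by (simp add: sum_distrib_left sum.distrib[symmetric]) (intro sum.cong; simp add: algebra_simps)

lemma surplus_sum: "surplus i (\<lambda>k. \<Sum>a\<in>A. c a * f a k) = (\<Sum>a\<in>A. c a * surplus i (f a))"
  unfolding surplus_def sum_distrib_left sum_distrib_right
  by (subst sum.swap) (simp add: mult.assoc)

lemma surplus_lincomb: "surplus i (\<lambda>k. a * f k + b * g k) = a * surplus i f + b * surplus i g"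
  unfolding surplus_def by (simp add: sum_distrib_left sum.distrib[symmetric] algebra_simps)

lemma surplus_antimono:
  assumes "\<And>k. k \<in> {1..K} \<Longrightarrow> 0 \<le> y k" "1 \<le> i" "i \<le> j" "j \<le> K"
  shows "surplus j y \<le> surplus i y"
  unfolding surplus_def using assms v_le[of i j]
  by (intro sum_mono mult_left_mono) auto

lemma v_telescope:
  assumes "1 \<le> i" "i \<le> K" "1 \<le> k" "k \<le> K"
  shows "max 0 (v k - v i) = (\<Sum>r=Suc i..k. v r - v (r - 1))"
proof (cases "i \<le> k")
  case True
  then have "(\<Sum>r=Suc i..k. v r - v (r - 1)) = v k - v i"
  proof (induction k rule: dec_induct)
    case (step k)
    then show ?case
      by (simp add: sum.atLeast_Suc_atMost_Suc_shift sum.nat_ivl_Suc')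
  qed simp
  then show ?thesis
    using True v_le[of i k] assms by simp
next
  case False
  then show ?thesis
    using v_le[of k i] assms by simp
qed

text \<open>Summation by parts. The price index remains only in the lower limit, so a surplus can be
  computed from the events that the price is below \<open>v r\<close>.\<close>

lemma surplus_tail:
  assumes "i \<in> {1..K}"
  shows "surplus i y = (\<Sum>r=Suc i..K. (v r - v (r - 1)) * tail K y r)"
proof -
  have "surplus i y = (\<Sum>k=1..K. \<Sum>r=Suc i..K. if r \<le> k then y k * (v r - v (r - 1)) else 0)"
    unfolding surplus_def
  proof (rule sum.cong)
    fix k assume k: "k \<in> {1..K}"
    have "y k * max 0 (v k - v i) = (\<Sum>r=Suc i..k. y k * (v r - v (r - 1)))"
      using assms k by (subst v_telescope) (auto simp: sum_distrib_left)
    also have "\<dots> = (\<Sum>r=Suc i..K. if r \<le> k then y k * (v r - v (r - 1)) else 0)"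
      using k by (intro sum.mono_neutral_cong_left) auto
    finally show "y k * max 0 (v k - v i) = (\<Sum>r=Suc i..K. if r \<le> k then y k * (v r - v (r - 1)) else 0)" .
  qed simp
  also have "\<dots> = (\<Sum>r=Suc i..K. \<Sum>k=1..K. if r \<le> k then y k * (v r - v (r - 1)) else 0)"
    by (rule sum.swap)
  also have "\<dots> = (\<Sum>r=Suc i..K. (v r - v (r - 1)) * tail K y r)"
  proof (rule sum.cong)
    fix r assume r: "r \<in> {Suc i..K}"
    have "(\<Sum>k=1..K. if r \<le> k then y k * (v r - v (r - 1)) else 0) = (\<Sum>k=r..K. y k * (v r - v (r - 1)))"
      using r assms by (intro sum.mono_neutral_cong_right) auto
    then show "(\<Sum>k=1..K. if r \<le> k then y k * (v r - v (r - 1)) else 0) = (v r - v (r - 1)) * tail K y r"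
      by (simp add: tail_def mult.commute flip: sum_distrib_right)
  qed simp
  finally show ?thesis .
qed

section \<open>Transforming plans\<close>

lemma plan_tail_sum:
  assumes "Y \<in> plans \<beta> xs" "1 \<le> r"
  shows "(\<Sum>i=1..K. tail K (Y i) r) = tail K xs r"
  unfolding tail_def using assms by (subst sum.swap) (auto simp: plans_def intro!: sum.cong)

text \<open>Every consumer of value \<open>v k\<close> facing a higher price is moved to the segment \<open>k\<close>.\<close>
lemma efficient_plan:
  assumes \<beta>: "0 \<le> \<beta>" "\<beta> < 1"
    and inc: "\<And>i j. 1 \<le> i \<Longrightarrow> i \<le> j \<Longrightarrow> j \<le> K \<Longrightarrow> weight i \<le> weight j"
    and small: "\<And>i j. 1 \<le> i \<Longrightarrow> i < j \<Longrightarrow> j \<le> K \<Longrightarrow> \<beta> * (weight j - weight i) \<le> (1 - \<beta>) * (K * v i)"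
    and Y: "Y \<in> plans \<beta> xs"
  obtains Z where "Z \<in> plans \<beta> xs" "plan_value Z = plan_value Y"
    "\<And>i k. k < i \<Longrightarrow> Z i k = 0"
    "\<And>i j. 1 \<le> i \<Longrightarrow> i < j \<Longrightarrow> j \<le> K \<Longrightarrow> v j * tail K (Z i) j \<le> v i * tail K (Z i) 1"
proof -
  have Y_nonneg: "0 \<le> Y i k" if "i \<in> {1..K}" "k \<in> {1..K}" for i k
    using Y that by (auto simp: plans_def)
  \<comment> \<open>In segment \<open>i\<close> only values above \<open>v i\<close> yield surplus,
    and these stay in place, so the value of the plan is unchanged.\<close>
  define Z where "Z = (\<lambda>i k. if i < k then Y i k else if k = i then (\<Sum>l=i..K. Y l i) else 0)"
  have Z_nonneg: "0 \<le> Z i k" if "i \<in> {1..K}" "k \<in> {1..K}" for i k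
    using that by (auto simp: Z_def intro!: sum_nonneg Y_nonneg)
  have above: "tail K (Z i) j = tail K (Y i) j" if "i < j" for i j
    unfolding tail_def using that by (intro sum.cong) (auto simp: Z_def)
  have Z_1: "tail K (Z i) 1 = tail K (Z i) i" if "i \<in> {1..K}" for i
    unfolding tail_def using that by (intro sum.mono_neutral_right) (auto simp: Z_def)
  have le: "tail K (Y i) i \<le> tail K (Z i) i" if i: "i \<in> {1..K}" for i
  proof -
    have "Y i i \<le> Z i i"
      unfolding Z_def using i Y_nonneg by (auto intro!: member_le_sum)
    then show ?thesis
      using i by (simp add: tail_rec[of i] above)
  qed
  \<comment> \<open>By \<open>inc\<close> the noise term may be charged for the buyers
    \<open>t\<close> alone; by \<open>small\<close> the resulting factor \<open>b\<close> is
    nonnegative, so \<open>t\<close> may be raised to the mass of the new segment. The bound covers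
    the plan constraint as well as the noiseless comparison of \<open>v j\<close> with
    \<open>v i\<close>.\<close>
  have key: "(1 - \<beta>) * (v j * tail K (Z i) j) \<le> tail K (Z i) 1 * ((1 - \<beta>) * v i - \<beta> * (weight j - weight i) / K)"
    if ij: "1 \<le> i" "i < j" "j \<le> K" for i j
  proof -
    define t where "t = tail K (Y i) i"
    define b where "b = (1 - \<beta>) * v i - \<beta> * (weight j - weight i) / K"
    have t1: "t \<le> tail K (Y i) 1"
      unfolding t_def using ij Y_nonneg by (intro tail_antimono) auto
    have b: "0 \<le> b"
      using small[OF ij] K by (simp add: b_def field_simps)
    have "0 \<le> \<beta> * (weight j - weight i) / K"
      using \<beta> inc[of i j] ij by auto
    then have *: "\<beta> * (weight j - weight i) / K * t \<le> \<beta> * (weight j - weight i) / K * tail K (Y i) 1"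
      using t1 by (intro mult_left_mono)
    have "score \<beta> (Y i) j \<le> score \<beta> (Y i) i"
      using Y ij by (auto simp: plans_def)
    then have "(1 - \<beta>) * (v j * tail K (Y i) j)
        \<le> (1 - \<beta>) * v i * t - \<beta> * (weight j - weight i) / K * tail K (Y i) 1"
      by (simp add: score_def t_def algebra_simps diff_divide_distrib)
    also have "\<dots> \<le> t * b"
      using * by (simp add: b_def algebra_simps)
    also have "\<dots> \<le> tail K (Z i) 1 * b"
      using b le[of i] Z_1[of i] ij by (intro mult_right_mono) (auto simp: t_def)
    finally show ?thesis
      using ij by (simp add: above b_def)
  qed
  show ?thesis
  proof (rule that[of Z])
    show "plan_value Z = plan_value Y"
      unfolding plan_value_def
    proof (rule sum.cong)
      fix i assume i: "i \<in> {1..K}"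
      show "surplus i (Z i) = surplus i (Y i)"
        unfolding surplus_tail[OF i] by (intro sum.cong) (auto simp: above)
    qed simp
    show "Z i k = 0" if "k < i" for i k
      using that by (auto simp: Z_def)
    show "v j * tail K (Z i) j \<le> v i * tail K (Z i) 1" if ij: "1 \<le> i" "i < j" "j \<le> K" for i j
    proof -
      have "0 \<le> tail K (Z i) 1"
        using ij Z_nonneg by (intro tail_nonneg) auto
      moreover have "0 \<le> \<beta> * (weight j - weight i) / K"
        using \<beta> inc[of i j] ij by auto
      ultimately have "tail K (Z i) 1 * ((1 - \<beta>) * v i - \<beta> * (weight j - weight i) / K) \<le> tail K (Z i) 1 * ((1 - \<beta>) * v i)"
        by (intro mult_left_mono) auto
      then have "(1 - \<beta>) * (v j * tail K (Z i) j) \<le> (1 - \<beta>) * (v i * tail K (Z i) 1)"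
        using key[OF ij] by (simp add: ac_simps)
      then show ?thesis
        using \<beta> by simp
    qed
    show "Z \<in> plans \<beta> xs"
      unfolding plans_def
    proof (intro CollectI conjI ballI)
      fix k assume k: "k \<in> {1..K}"
      have split: "{1..K} = {1..<k} \<union> {k} \<union> {Suc k..K}"
        using k by auto
      have "(\<Sum>i=1..K. Z i k) = (\<Sum>i=1..<k. Z i k) + Z k k + (\<Sum>i=Suc k..K. Z i k)"
        unfolding split by (subst sum.union_disjoint; auto)+
      also have "\<dots> = (\<Sum>i=1..<k. Y i k) + (\<Sum>i=k..K. Y i k)"
        by (simp add: Z_def)
      also have "\<dots> = (\<Sum>i=1..K. Y i k)"
        using k by (subst sum.union_disjoint[symmetric]) (auto intro!: sum.cong)
      finally show "(\<Sum>i=1..K. Z i k) = xs k"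
        using Y k by (simp add: plans_def)
    next
      fix i j assume "i \<in> {1..K}" "j \<in> {i<..K}"
      then show "score \<beta> (Z i) j \<le> score \<beta> (Z i) i"
        using key[of i j] Z_1[of i] by (simp add: score_def algebra_simps diff_divide_distrib)
    qed (use Z_nonneg in auto)
  qed
qed

text \<open>
  With \<open>z = (1 - \<beta>) y + \<beta> e\<close> the posterior mean of a segment \<open>y\<close> and \<open>e\<close> the uniform market, less
  noise means that part of \<open>e\<close> is replaced by a market \<open>U\<close> of our choice; the price \<open>i\<close> stays
  good if the tails of \<open>U\<close> are below those of \<open>e\<close>, with equality at \<open>i\<close>.
\<close>
lemma plan_step:
  assumes \<beta>: "0 \<le> \<beta>" "\<beta> \<le> \<beta>'" "\<beta>' < 1" and xs: "xs \<in> markets K"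
    and inc: "\<And>i j. 1 \<le> i \<Longrightarrow> i \<le> j \<Longrightarrow> j \<le> K \<Longrightarrow> weight i \<le> weight j"
    and small: "\<And>i j. 1 \<le> i \<Longrightarrow> i < j \<Longrightarrow> j \<le> K \<Longrightarrow> \<beta>' * (weight j - weight i) \<le> (1 - \<beta>') * (K * v i)"
    and opt: "\<And>j. j \<in> {1..K} \<Longrightarrow> v j * tail K xs j \<le> v 1"
    and Y: "Y \<in> plans \<beta>' xs"
  shows "\<exists>Z\<in>plans \<beta> xs. (1 - \<beta>') * plan_value Y +
      (\<beta>' - \<beta>) * (\<Sum>r=2..K. (v r - v (r - 1)) * tail K xs r * ((real r - 1) / K)) \<le> (1 - \<beta>) * plan_value Z"
proof -
  obtain Z where Z: "Z \<in> plans \<beta>' xs" and Z_val: "plan_value Z = plan_value Y"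
    and Z_low: "\<And>i k. k < i \<Longrightarrow> Z i k = 0"
    and Z_tail: "\<And>i j. 1 \<le> i \<Longrightarrow> i < j \<Longrightarrow> j \<le> K \<Longrightarrow> v j * tail K (Z i) j \<le> v i * tail K (Z i) 1"
    by (rule efficient_plan[where \<beta>=\<beta>' and Y=Y and xs=xs];
      ((rule inc; assumption) | (rule small; assumption) | rule Y | (use \<beta> in linarith) | (rule that; blast)))
  have Z_nonneg: "0 \<le> Z i k" if "i \<in> {1..K}" "k \<in> {1..K}" for i k
    using Z that by (auto simp: plans_def)
  have xs_nonneg: "0 \<le> xs k" if "k \<in> {1..K}" for k
    using xs that by (auto simp: markets_def)
  define m where "m = (\<lambda>i. tail K (Z i) 1)"
  have m_nonneg: "0 \<le> m i" if "i \<in> {1..K}" for i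
    unfolding m_def using that Z_nonneg by (intro tail_nonneg) auto
  have m_tail: "m i = tail K (Z i) r" if "1 \<le> r" "r \<le> i" for i r
    unfolding m_def tail_def using that Z_low by (intro sum.mono_neutral_right) auto
  have m_sum: "(\<Sum>i=1..K. m i) = 1"
    unfolding m_def using plan_tail_sum[OF Z, of 1] tail_market[OF xs] by simp
  \<comment> \<open>The revenue of \<open>v r\<close> on \<open>xs\<close> is at most
    \<open>v 1 = weight 1 / K \<le> weight r / K\<close>; divide by \<open>v r\<close>.\<close>
  have dom: "tail K xs r \<le> (real K + 1 - real r) / K" if r: "r \<in> {1..K}" for r
  proof -
    have "K * (v r * tail K xs r) \<le> weight r"
    proof -
      have "K * (v r * tail K xs r) \<le> K * v 1"
        using opt[OF r] by (intro mult_left_mono) auto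
      also have "\<dots> = weight 1"
        by (simp add: weight_def)
      also have "\<dots> \<le> weight r"
        using r by (intro inc) auto
      finally show ?thesis .
    qed
    then show ?thesis
    proof -
      have "v r * (K * tail K xs r) \<le> v r * (real K + 1 - real r)"
        using \<open>K * (v r * tail K xs r) \<le> weight r\<close> by (simp add: weight_def ac_simps)
      then have "K * tail K xs r \<le> real K + 1 - real r"
        using v_pos[of r] r by simp
      then show ?thesis
        using K by (simp add: field_simps)
    qed
  qed
  \<comment> \<open>The cleaned plan is the witness: since \<open>weight\<close> increases, at most
    the fraction \<open>(K - t) / (K + 1 - i)\<close> of segment \<open>i\<close> lies above
    \<open>t\<close>, so at least \<open>(t + 1 - i) / (K + 1 - i)\<close> of it lies in the columns
    \<open>i\<close> to \<open>t\<close>.\<close>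
  have hall: "(\<Sum>i=p..t. m i * ((real t + 1 - real i) / K)) \<le> (\<Sum>k=p..t. xs k)"
    if pt: "1 \<le> p" "p \<le> t" "t \<le> K" for p t
  proof -
    have "(\<Sum>i=p..t. m i * ((real t + 1 - real i) / K)) \<le> (\<Sum>i=p..t. \<Sum>k=p..t. Z i k)"
    proof (rule sum_mono)
      fix i assume i: "i \<in> {p..t}"
      have mi: "0 \<le> m i"
        using i pt by (intro m_nonneg) auto
      have "tail K (Z i) (Suc t) \<le> m i * ((real K - real t) / (real K + 1 - real i))"
      proof (cases "t < K")
        case True
        have "weight i \<le> weight (Suc t)"
          using i pt True by (intro inc) auto
        then have w: "v i * (real K + 1 - real i) \<le> v (Suc t) * (real K - real t)"
          by (simp add: weight_def algebra_simps)
        have vt: "0 < v (Suc t)"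
          using True by (intro v_pos) auto
        have "v (Suc t) * (tail K (Z i) (Suc t) * (real K + 1 - real i)) \<le> v i * m i * (real K + 1 - real i)"
          using Z_tail[of i "Suc t"] i pt True
          by (auto simp: m_def mult.assoc[symmetric] intro!: mult_right_mono)
        also have "\<dots> = m i * (v i * (real K + 1 - real i))"
          by simp
        also have "\<dots> \<le> m i * (v (Suc t) * (real K - real t))"
          using w mi by (rule mult_left_mono)
        also have "\<dots> = v (Suc t) * (m i * (real K - real t))"
          by simp
        finally have "tail K (Z i) (Suc t) * (real K + 1 - real i) \<le> m i * (real K - real t)"
          using vt by simp
        then show ?thesis
          using i pt by (simp add: field_simps)
      next
        case False
        then show ?thesis
          using pt by (simp add: tail_def)
      qed
      moreover have "m i * ((real t + 1 - real i) / K) \<le> m i * ((real t + 1 - real i) / (real K + 1 - real i))"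
        using mi i pt by (intro mult_left_mono divide_left_mono) auto
      moreover have "(real t + 1 - real i) / (real K + 1 - real i) = 1 - (real K - real t) / (real K + 1 - real i)"
        using i pt by (simp add: field_simps)
      ultimately have "m i * ((real t + 1 - real i) / K) \<le> m i - tail K (Z i) (Suc t)"
        by (simp add: right_diff_distrib)
      also have "\<dots> = tail K (Z i) p - tail K (Z i) (Suc t)"
        using m_tail[of p i] i pt by simp
      also have "\<dots> = (\<Sum>k=p..t. Z i k)"
      proof -
        have "{p..K} = {p..t} \<union> {Suc t..K}"
          using pt by auto
        then have "tail K (Z i) p = (\<Sum>k=p..t. Z i k) + tail K (Z i) (Suc t)"
          unfolding tail_def by (simp add: sum.union_disjoint)
        then show ?thesis
          by simp
      qed
      finally show "m i * ((real t + 1 - real i) / K) \<le> (\<Sum>k=p..t. Z i k)" .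
    qed
    also have "\<dots> \<le> (\<Sum>i=1..K. \<Sum>k=p..t. Z i k)"
      using pt Z_nonneg by (intro sum_mono2 sum_nonneg) auto
    also have "\<dots> = (\<Sum>k=p..t. xs k)"
      using Z pt by (subst sum.swap) (auto simp: plans_def intro!: sum.cong)
    finally show ?thesis .
  qed
  obtain U where U_nonneg: "\<And>i k. i \<in> {1..K} \<Longrightarrow> k \<in> {1..K} \<Longrightarrow> 0 \<le> U i k"
    and U_sum: "\<And>k. k \<in> {1..K} \<Longrightarrow> (\<Sum>i=1..K. U i k) = xs k"
    and U_le: "\<And>i r. i \<in> {1..K} \<Longrightarrow> r \<in> {1..K} \<Longrightarrow> tail K (U i) r \<le> m i * ((real K + 1 - real r) / K)"
    and U_eq: "\<And>i. i \<in> {1..K} \<Longrightarrow> tail K (U i) i = m i * ((real K + 1 - real i) / K)"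
    by (rule interval_transport[where K=K and m=m and x=xs];
      ((rule m_nonneg; assumption) | rule m_sum | (rule xs_nonneg; assumption) | (rule dom; assumption)
        | (rule hall; assumption) | (rule that; blast)))
  have U_tail: "(\<Sum>i=1..K. tail K (U i) r) = tail K xs r" if "1 \<le> r" for r
    unfolding tail_def using that U_sum by (subst sum.swap) (auto intro!: sum.cong)
  \<comment> \<open>The cap at \<open>r = 1\<close> is \<open>m i\<close>; both sides sum to 1 over
    \<open>i\<close>, which forces equality.\<close>
  have U_1: "tail K (U i) 1 = m i" if i: "i \<in> {1..K}" for i
  proof -
    have le: "tail K (U i) 1 \<le> m i" if "i \<in> {1..K}" for i
      using U_le[of i 1] that K by simp
    have "(\<Sum>i=1..K. m i - tail K (U i) 1) = 0"
      using U_tail[of 1] m_sum tail_market[OF xs] by (simp add: sum_subtractf)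
    then have "\<forall>i\<in>{1..K}. m i - tail K (U i) 1 = 0"
      using le by (subst (asm) sum_nonneg_eq_0_iff) auto
    then show ?thesis
      using i by auto
  qed
  \<comment> \<open>Chosen so that \<open>(1 - \<beta>) * X i k = (1 - \<beta>') * Z i k + (\<beta>'
    - \<beta>) * U i k\<close>: the pieces fill exactly the share of noise that is removed.\<close>
  define a b where "a = (1 - \<beta>') / (1 - \<beta>)" and "b = (\<beta>' - \<beta>) / (1 - \<beta>)"
  have ab: "0 \<le> a" "0 \<le> b" "a + b = 1" "(1 - \<beta>) * a = 1 - \<beta>'" "(1 - \<beta>) * b = \<beta>' - \<beta>"
    using \<beta> by (auto simp: a_def b_def add_divide_distrib[symmetric])
  define X where "X = (\<lambda>i k. a * Z i k + b * U i k)"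
  have X_tail: "tail K (X i) r = a * tail K (Z i) r + b * tail K (U i) r" for i r
    unfolding X_def by (rule tail_lincomb)
  have "X \<in> plans \<beta> xs"
    unfolding plans_def
  proof (intro CollectI conjI ballI)
    fix i k assume "i \<in> {1..K}" "k \<in> {1..K}"
    then show "0 \<le> X i k"
      using ab Z_nonneg U_nonneg by (auto simp: X_def)
  next
    fix k assume k: "k \<in> {1..K}"
    have "(\<Sum>i=1..K. X i k) = a * (\<Sum>i=1..K. Z i k) + b * (\<Sum>i=1..K. U i k)"
      by (simp add: X_def sum.distrib sum_distrib_left)
    also have "\<dots> = a * xs k + b * xs k"
      using Z U_sum k by (simp add: plans_def)
    also have "\<dots> = xs k"
      using ab by (simp flip: distrib_right)
    finally show "(\<Sum>i=1..K. X i k) = xs k" .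
  next
    fix i j assume i: "i \<in> {1..K}" and j: "j \<in> {i<..K}"
    have X_1: "tail K (X i) 1 = m i"
      unfolding X_tail U_1[OF i] using ab by (simp add: m_def flip: distrib_right)
    \<comment> \<open>Compared with \<open>score \<beta>'\<close> on \<open>Z i\<close>, the share
      \<open>\<beta>' - \<beta>\<close> of the noise revenue \<open>weight l / K * m i\<close> is
      exchanged for the revenue of \<open>v l\<close> on \<open>U i\<close>.\<close>
    have sc: "score \<beta> (X i) l = (score \<beta>' (Z i) l - \<beta>' * (weight l / K * m i))
        + (\<beta>' - \<beta>) * (v l * tail K (U i) l) + \<beta> * (weight l / K * m i)" for l
    proof -
      have "score \<beta> (X i) l = ((1 - \<beta>) * a) * (v l * tail K (Z i) l)
          + ((1 - \<beta>) * b) * (v l * tail K (U i) l) + \<beta> * (weight l / K * m i)"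
        unfolding score_def X_1 by (simp add: X_tail algebra_simps)
      also have "\<dots> = (score \<beta>' (Z i) l - \<beta>' * (weight l / K * m i))
          + (\<beta>' - \<beta>) * (v l * tail K (U i) l) + \<beta> * (weight l / K * m i)"
        unfolding ab by (simp add: score_def m_def)
      finally show ?thesis .
    qed
    have "v j * tail K (U i) j \<le> weight j / K * m i"
    proof -
      have "v j * tail K (U i) j \<le> v j * (m i * ((real K + 1 - real j) / K))"
        using i j v_pos[of j] by (intro mult_left_mono U_le) auto
      then show ?thesis
        by (simp add: weight_def mult_ac)
    qed
    then have 1: "(\<beta>' - \<beta>) * (v j * tail K (U i) j) \<le> (\<beta>' - \<beta>) * (weight j / K * m i)"
      using \<beta> by (intro mult_left_mono) auto
    have 2: "v i * tail K (U i) i = weight i / K * m i"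
      using U_eq[OF i] by (simp add: weight_def mult_ac)
    have 3: "score \<beta>' (Z i) j \<le> score \<beta>' (Z i) i"
      using Z i j by (auto simp: plans_def)
    have "(A - \<beta>' * P) + (\<beta>' - \<beta>) * R + \<beta> * P \<le> (B - \<beta>' * Q) + (\<beta>' - \<beta>) * Q + \<beta> * Q"
      if "(\<beta>' - \<beta>) * R \<le> (\<beta>' - \<beta>) * P" "A \<le> B" for A B P Q R :: real
      using that by (simp add: algebra_simps)
    from this[OF 1 3] show "score \<beta> (X i) j \<le> score \<beta> (X i) i"
      unfolding sc 2 .
  qed
  moreover have "(1 - \<beta>) * plan_value X = (1 - \<beta>') * plan_value Y + (\<beta>' - \<beta>) * plan_value U"
  proof -
    have "plan_value X = a * plan_value Z + b * plan_value U"
      unfolding plan_value_def X_def surplus_lincomb by (simp add: sum.distrib sum_distrib_left)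
    then have "(1 - \<beta>) * plan_value X = ((1 - \<beta>) * a) * plan_value Z + ((1 - \<beta>) * b) * plan_value U"
      by (simp add: algebra_simps)
    then show ?thesis
      by (simp add: ab Z_val)
  qed
  \<comment> \<open>At level \<open>r\<close> only the rows \<open>i \<ge> r\<close> are lost. They
    carry at most \<open>m i * (K + 1 - r) / K\<close> from \<open>v r\<close> on, and since segment
    \<open>i\<close> of \<open>Z\<close> has no value below \<open>v i\<close>, these
    \<open>m i\<close> sum to at most \<open>tail K xs r\<close>.\<close>
  moreover have "(\<Sum>r=2..K. (v r - v (r - 1)) * tail K xs r * ((real r - 1) / K)) \<le> plan_value U"
  proof -
    have "plan_value U = (\<Sum>i=1..K. \<Sum>r=2..K. if i < r then (v r - v (r - 1)) * tail K (U i) r else 0)"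
      unfolding plan_value_def
    proof (rule sum.cong)
      fix i assume i: "i \<in> {1..K}"
      show "surplus i (U i) = (\<Sum>r=2..K. if i < r then (v r - v (r - 1)) * tail K (U i) r else 0)"
        unfolding surplus_tail[OF i] using i by (intro sum.mono_neutral_cong_left) auto
    qed simp
    also have "\<dots> = (\<Sum>r=2..K. \<Sum>i=1..K. if i < r then (v r - v (r - 1)) * tail K (U i) r else 0)"
      by (rule sum.swap)
    also have "\<dots> \<ge> (\<Sum>r=2..K. (v r - v (r - 1)) * tail K xs r * ((real r - 1) / K))"
    proof (rule sum_mono)
      fix r assume r: "r \<in> {2..K}"
      have split: "{1..K} = {1..<r} \<union> {r..K}"
        using r by auto
      have "(\<Sum>i=r..K. tail K (U i) r) \<le> (\<Sum>i=r..K. m i * ((real K + 1 - real r) / K))"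
        using r by (intro sum_mono U_le) auto
      also have "\<dots> = (\<Sum>i=r..K. tail K (Z i) r) * ((real K + 1 - real r) / K)"
        unfolding sum_distrib_right using r by (intro sum.cong) (auto simp: m_tail[of r])
      also have "\<dots> \<le> tail K xs r * ((real K + 1 - real r) / K)"
      proof (rule mult_right_mono)
        have "(\<Sum>i=r..K. tail K (Z i) r) \<le> (\<Sum>i=1..K. tail K (Z i) r)"
          using r Z_nonneg by (intro sum_mono2 tail_nonneg) auto
        then show "(\<Sum>i=r..K. tail K (Z i) r) \<le> tail K xs r"
          using plan_tail_sum[OF Z, of r] r by simp
      qed (use r in auto)
      finally have le: "(\<Sum>i=r..K. tail K (U i) r) \<le> tail K xs r * ((real K + 1 - real r) / K)" .
      have "tail K xs r = (\<Sum>i=1..<r. tail K (U i) r) + (\<Sum>i=r..K. tail K (U i) r)"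
      proof -
        have "tail K xs r = (\<Sum>i=1..K. tail K (U i) r)"
          using U_tail[of r] r by simp
        also have "\<dots> = (\<Sum>i=1..<r. tail K (U i) r) + (\<Sum>i=r..K. tail K (U i) r)"
          unfolding split by (rule sum.union_disjoint) auto
        finally show ?thesis .
      qed
      moreover have "(real K + 1 - real r) / K = 1 - (real r - 1) / K"
        using K by (simp add: field_simps)
      ultimately have "tail K xs r * ((real r - 1) / K) \<le> (\<Sum>i=1..<r. tail K (U i) r)"
        using le by (simp add: right_diff_distrib)
      moreover have "v (r - 1) \<le> v r"
        using r by (intro v_le) auto
      ultimately have "(v r - v (r - 1)) * (tail K xs r * ((real r - 1) / K))
          \<le> (v r - v (r - 1)) * (\<Sum>i=1..<r. tail K (U i) r)"
        by (intro mult_left_mono) auto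
      also have "\<dots> = (\<Sum>i=1..K. if i < r then (v r - v (r - 1)) * tail K (U i) r else 0)"
        unfolding sum_distrib_left using r by (intro sum.mono_neutral_cong_left) auto
      finally show "(v r - v (r - 1)) * tail K xs r * ((real r - 1) / K)
          \<le> (\<Sum>i=1..K. if i < r then (v r - v (r - 1)) * tail K (U i) r else 0)"
        by (simp add: mult.assoc)
    qed
    finally show ?thesis .
  qed
  ultimately show ?thesis
    using \<beta> by (intro bexI[of _ X]) (auto intro!: add_left_mono mult_left_mono)
qed

section \<open>The lowest optimal price\<close>

definition best :: "real \<Rightarrow> market \<Rightarrow> nat" where
  "best \<beta> y = (LEAST i. i \<in> {1..K} \<and> (\<forall>j\<in>{1..K}. score \<beta> y j \<le> score \<beta> y i))"

lemma best_props:
  shows best_range: "best \<beta> y \<in> {1..K}"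
    and score_le_best: "j \<in> {1..K} \<Longrightarrow> score \<beta> y j \<le> score \<beta> y (best \<beta> y)"
proof -
  have "Max (score \<beta> y ` {1..K}) \<in> score \<beta> y ` {1..K}"
    using K by (intro Max_in) auto
  then obtain i where "i \<in> {1..K}" "Max (score \<beta> y ` {1..K}) = score \<beta> y i"
    by blast
  then have "i \<in> {1..K} \<and> (\<forall>j\<in>{1..K}. score \<beta> y j \<le> score \<beta> y i)"
    by (metis Max_ge finite_atLeastAtMost finite_imageI imageI)
  from LeastI[of "\<lambda>i. i \<in> {1..K} \<and> (\<forall>j\<in>{1..K}. score \<beta> y j \<le> score \<beta> y i)", OF this]
  show "best \<beta> y \<in> {1..K}" "j \<in> {1..K} \<Longrightarrow> score \<beta> y j \<le> score \<beta> y (best \<beta> y)"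
    unfolding best_def[symmetric] by auto
qed

text \<open>Comparisons with higher indices suffice: were the lowest maximiser above
  \<open>i\<close>, then \<open>i\<close> would be a maximiser too. This is why plans constrain
  \<open>j > i\<close>.\<close>

lemma best_le:
  assumes "i \<in> {1..K}" "\<And>j. j \<in> {i<..K} \<Longrightarrow> score \<beta> y j \<le> score \<beta> y i"
  shows "best \<beta> y \<le> i"
proof (rule ccontr)
  assume "\<not> best \<beta> y \<le> i"
  then have "score \<beta> y (best \<beta> y) \<le> score \<beta> y i"
    using assms(2) best_range[of \<beta> y] by auto
  then have "\<forall>j\<in>{1..K}. score \<beta> y j \<le> score \<beta> y i"
    using score_le_best[of _ \<beta> y] by (meson order_trans)
  then have "best \<beta> y \<le> i"
    unfolding best_def using assms(1) by (intro Least_le) auto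
  then show False
    using \<open>\<not> best \<beta> y \<le> i\<close> by simp
qed

lemma score_less_best:
  assumes "i \<in> {1..K}" "i < best \<beta> y"
  shows "score \<beta> y i < score \<beta> y (best \<beta> y)"
proof (rule ccontr)
  assume "\<not> score \<beta> y i < score \<beta> y (best \<beta> y)"
  then have "score \<beta> y j \<le> score \<beta> y i" if "j \<in> {1..K}" for j
    using score_le_best[OF that, of \<beta> y] by linarith
  then have "best \<beta> y \<le> i"
    using assms by (intro best_le) auto
  then show False
    using assms by simp
qed

lemma best_eq_iff:
  assumes "i \<in> {1..K}"
  shows "best \<beta> y = i \<longleftrightarrow>
    (\<forall>j\<in>{1..K}. score \<beta> y j \<le> score \<beta> y i) \<and> (\<forall>j\<in>{1..<i}. score \<beta> y j < score \<beta> y i)"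
proof
  assume "best \<beta> y = i"
  then show "(\<forall>j\<in>{1..K}. score \<beta> y j \<le> score \<beta> y i) \<and> (\<forall>j\<in>{1..<i}. score \<beta> y j < score \<beta> y i)"
    using score_le_best[of _ \<beta> y] score_less_best[of _ \<beta> y] assms by auto
next
  assume *: "(\<forall>j\<in>{1..K}. score \<beta> y j \<le> score \<beta> y i) \<and> (\<forall>j\<in>{1..<i}. score \<beta> y j < score \<beta> y i)"
  then have "best \<beta> y \<le> i"
    using assms by (intro best_le) auto
  moreover have "\<not> best \<beta> y < i"
    using * best_range[of \<beta> y] score_le_best[of i \<beta> y] assms by (auto simp: not_le[symmetric])
  ultimately show "best \<beta> y = i"
    by simp
qed

lemma surplus_best_ge:
  assumes "\<And>k. k \<in> {1..K} \<Longrightarrow> 0 \<le> y k" "i \<in> {1..K}" "\<And>j. j \<in> {i<..K} \<Longrightarrow> score \<beta> x j \<le> score \<beta> x i"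
  shows "surplus i y \<le> surplus (best \<beta> x) y"
  using assms best_le[of i \<beta> x] best_range[of \<beta> x] by (intro surplus_antimono) auto

section \<open>Optimal plans and their segmentations\<close>

lemma plan_value_maximum:
  assumes xs: "xs \<in> markets K"
  obtains Y where "Y \<in> plans \<beta> xs" "\<And>Z. Z \<in> plans \<beta> xs \<Longrightarrow> plan_value Z \<le> plan_value Y"
proof -
  \<comment> \<open>A plan is arbitrary off the grid of indices. Pinning these entries to 0 makes
    the set of plans compact, by Tychonoff, and keeps all attained values.\<close>
  define S where "S = (\<lambda>(i, k). if i \<in> {1..K} \<and> k \<in> {1..K} then {0..1::real} else {0})"
  define B where "B = PiE UNIV S"
  define P where "P = {f \<in> B. curry f \<in> plans \<beta> xs}"
  have xs_props: "0 \<le> xs k" "xs k \<le> 1" if "k \<in> {1..K}" for k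
  proof -
    show "0 \<le> xs k"
      using xs that by (auto simp: markets_def)
    have "xs k \<le> (\<Sum>k=1..K. xs k)"
      using xs that by (intro member_le_sum) (auto simp: markets_def)
    then show "xs k \<le> 1"
      using xs by (auto simp: markets_def)
  qed
  have "compact B"
  proof -
    have "compact (S p)" for p
      by (auto simp: S_def split: prod.split)
    then have "compactin (product_topology (\<lambda>_. euclidean) UNIV) B"
      unfolding B_def by (subst compactin_PiE) auto
    then show ?thesis
      by (simp add: euclidean_product_topology)
  qed
  have coord [continuous_intros]: "continuous_on UNIV (\<lambda>f :: nat \<times> nat \<Rightarrow> real. f p)" for p
    by simp
  have score_cont: "continuous_on UNIV (\<lambda>f. score \<beta> (curry f i) j)" for i j
    unfolding score_def tail_def curry_def
    by (intro continuous_intros continuous_on_product_coordinates)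
  have "closed {f. curry f \<in> plans \<beta> xs}"
  proof -
    have "{f. curry f \<in> plans \<beta> xs} =
        (\<Inter>i\<in>{1..K}. \<Inter>k\<in>{1..K}. {f. 0 \<le> f (i, k)}) \<inter>
        (\<Inter>k\<in>{1..K}. {f. (\<Sum>i=1..K. f (i, k)) = xs k}) \<inter>
        (\<Inter>i\<in>{1..K}. \<Inter>j\<in>{i<..K}. {f. score \<beta> (curry f i) j \<le> score \<beta> (curry f i) i})"
      by (auto simp: plans_def)
    also have "closed \<dots>"
      by (intro closed_Int closed_INT ballI closed_Collect_le closed_Collect_eq score_cont continuous_intros)
    finally show ?thesis .
  qed
  then have "compact P"
    using \<open>compact B\<close> unfolding P_def by (simp add: Collect_conj_eq compact_Int_closed)
  moreover have "continuous_on P (\<lambda>f. plan_value (curry f))"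
  proof (rule continuous_on_subset)
    show "continuous_on UNIV (\<lambda>f. plan_value (curry f))"
      unfolding plan_value_def surplus_def curry_def by (intro continuous_intros)
  qed simp
  moreover have restrict: "\<exists>f\<in>P. plan_value (curry f) = plan_value Z" if Z: "Z \<in> plans \<beta> xs" for Z
  proof -
    define f where "f = (\<lambda>(i, k). if i \<in> {1..K} \<and> k \<in> {1..K} then Z i k else 0)"
    have tail_f: "tail K (curry f i) j = tail K (Z i) j" if "i \<in> {1..K}" "1 \<le> j" for i j
      unfolding tail_def using that by (intro sum.cong) (auto simp: f_def)
    have "Z i k \<le> 1" if "i \<in> {1..K}" "k \<in> {1..K}" for i k
    proof -
      have "Z i k \<le> (\<Sum>i=1..K. Z i k)"
        using Z that by (intro member_le_sum) (auto simp: plans_def)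
      then show ?thesis
        using Z that xs_props[of k] by (auto simp: plans_def)
    qed
    then have "f \<in> B"
      using Z by (auto simp: B_def S_def f_def plans_def)
    moreover have "curry f \<in> plans \<beta> xs"
      using Z by (auto simp: plans_def score_def tail_f) (auto simp: f_def)
    moreover have "plan_value (curry f) = plan_value Z"
      unfolding plan_value_def surplus_def by (intro sum.cong) (auto simp: f_def)
    ultimately show ?thesis
      by (auto simp: P_def)
  qed
  moreover have "P \<noteq> {}"
  proof -
    \<comment> \<open>No segmentation: all of \<open>xs\<close> in one segment, at its own lowest
      optimal price.\<close>
    define Z where "Z = (\<lambda>i k. if i = best \<beta> xs then xs k else 0)"
    have "Z i = (if i = best \<beta> xs then xs else (\<lambda>_. 0))" for i
      by (auto simp: Z_def)
    moreover have "score \<beta> (\<lambda>_. 0) i = 0" for i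
      by (simp add: score_def tail_def)
    moreover have "(\<Sum>i=1..K. Z i k) = xs k" for k
      using best_range[of \<beta> xs] by (simp add: Z_def)
    ultimately have "Z \<in> plans \<beta> xs"
      using xs_props score_le_best[of _ \<beta> xs] by (auto simp: plans_def)
    then show ?thesis
      using restrict by blast
  qed
  ultimately obtain f where f: "f \<in> P" "\<forall>g\<in>P. plan_value (curry g) \<le> plan_value (curry f)"
    using continuous_attains_sup[of P "\<lambda>f. plan_value (curry f)"] by blast
  show ?thesis
  proof (rule that[of "curry f"])
    show "curry f \<in> plans \<beta> xs"
      using f by (simp add: P_def)
    show "plan_value Z \<le> plan_value (curry f)" if "Z \<in> plans \<beta> xs" for Z
      using restrict[OF that] f by auto
  qed
qed

definition segmented_surplus :: "real \<Rightarrow> market pmf \<Rightarrow> real" where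
  "segmented_surplus \<beta> \<sigma> = (\<Sum>x\<in>set_pmf \<sigma>. pmf \<sigma> x * surplus (best \<beta> x) x)"

text \<open>Segments with the same lowest optimal price are merged; by linearity of the score that
  price still beats the others.\<close>

lemma segmentation_plan:
  assumes \<sigma>: "segmentation K xs \<sigma>"
  shows "\<exists>Y\<in>plans \<beta> xs. plan_value Y = segmented_surplus \<beta> \<sigma>"
proof -
  define Y where "Y = (\<lambda>i k. \<Sum>x\<in>{x \<in> set_pmf \<sigma>. best \<beta> x = i}. pmf \<sigma> x * x k)"
  have fin: "finite (set_pmf \<sigma>)"
    using \<sigma> by (simp add: segmentation_def)
  have group: "(\<Sum>i=1..K. \<Sum>x\<in>{x \<in> set_pmf \<sigma>. best \<beta> x = i}. f x) = (\<Sum>x\<in>set_pmf \<sigma>. f x)" for f :: "market \<Rightarrow> real"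
    using fin best_range by (intro sum.group) auto
  have "Y \<in> plans \<beta> xs"
    unfolding plans_def
  proof (intro CollectI conjI ballI)
    fix i k assume "i \<in> {1..K}" "k \<in> {1..K}"
    then show "0 \<le> Y i k"
      using \<sigma> by (auto simp: Y_def segmentation_def markets_def subset_iff intro!: sum_nonneg)
  next
    fix k assume "k \<in> {1..K}"
    then show "(\<Sum>i=1..K. Y i k) = xs k"
      unfolding Y_def group using \<sigma> by (simp add: segmentation_def)
  next
    fix i j assume "i \<in> {1..K}" "j \<in> {i<..K}"
    then show "score \<beta> (Y i) j \<le> score \<beta> (Y i) i"
      unfolding Y_def score_sum by (intro sum_mono mult_left_mono) (auto intro!: score_le_best)
  qed
  moreover have "plan_value Y = segmented_surplus \<beta> \<sigma>"
  proof -
    have "surplus i (Y i) = (\<Sum>x\<in>{x \<in> set_pmf \<sigma>. best \<beta> x = i}. pmf \<sigma> x * surplus (best \<beta> x) x)" for i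
      unfolding Y_def surplus_sum by (intro sum.cong) auto
    then show ?thesis
      unfolding plan_value_def segmented_surplus_def by (simp only: group)
  qed
  ultimately show ?thesis
    by blast
qed

text \<open>Each row is normalised to a market whose probability is the mass of the row. Its lowest
  optimal price may be below \<open>v i\<close>, hence only an inequality.\<close>

lemma plan_segmentation:
  assumes xs: "xs \<in> markets K" and Y: "Y \<in> plans \<beta> xs"
  shows "\<exists>\<sigma>. segmentation K xs \<sigma> \<and> plan_value Y \<le> segmented_surplus \<beta> \<sigma>"
proof -
  have Y_nonneg: "0 \<le> Y i k" if "i \<in> {1..K}" "k \<in> {1..K}" for i k
    using Y that by (auto simp: plans_def)
  define m where "m = (\<lambda>i. if i \<in> {1..K} then tail K (Y i) 1 else 0)"
  have m_nonneg: "0 \<le> m i" for i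
    using Y_nonneg by (auto simp: m_def intro!: tail_nonneg)
  have m_sum: "(\<Sum>i=1..K. m i) = 1"
    using plan_tail_sum[OF Y, of 1] tail_market[OF xs] by (simp add: m_def)
  have m_int: "(\<integral>\<^sup>+i. ennreal (m i) \<partial>count_space UNIV) = 1"
  proof -
    have "(\<integral>\<^sup>+i. ennreal (m i) \<partial>count_space UNIV) = (\<Sum>i\<in>{1..K}. ennreal (m i))"
      by (intro nn_integral_count_space'[OF _ _ ]) (auto simp: m_def)
    also have "\<dots> = 1"
      using m_nonneg m_sum by (simp add: sum_ennreal)
    finally show ?thesis .
  qed
  define p where "p = embed_pmf m"
  have pmf_p: "pmf p i = m i" for i
    unfolding p_def using m_nonneg m_int by (rule pmf_embed_pmf)
  have set_p: "set_pmf p \<subseteq> {1..K}"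
    by (auto simp: set_pmf_iff pmf_p m_def split: if_splits)
  define X where "X = (\<lambda>i. \<lambda>k\<in>{1..K}. Y i k / m i)"
  define \<sigma> where "\<sigma> = map_pmf X p"
  have fin: "finite (set_pmf \<sigma>)"
    using set_p finite_subset by (auto simp: \<sigma>_def)
  \<comment> \<open>Different rows may yield the same normalised market; the expectation makes it
    immaterial which rows \<open>map_pmf\<close> merges.\<close>
  have expect: "(\<Sum>x\<in>set_pmf \<sigma>. pmf \<sigma> x * f x) = (\<Sum>i=1..K. m i * f (X i))" for f
  proof -
    have "(\<Sum>x\<in>set_pmf \<sigma>. pmf \<sigma> x * f x) = measure_pmf.expectation \<sigma> f"
      using fin by (subst integral_measure_pmf_real[of "set_pmf \<sigma>"]) (auto simp: mult.commute)
    also have "\<dots> = measure_pmf.expectation p (\<lambda>i. f (X i))"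
      by (simp add: \<sigma>_def)
    also have "\<dots> = (\<Sum>i=1..K. m i * f (X i))"
      using set_p by (subst integral_measure_pmf_real[of "{1..K}"]) (auto simp: pmf_p mult.commute)
    finally show ?thesis .
  qed
  have Y_zero: "Y i k = 0" if "i \<in> {1..K}" "k \<in> {1..K}" "m i = 0" for i k
  proof -
    have "(\<Sum>k=1..K. Y i k) = 0"
      using that by (simp add: m_def tail_def)
    then show ?thesis
      using that Y_nonneg by (subst (asm) sum_nonneg_eq_0_iff) auto
  qed
  have mX: "m i * X i k = Y i k" if "i \<in> {1..K}" "k \<in> {1..K}" for i k
    using that Y_zero[OF that] by (auto simp: X_def)
  have X_market: "X i \<in> markets K" if "i \<in> {1..K}" "0 < m i" for i
    using that Y_nonneg
    by (auto simp: markets_def X_def m_def tail_def simp flip: sum_divide_distrib intro!: divide_nonneg_pos)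
  have tail_X: "tail K (X i) j = tail K (Y i) j / m i" if "1 \<le> j" for i j
    unfolding tail_def using that by (auto simp: X_def sum_divide_distrib intro!: sum.cong)
  have "segmentation K xs \<sigma>"
    unfolding segmentation_def
  proof (intro conjI ballI)
    show "set_pmf \<sigma> \<subseteq> markets K"
    proof
      fix x assume "x \<in> set_pmf \<sigma>"
      then obtain i where "i \<in> set_pmf p" "x = X i"
        by (auto simp: \<sigma>_def)
      then show "x \<in> markets K"
        using set_p m_nonneg[of i] by (auto simp: set_pmf_iff pmf_p less_le intro!: X_market)
    qed
    fix k assume k: "k \<in> {1..K}"
    then show "(\<Sum>x\<in>set_pmf \<sigma>. pmf \<sigma> x * x k) = xs k"
      using Y by (simp add: expect[of "\<lambda>x. x k"] mX plans_def)
  qed (rule fin)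
  moreover have "plan_value Y \<le> segmented_surplus \<beta> \<sigma>"
    unfolding plan_value_def segmented_surplus_def expect
  proof (rule sum_mono)
    fix i assume i: "i \<in> {1..K}"
    have "surplus i (Y i) = m i * surplus i (X i)"
      unfolding surplus_def sum_distrib_left using i mX[OF i]
      by (intro sum.cong) (auto simp: mult.assoc[symmetric])
    also have "\<dots> \<le> m i * surplus (best \<beta> (X i)) (X i)"
    proof (cases "m i = 0")
      case False
      then have mi: "0 < m i"
        using m_nonneg[of i] by simp
      have sc: "score \<beta> (X i) j = score \<beta> (Y i) j / m i" if "j \<in> {1..K}" for j
        using that by (simp add: score_def tail_X add_divide_distrib)
      have "surplus i (X i) \<le> surplus (best \<beta> (X i)) (X i)"
        using i X_market[OF i mi] Y mi
        by (intro surplus_best_ge) (auto simp: sc markets_def plans_def intro!: divide_right_mono)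
      then show ?thesis
        using mi by simp
    qed simp
    finally show "surplus i (Y i) \<le> m i * surplus (best \<beta> (X i)) (X i)" .
  qed
  ultimately show ?thesis
    by blast
qed

section \<open>Consumer utility under the privacy mechanism\<close>

lemma prob_space_unif: "prob_space (unif_market K)"
  using K by (rule prob_space_unif_market)

lemma integrable_unif:
  fixes g :: "market \<Rightarrow> real"
  assumes "g \<in> borel_measurable (market_space K)" "\<And>x. x \<in> markets K \<Longrightarrow> \<bar>g x\<bar> \<le> B"
  shows "integrable (unif_market K) g"
proof -
  interpret prob_space "unif_market K"
    by (rule prob_space_unif)
  show ?thesis
    using assms by (intro integrable_const_bound[where B=B]) auto
qed

lemma market_bounds:
  assumes "x \<in> markets K" "k \<in> {1..K}"
  shows "0 \<le> x k" "x k \<le> 1"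
proof -
  show "0 \<le> x k"
    using assms by (auto simp: markets_def)
  have "x k \<le> (\<Sum>k=1..K. x k)"
    using assms by (intro member_le_sum) (auto simp: markets_def)
  then show "x k \<le> 1"
    using assms by (auto simp: markets_def)
qed

lemma integral_mechanism:
  fixes g :: "market \<Rightarrow> real"
  assumes \<beta>: "0 \<le> \<beta>" "\<beta> \<le> 1" and x: "x \<in> markets K"
    and g: "g \<in> borel_measurable (market_space K)" "\<And>x. x \<in> markets K \<Longrightarrow> \<bar>g x\<bar> \<le> B"
  shows "(\<integral>y. g y \<partial>mechanism K \<beta> x) = (1 - \<beta>) * g x + \<beta> * (\<integral>y. g y \<partial>unif_market K)"
proof -
  let ?N = "\<lambda>resample. if resample then unif_market K else return (market_space K) x"
  have x': "x \<in> space (market_space K)"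
    using x by (simp add: space_market_space)
  have prob: "prob_space (?N r)" for r
    using prob_space_unif prob_space_return[OF x'] by auto
  have sets: "sets (?N r) = sets (market_space K)" for r
    by simp
  have N: "?N \<in> measure_pmf (bernoulli_pmf \<beta>) \<rightarrow>\<^sub>M subprob_algebra (market_space K)"
    using prob sets by (simp add: space_subprob_algebra prob_space_imp_subprob_space del: if_split)
  have "(\<integral>y. g y \<partial>mechanism K \<beta> x) = (\<integral>r. (\<integral>y. g y \<partial>?N r) \<partial>measure_pmf (bernoulli_pmf \<beta>))"
    unfolding mechanism_def
  proof (rule integral_bind[OF g(1) _ N])
    show "AE r in measure_pmf (bernoulli_pmf \<beta>). emeasure (?N r) (space (?N r)) \<le> ennreal 1"
      using prob_space.emeasure_space_1[OF prob] by (intro AE_I2) (simp only: ennreal_1 order_refl)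
  qed (use g in \<open>auto simp: space_market_space intro: measure_pmf.finite_measure\<close>)
  also have "\<dots> = (1 - \<beta>) * g x + \<beta> * (\<integral>y. g y \<partial>unif_market K)"
    using \<beta> x' g(1) by (simp add: integral_return)
  finally show ?thesis .
qed

text \<open>By symmetry all masses have the same mean, and they sum to 1.\<close>

lemma integral_component:
  assumes k: "k \<in> {1..K}"
  shows "(\<integral>x. x k \<partial>unif_market K) = 1 / K"
proof -
  interpret prob_space "unif_market K"
    by (rule prob_space_unif)
  have int: "integrable (unif_market K) (\<lambda>x. x k)" if "k \<in> {1..K}" for k
    using that market_bounds by (intro integrable_unif[where B=1] market_component_measurable) auto
  have eq: "(\<integral>x. x j \<partial>unif_market K) = (\<integral>x. x K \<partial>unif_market K)" if "j \<in> {1..K}" for j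
  proof (cases "j = K")
    case False
    then have j: "j \<in> {1..<K}"
      using that by auto
    have "(\<integral>x. x j \<partial>unif_market K) = (\<integral>x. x j \<partial>distr (unif_market K) (market_space K) (swap_last K j))"
      using K j by (simp add: distr_swap_last)
    also have "\<dots> = (\<integral>x. swap_last K j x j \<partial>unif_market K)"
      using that j by (subst integral_distr) (auto intro: market_component_measurable)
    also have "\<dots> = (\<integral>x. x K \<partial>unif_market K)"
      using j by (simp add: swap_last_def)
    finally show ?thesis .
  qed simp
  have "1 = (\<integral>x. (\<Sum>k=1..K. x k) \<partial>unif_market K)"
  proof -
    have "(\<integral>x. (\<Sum>k=1..K. x k) \<partial>unif_market K) = (\<integral>x. 1 \<partial>unif_market K)"
      by (intro Bochner_Integration.integral_cong) (auto simp: markets_def)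
    then show ?thesis
      using prob_space by simp
  qed
  also have "\<dots> = (\<Sum>k=1..K. (\<integral>x. x k \<partial>unif_market K))"
    using int by (intro Bochner_Integration.integral_sum) auto
  also have "\<dots> = (\<Sum>k=1..K. (\<integral>x. x K \<partial>unif_market K))"
    by (intro sum.cong refl eq)
  finally show ?thesis
    using eq[OF k] K by (simp add: field_simps)
qed

lemma integral_tail:
  assumes i: "i \<in> {1..K}"
  shows "(\<integral>x. tail K x i \<partial>unif_market K) = (real K + 1 - real i) / K"
proof -
  have "(\<integral>x. tail K x i \<partial>unif_market K) = (\<Sum>k=i..K. (\<integral>x. x k \<partial>unif_market K))"
    unfolding tail_def using i market_bounds
    by (intro Bochner_Integration.integral_sum integrable_unif[where B=1] market_component_measurable) auto
  also have "\<dots> = (\<Sum>k=i..K. 1 / K)"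
    using i by (intro sum.cong integral_component) auto
  also have "\<dots> = (real K + 1 - real i) / K"
    using i by (simp add: of_nat_diff)
  finally show ?thesis .
qed

section \<open>Posterior revenue and optimal prices\<close>

lemma producer_utility_grid:
  assumes i: "i \<in> {1..K}"
  shows "producer_utility K v (v i) x = v i * tail K x i"
proof -
  have iff: "v i \<le> v k \<longleftrightarrow> i \<le> k" if "k \<in> {1..K}" for k
    using v_le[of i k] v_less[of k i] i that by (auto simp: not_le[symmetric])
  have "(\<Sum>k=1..K. x k * of_bool (v i \<le> v k)) = (\<Sum>k=i..K. x k)"
    using i iff by (intro sum.mono_neutral_cong_right) auto
  then show ?thesis
    by (simp add: producer_utility_def tail_def)
qed

lemma consumer_utility_grid: "consumer_utility K v (v i) x = surplus i x"
  unfolding consumer_utility_def surplus_def by (intro sum.cong) auto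

lemma producer_utility_measurable: "producer_utility K v p \<in> borel_measurable (market_space K)"
  unfolding producer_utility_def
  by (intro borel_measurable_times borel_measurable_const borel_measurable_sum market_component_measurable)

lemma producer_utility_bound:
  assumes "x \<in> markets K"
  shows "\<bar>producer_utility K v p x\<bar> \<le> \<bar>p\<bar>"
proof -
  have "0 \<le> (\<Sum>k=1..K. x k * of_bool (p \<le> v k))"
    using market_bounds[OF assms] by (intro sum_nonneg) auto
  moreover have "(\<Sum>k=1..K. x k * of_bool (p \<le> v k)) \<le> (\<Sum>k=1..K. x k)"
    using market_bounds[OF assms] by (intro sum_mono) auto
  moreover have "(\<Sum>k=1..K. x k) = 1"
    using assms by (simp add: markets_def)
  ultimately have "\<bar>p\<bar> * \<bar>\<Sum>k=1..K. x k * of_bool (p \<le> v k)\<bar> \<le> \<bar>p\<bar> * 1"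
    by (intro mult_left_mono) auto
  then show ?thesis
    by (simp add: producer_utility_def abs_mult)
qed

lemma posterior_revenue_eq:
  assumes "0 \<le> \<beta>" "\<beta> \<le> 1" "x \<in> markets K"
  shows "posterior_revenue K v \<beta> p x =
    (1 - \<beta>) * producer_utility K v p x + \<beta> * (\<integral>y. producer_utility K v p y \<partial>unif_market K)"
  unfolding posterior_revenue_def posterior_def
  using assms producer_utility_measurable producer_utility_bound by (intro integral_mechanism)

lemma posterior_revenue_grid:
  assumes "0 \<le> \<beta>" "\<beta> \<le> 1" "x \<in> markets K" "i \<in> {1..K}"
  shows "posterior_revenue K v \<beta> (v i) x = score \<beta> x i"
  using assms
  by (simp add: posterior_revenue_eq producer_utility_grid integral_tail score_def weight_def tail_market)

text \<open>Rounding \<open>p\<close> up to the next value keeps all buyers and raises the price;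
  above \<open>v K\<close> nobody buys.\<close>

lemma posterior_revenue_le_grid:
  assumes \<beta>: "0 \<le> \<beta>" "\<beta> \<le> 1" and x: "x \<in> markets K" and p: "0 \<le> p"
  shows "\<exists>i\<in>{1..K}. posterior_revenue K v \<beta> p x \<le> posterior_revenue K v \<beta> (v i) x"
proof -
  \<comment> \<open>The index must not depend on \<open>y\<close>, because the inequality is also
    integrated over the uniform market.\<close>
  have "\<exists>i\<in>{1..K}. \<forall>y\<in>markets K. producer_utility K v p y \<le> producer_utility K v (v i) y"
  proof (cases "p \<le> v K")
    case True
    define i where "i = (LEAST i. i \<in> {1..K} \<and> p \<le> v i)"
    have i: "i \<in> {1..K}" "p \<le> v i"
      using LeastI[of "\<lambda>i. i \<in> {1..K} \<and> p \<le> v i" K] True K by (auto simp: i_def)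
    have above: "v i \<le> v k" if "k \<in> {1..K}" "p \<le> v k" for k
    proof -
      have "i \<le> k"
        unfolding i_def using that by (intro Least_le) auto
      then show ?thesis
        using i that by (intro v_le) auto
    qed
    have "producer_utility K v p y \<le> producer_utility K v (v i) y" if y: "y \<in> markets K" for y
      unfolding producer_utility_def
    proof (rule mult_mono)
      show "(\<Sum>k=1..K. y k * of_bool (p \<le> v k)) \<le> (\<Sum>k=1..K. y k * of_bool (v i \<le> v k))"
        using market_bounds[OF y] above by (intro sum_mono mult_left_mono) (auto simp: of_bool_def)
      show "0 \<le> (\<Sum>k=1..K. y k * of_bool (p \<le> v k))"
        using market_bounds[OF y] by (intro sum_nonneg) auto
    qed (use i v_pos[of i] in auto)
    then show ?thesis
      using i by blast
  next
    case False
    then have "\<not> p \<le> v k" if "k \<in> {1..K}" for k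
      using v_le[of k K] that by auto
    then have "producer_utility K v p y = 0" for y
      by (simp add: producer_utility_def)
    moreover have "0 \<le> producer_utility K v (v K) y" if "y \<in> markets K" for y
      using market_bounds[OF that] v_pos[of K] K
      by (auto simp: producer_utility_def intro!: mult_nonneg_nonneg sum_nonneg)
    ultimately show ?thesis
      using K by (intro bexI[of _ K]) auto
  qed
  then obtain i where i: "i \<in> {1..K}"
    and le: "\<And>y. y \<in> markets K \<Longrightarrow> producer_utility K v p y \<le> producer_utility K v (v i) y"
    by blast
  have int: "integrable (unif_market K) (producer_utility K v q)" for q
    using producer_utility_measurable producer_utility_bound by (rule integrable_unif)
  have "(\<integral>y. producer_utility K v p y \<partial>unif_market K) \<le> (\<integral>y. producer_utility K v (v i) y \<partial>unif_market K)"
    using le by (intro integral_mono int) auto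
  then have "posterior_revenue K v \<beta> p x \<le> posterior_revenue K v \<beta> (v i) x"
    unfolding posterior_revenue_eq[OF \<beta> x] using \<beta> le[OF x]
    by (intro add_mono mult_left_mono) auto
  then show ?thesis
    using i by blast
qed

lemma optimal_price_grid:
  assumes \<beta>: "0 \<le> \<beta>" "\<beta> \<le> 1" and x: "x \<in> markets K" and i: "i \<in> {1..K}"
  shows "optimal_price K v \<beta> x (v i) \<longleftrightarrow> (\<forall>j\<in>{1..K}. score \<beta> x j \<le> score \<beta> x i)"
proof
  assume "optimal_price K v \<beta> x (v i)"
  then have "\<not> posterior_revenue K v \<beta> (v j) x > posterior_revenue K v \<beta> (v i) x" if "j \<in> {1..K}" for j
    using that v_pos[of j] by (auto simp: optimal_price_def is_arg_max_def)
  then show "\<forall>j\<in>{1..K}. score \<beta> x j \<le> score \<beta> x i"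
    using posterior_revenue_grid[OF \<beta> x] i by (auto simp: not_less)
next
  assume *: "\<forall>j\<in>{1..K}. score \<beta> x j \<le> score \<beta> x i"
  have "posterior_revenue K v \<beta> p x \<le> posterior_revenue K v \<beta> (v i) x" if "0 \<le> p" for p
    using posterior_revenue_le_grid[OF \<beta> x that] posterior_revenue_grid[OF \<beta> x] i * by force
  then show "optimal_price K v \<beta> x (v i)"
    using v_pos[of i] i by (auto simp: optimal_price_def is_arg_max_def not_less less_imp_le)
qed

section \<open>Measurability of the price, and the noise surplus\<close>

lemma score_measurable:
  assumes "i \<in> {1..K}"
  shows "(\<lambda>x. score \<beta> x i) \<in> borel_measurable (market_space K)"
  unfolding score_def using assms
  by (intro borel_measurable_add borel_measurable_times borel_measurable_const tail_measurable) auto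

lemma best_eq_sets:
  assumes i: "i \<in> {1..K}"
  shows "{x \<in> markets K. best \<beta> x = i} \<in> sets (market_space K)"
proof -
  have 1: "Measurable.pred (market_space K) (\<lambda>x. score \<beta> x j \<le> score \<beta> x i)" if "j \<in> {1..K}" for j
    unfolding pred_def using i that by (intro borel_measurable_le score_measurable)
  have 2: "Measurable.pred (market_space K) (\<lambda>x. score \<beta> x j < score \<beta> x i)" if "j \<in> {1..K}" for j
    unfolding pred_def using i that by (intro borel_measurable_less score_measurable)
  have "Measurable.pred (market_space K) (\<lambda>x. best \<beta> x = i)"
    unfolding best_eq_iff[OF i] using i by (intro pred_intros_logic pred_intros_finite 1 2) auto
  then show ?thesis
    by (simp add: pred_def space_market_space)
qed

lemma best_less_sets: "{x \<in> markets K. best \<beta> x < r} \<in> sets (market_space K)"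
proof -
  have "{x \<in> markets K. best \<beta> x < r} = (\<Union>i\<in>{i \<in> {1..K}. i < r}. {x \<in> markets K. best \<beta> x = i})"
    using best_range[of \<beta>] by auto
  also have "\<dots> \<in> sets (market_space K)"
    using best_eq_sets by (intro sets.finite_UN) auto
  finally show ?thesis .
qed

text \<open>This is \<open>G \<beta>\<close>: the price is set on the random market
  \<open>x\<close>, but the buyers come from \<open>xs\<close>.\<close>

definition noise_surplus :: "real \<Rightarrow> market \<Rightarrow> real" where
  "noise_surplus \<beta> xs = (\<integral>x. surplus (best \<beta> x) xs \<partial>unif_market K)"

lemma surplus_best_measurable:
  "(\<lambda>x. surplus (best \<beta> x) xs) \<in> borel_measurable (market_space K)"
proof -
  have ind: "(\<lambda>x. indicator {x \<in> markets K. best \<beta> x = i} x :: real) \<in> borel_measurable (market_space K)"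
    if "i \<in> {1..K}" for i
    using best_eq_sets[OF that] by (rule borel_measurable_indicator)
  have "(\<lambda>x. \<Sum>i=1..K. indicator {x \<in> markets K. best \<beta> x = i} x * surplus i xs) \<in> borel_measurable (market_space K)"
    using ind by (intro borel_measurable_sum borel_measurable_times borel_measurable_const) auto
  moreover have "(\<Sum>i=1..K. indicator {x \<in> markets K. best \<beta> x = i} x * surplus i xs) = surplus (best \<beta> x) xs"
    if "x \<in> markets K" for x
  proof -
    have "(\<Sum>i=1..K. indicator {x \<in> markets K. best \<beta> x = i} x * surplus i xs)
        = (\<Sum>i=1..K. if best \<beta> x = i then surplus i xs else 0)"
      using that by (intro sum.cong) (auto simp: indicator_def)
    then show ?thesis
      using best_range[of \<beta> x] by simp
  qed
  ultimately show ?thesis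
    by (subst measurable_cong) (auto simp: space_market_space)
qed

lemma surplus_bound:
  assumes xs: "xs \<in> markets K" and i: "i \<in> {1..K}"
  shows "0 \<le> surplus i xs" "surplus i xs \<le> v K"
proof -
  show "0 \<le> surplus i xs"
    unfolding surplus_def using market_bounds[OF xs] by (intro sum_nonneg) auto
  have "surplus i xs \<le> (\<Sum>k=1..K. xs k * v K)"
    unfolding surplus_def
  proof (intro sum_mono mult_left_mono)
    fix k assume k: "k \<in> {1..K}"
    then show "max 0 (v k - v i) \<le> v K"
      using v_le[of k K] v_pos[of i] v_pos[of K] i K by auto
    show "0 \<le> xs k"
      using market_bounds[OF xs k] by simp
  qed
  also have "\<dots> = v K"
    using xs by (simp add: markets_def flip: sum_distrib_right)
  finally show "surplus i xs \<le> v K" .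
qed

lemma integrable_surplus_best:
  assumes "xs \<in> markets K"
  shows "integrable (unif_market K) (\<lambda>x. surplus (best \<beta> x) xs)"
  using surplus_bound[OF assms best_range] surplus_best_measurable
  by (intro integrable_unif[where B="v K"]) auto

section \<open>Consumer utility under pricing rules\<close>

lemma rule_expectation:
  fixes f :: "real \<Rightarrow> real"
  assumes "set_pmf q \<subseteq> v ` {1..K}"
  shows "measure_pmf.expectation q f = (\<Sum>k=1..K. pmf q (v k) * f (v k))"
proof -
  have inj: "inj_on v {1..K}"
    using v_mono by (rule strict_mono_on_imp_inj_on)
  have "measure_pmf.expectation q f = (\<Sum>a\<in>v ` {1..K}. f a * pmf q a)"
    using assms by (intro integral_measure_pmf_real) auto
  also have "\<dots> = (\<Sum>k=1..K. f (v k) * pmf q (v k))"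
    using inj by (subst sum.reindex) auto
  finally show ?thesis
    by (simp add: mult.commute)
qed

lemma rule_expectation_measurable:
  fixes f :: "real \<Rightarrow> real"
  assumes "optimal_pricing_rule K v \<beta> \<phi>"
  shows "(\<lambda>xh. measure_pmf.expectation (\<phi> xh) f) \<in> borel_measurable (market_space K)"
proof -
  have "(\<lambda>xh. \<Sum>k=1..K. pmf (\<phi> xh) (v k) * f (v k)) \<in> borel_measurable (market_space K)"
    using assms by (intro borel_measurable_sum borel_measurable_times borel_measurable_const)
      (auto simp: optimal_pricing_rule_def)
  moreover have "measure_pmf.expectation (\<phi> xh) f = (\<Sum>k=1..K. pmf (\<phi> xh) (v k) * f (v k))"
    if "xh \<in> markets K" for xh
    using assms that by (intro rule_expectation) (auto simp: optimal_pricing_rule_def)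
  ultimately show ?thesis
    by (subst measurable_cong) (auto simp: space_market_space)
qed

lemma rule_expectation_bound:
  fixes f :: "real \<Rightarrow> real"
  assumes "optimal_pricing_rule K v \<beta> \<phi>" "xh \<in> markets K"
  shows "\<bar>measure_pmf.expectation (\<phi> xh) f\<bar> \<le> (\<Sum>k=1..K. \<bar>f (v k)\<bar>)"
proof -
  have "measure_pmf.expectation (\<phi> xh) f = (\<Sum>k=1..K. pmf (\<phi> xh) (v k) * f (v k))"
    using assms by (intro rule_expectation) (auto simp: optimal_pricing_rule_def)
  also have "\<bar>\<dots>\<bar> \<le> (\<Sum>k=1..K. \<bar>pmf (\<phi> xh) (v k) * f (v k)\<bar>)"
    by (rule sum_abs)
  also have "\<dots> \<le> (\<Sum>k=1..K. \<bar>f (v k)\<bar>)"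
    by (intro sum_mono) (auto simp: abs_mult pmf_le_1 intro!: mult_left_le_one_le)
  finally show ?thesis .
qed

text \<open>Every charged price is optimal, hence at least \<open>v (best \<beta> xh)\<close>, and
  surplus falls with the price. The buyers \<open>y\<close> are separate from the observed market
  \<open>xh\<close>, so that the bound also serves for the noise.\<close>

lemma rule_expectation_le:
  assumes \<beta>: "0 \<le> \<beta>" "\<beta> \<le> 1" and \<phi>: "optimal_pricing_rule K v \<beta> \<phi>" and xh: "xh \<in> markets K"
    and y: "\<And>k. k \<in> {1..K} \<Longrightarrow> 0 \<le> y k"
  shows "measure_pmf.expectation (\<phi> xh) (\<lambda>q. consumer_utility K v q y) \<le> surplus (best \<beta> xh) y"
proof -
  have supp: "set_pmf (\<phi> xh) \<subseteq> v ` {1..K}"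
    using \<phi> xh by (auto simp: optimal_pricing_rule_def)
  have "measure_pmf.expectation (\<phi> xh) (\<lambda>q. consumer_utility K v q y)
      = (\<Sum>k=1..K. pmf (\<phi> xh) (v k) * surplus k y)"
    using supp by (simp add: rule_expectation consumer_utility_grid)
  also have "\<dots> \<le> (\<Sum>k=1..K. pmf (\<phi> xh) (v k) * surplus (best \<beta> xh) y)"
  proof (rule sum_mono)
    fix k assume k: "k \<in> {1..K}"
    show "pmf (\<phi> xh) (v k) * surplus k y \<le> pmf (\<phi> xh) (v k) * surplus (best \<beta> xh) y"
    proof (cases "v k \<in> set_pmf (\<phi> xh)")
      case True
      then have "optimal_price K v \<beta> xh (v k)"
        using \<phi> xh by (auto simp: optimal_pricing_rule_def)
      then have "\<forall>j\<in>{1..K}. score \<beta> xh j \<le> score \<beta> xh k"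
        using optimal_price_grid[OF \<beta> xh k] by simp
      then show ?thesis
        using k y by (intro mult_left_mono surplus_best_ge) auto
    next
      case False
      then show ?thesis
        by (simp add: set_pmf_iff)
    qed
  qed
  also have "\<dots> = measure_pmf.expectation (\<phi> xh) (\<lambda>q. surplus (best \<beta> xh) y)"
    using supp by (subst rule_expectation) auto
  also have "\<dots> = surplus (best \<beta> xh) y"
    by simp
  finally show ?thesis .
qed

definition lowest_rule :: "real \<Rightarrow> market \<Rightarrow> real pmf" where
  "lowest_rule \<beta> x = return_pmf (v (best \<beta> x))"

lemma lowest_rule_optimal:
  assumes \<beta>: "0 \<le> \<beta>" "\<beta> \<le> 1"
  shows "optimal_pricing_rule K v \<beta> (lowest_rule \<beta>)"
  unfolding optimal_pricing_rule_def
proof (intro conjI ballI)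
  fix k assume k: "k \<in> {1..K}"
  have inj: "inj_on v {1..K}"
    using v_mono by (rule strict_mono_on_imp_inj_on)
  have "pmf (lowest_rule \<beta> x) (v k) = indicator {x \<in> markets K. best \<beta> x = k} x" if "x \<in> markets K" for x
    using that inj_on_eq_iff[OF inj best_range[of \<beta> x] k]
    by (auto simp: lowest_rule_def indicator_def)
  then show "(\<lambda>x. pmf (lowest_rule \<beta> x) (v k)) \<in> borel_measurable (market_space K)"
    using best_eq_sets[OF k] by (subst measurable_cong) (auto simp: space_market_space)
next
  fix x assume x: "x \<in> markets K"
  show "set_pmf (lowest_rule \<beta> x) \<subseteq> v ` {1..K}"
    using best_range[of \<beta> x] by (auto simp: lowest_rule_def)
  fix q assume "q \<in> set_pmf (lowest_rule \<beta> x)"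
  then show "optimal_price K v \<beta> x q"
    using optimal_price_grid[OF \<beta> x best_range] score_le_best by (auto simp: lowest_rule_def)
qed

lemma expected_utility_eq:
  assumes \<beta>: "0 \<le> \<beta>" "\<beta> \<le> 1" and \<phi>: "optimal_pricing_rule K v \<beta> \<phi>" and x: "x \<in> markets K"
  shows "expected_utility K \<beta> \<phi> u x = (1 - \<beta>) * measure_pmf.expectation (\<phi> x) (\<lambda>q. u q x)
    + \<beta> * (\<integral>xh. measure_pmf.expectation (\<phi> xh) (\<lambda>q. u q x) \<partial>unif_market K)"
  unfolding expected_utility_def
  using \<beta> x rule_expectation_measurable[OF \<phi>] rule_expectation_bound[OF \<phi>] by (intro integral_mechanism)

lemma segmentation_surplus:
  assumes \<sigma>: "segmentation K xs \<sigma>"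
  shows "(\<Sum>x\<in>set_pmf \<sigma>. pmf \<sigma> x * surplus i x) = surplus i xs"
proof -
  have "(\<Sum>x\<in>set_pmf \<sigma>. pmf \<sigma> x * surplus i x) = surplus i (\<lambda>k. \<Sum>x\<in>set_pmf \<sigma>. pmf \<sigma> x * x k)"
    by (rule surplus_sum[symmetric])
  also have "\<dots> = surplus i xs"
    unfolding surplus_def using \<sigma> by (intro sum.cong) (auto simp: segmentation_def)
  finally show ?thesis .
qed

text \<open>In the noise part the price is independent of the segment and surplus is linear, so
  averaging over the segments gives back \<open>xs\<close>.\<close>

lemma segmentation_utility:
  assumes \<beta>: "0 \<le> \<beta>" "\<beta> \<le> 1" and \<phi>: "optimal_pricing_rule K v \<beta> \<phi>" and \<sigma>: "segmentation K xs \<sigma>"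
  shows "(\<Sum>x\<in>set_pmf \<sigma>. pmf \<sigma> x * expected_utility K \<beta> \<phi> (consumer_utility K v) x) =
    (1 - \<beta>) * (\<Sum>x\<in>set_pmf \<sigma>. pmf \<sigma> x * measure_pmf.expectation (\<phi> x) (\<lambda>q. consumer_utility K v q x))
    + \<beta> * (\<integral>xh. measure_pmf.expectation (\<phi> xh) (\<lambda>q. consumer_utility K v q xs) \<partial>unif_market K)"
proof -
  let ?E = "\<lambda>xh y. measure_pmf.expectation (\<phi> xh) (\<lambda>q. consumer_utility K v q y)"
  have x: "x \<in> markets K" if "x \<in> set_pmf \<sigma>" for x
    using \<sigma> that by (auto simp: segmentation_def)
  have int: "integrable (unif_market K) (\<lambda>xh. ?E xh y)" for y
    using rule_expectation_measurable[OF \<phi>] rule_expectation_bound[OF \<phi>] by (rule integrable_unif)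
  have E: "?E xh y = (\<Sum>k=1..K. pmf (\<phi> xh) (v k) * surplus k y)" if "xh \<in> markets K" for xh y
    using \<phi> that by (subst rule_expectation) (auto simp: optimal_pricing_rule_def consumer_utility_grid)
  have lin: "(\<Sum>x\<in>set_pmf \<sigma>. pmf \<sigma> x * ?E xh x) = ?E xh xs" if "xh \<in> markets K" for xh
  proof -
    have "(\<Sum>x\<in>set_pmf \<sigma>. pmf \<sigma> x * ?E xh x)
        = (\<Sum>k=1..K. pmf (\<phi> xh) (v k) * (\<Sum>x\<in>set_pmf \<sigma>. pmf \<sigma> x * surplus k x))"
      unfolding E[OF that] sum_distrib_left by (subst sum.swap) (simp add: mult.left_commute)
    then show ?thesis
      unfolding E[OF that] segmentation_surplus[OF \<sigma>] .
  qed
  have "(\<Sum>x\<in>set_pmf \<sigma>. pmf \<sigma> x * (\<integral>xh. ?E xh x \<partial>unif_market K))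
      = (\<integral>xh. (\<Sum>x\<in>set_pmf \<sigma>. pmf \<sigma> x * ?E xh x) \<partial>unif_market K)"
    using int by (subst Bochner_Integration.integral_sum) auto
  also have "\<dots> = (\<integral>xh. ?E xh xs \<partial>unif_market K)"
    using lin by (intro Bochner_Integration.integral_cong) auto
  finally have noise: "(\<Sum>x\<in>set_pmf \<sigma>. pmf \<sigma> x * (\<integral>xh. ?E xh x \<partial>unif_market K)) = (\<integral>xh. ?E xh xs \<partial>unif_market K)" .
  have "(\<Sum>x\<in>set_pmf \<sigma>. pmf \<sigma> x * expected_utility K \<beta> \<phi> (consumer_utility K v) x)
      = (\<Sum>x\<in>set_pmf \<sigma>. (1 - \<beta>) * (pmf \<sigma> x * ?E x x) + \<beta> * (pmf \<sigma> x * (\<integral>xh. ?E xh x \<partial>unif_market K)))"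
  proof (rule sum.cong)
    fix y assume "y \<in> set_pmf \<sigma>"
    from expected_utility_eq[OF \<beta> \<phi> x[OF this], of "consumer_utility K v"]
    show "pmf \<sigma> y * expected_utility K \<beta> \<phi> (consumer_utility K v) y
        = (1 - \<beta>) * (pmf \<sigma> y * ?E y y) + \<beta> * (pmf \<sigma> y * (\<integral>xh. ?E xh y \<partial>unif_market K))"
      by (simp only:) (simp add: algebra_simps)
  qed simp
  then show ?thesis
    by (simp add: sum.distrib noise flip: sum_distrib_left)
qed

text \<open>The two parts of \<open>segmentation_utility\<close> are bounded separately; the lowest
  rule and a segmentation from an optimal plan attain both bounds at once, so the value of
  \<open>GREATEST\<close> is a true maximum.\<close>

lemma consumer_utilities:
  assumes \<beta>: "0 \<le> \<beta>" "\<beta> < 1" and xs: "xs \<in> markets K"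
  obtains Y where "Y \<in> plans \<beta> xs" "\<And>Z. Z \<in> plans \<beta> xs \<Longrightarrow> plan_value Z \<le> plan_value Y"
    "(1 - \<beta>) * plan_value Y + \<beta> * noise_surplus \<beta> xs \<in> fst ` utility_set K v xs \<beta>"
    "\<And>w. w \<in> fst ` utility_set K v xs \<beta> \<Longrightarrow> w \<le> (1 - \<beta>) * plan_value Y + \<beta> * noise_surplus \<beta> xs"
    "max_consumer_utility K v xs \<beta> = (1 - \<beta>) * plan_value Y + \<beta> * noise_surplus \<beta> xs"
proof -
  obtain Y where Y: "Y \<in> plans \<beta> xs" and Y_max: "\<And>Z. Z \<in> plans \<beta> xs \<Longrightarrow> plan_value Z \<le> plan_value Y"
    using plan_value_maximum[OF xs, of \<beta>] by blast
  let ?m = "(1 - \<beta>) * plan_value Y + \<beta> * noise_surplus \<beta> xs"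
  have \<beta>1: "\<beta> \<le> 1"
    using \<beta> by simp
  have xs_nonneg: "0 \<le> xs k" if "k \<in> {1..K}" for k
    using market_bounds[OF xs that] by simp
  have le: "w \<le> ?m" if w_mem: "w \<in> fst ` utility_set K v xs \<beta>" for w
  proof -
    obtain \<sigma> \<phi> where \<sigma>: "segmentation K xs \<sigma>" and \<phi>: "optimal_pricing_rule K v \<beta> \<phi>"
      and w: "w = (\<Sum>x\<in>set_pmf \<sigma>. pmf \<sigma> x * expected_utility K \<beta> \<phi> (consumer_utility K v) x)"
      using w_mem by (auto simp: utility_set_def)
    have "(\<Sum>x\<in>set_pmf \<sigma>. pmf \<sigma> x * measure_pmf.expectation (\<phi> x) (\<lambda>q. consumer_utility K v q x))
        \<le> segmented_surplus \<beta> \<sigma>"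
      unfolding segmented_surplus_def using \<sigma> market_bounds
      by (intro sum_mono mult_left_mono rule_expectation_le[OF \<beta>(1) \<beta>1 \<phi>]) (auto simp: segmentation_def)
    also have "\<dots> \<le> plan_value Y"
      using segmentation_plan[OF \<sigma>, of \<beta>] Y_max by metis
    finally have 1: "(1 - \<beta>) * (\<Sum>x\<in>set_pmf \<sigma>. pmf \<sigma> x * measure_pmf.expectation (\<phi> x) (\<lambda>q. consumer_utility K v q x))
        \<le> (1 - \<beta>) * plan_value Y"
      using \<beta> by (intro mult_left_mono) auto
    have "(\<integral>xh. measure_pmf.expectation (\<phi> xh) (\<lambda>q. consumer_utility K v q xs) \<partial>unif_market K)
        \<le> noise_surplus \<beta> xs"
      unfolding noise_surplus_def
    proof (rule integral_mono)
      show "integrable (unif_market K) (\<lambda>xh. measure_pmf.expectation (\<phi> xh) (\<lambda>q. consumer_utility K v q xs))"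
        using rule_expectation_measurable[OF \<phi>] rule_expectation_bound[OF \<phi>] by (rule integrable_unif)
    qed (use integrable_surplus_best[OF xs] rule_expectation_le[OF \<beta>(1) \<beta>1 \<phi> _ xs_nonneg] in auto)
    then have "\<beta> * (\<integral>xh. measure_pmf.expectation (\<phi> xh) (\<lambda>q. consumer_utility K v q xs) \<partial>unif_market K)
        \<le> \<beta> * noise_surplus \<beta> xs"
      using \<beta> by (intro mult_left_mono) auto
    with 1 show ?thesis
      unfolding w segmentation_utility[OF \<beta>(1) \<beta>1 \<phi> \<sigma>] by (rule add_mono)
  qed
  have mem: "?m \<in> fst ` utility_set K v xs \<beta>"
  proof -
    obtain \<sigma> where \<sigma>: "segmentation K xs \<sigma>" and "plan_value Y \<le> segmented_surplus \<beta> \<sigma>"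
      using plan_segmentation[OF xs Y] by blast
    moreover have "segmented_surplus \<beta> \<sigma> \<le> plan_value Y"
      using segmentation_plan[OF \<sigma>, of \<beta>] Y_max by metis
    ultimately have eq: "segmented_surplus \<beta> \<sigma> = plan_value Y"
      by simp
    note \<phi> = lowest_rule_optimal[OF \<beta>(1) \<beta>1]
    have "(\<Sum>x\<in>set_pmf \<sigma>. pmf \<sigma> x * expected_utility K \<beta> (lowest_rule \<beta>) (consumer_utility K v) x) = ?m"
      unfolding segmentation_utility[OF \<beta>(1) \<beta>1 \<phi> \<sigma>] eq[symmetric] segmented_surplus_def noise_surplus_def
      by (simp add: lowest_rule_def consumer_utility_grid)
    then show ?thesis
      using \<sigma> \<phi> unfolding utility_set_def by (force simp: image_iff)
  qed
  have "max_consumer_utility K v xs \<beta> = ?m"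
    unfolding max_consumer_utility_def using mem le by (intro Greatest_equality) auto
  then show ?thesis
    using Y Y_max mem le by (intro that[of Y])
qed

end

section \<open>Comparison of privacy levels\<close>

text \<open>The odds map \<open>(0, 1]\<close> bijectively onto the positive extended reals, with
  \<open>b = 1\<close> going to infinity as \<open>1 / 0\<close> does there. Hence
  \<open>THE\<close> in \<open>beta_bar\<close> denotes a solution.\<close>

lemma ex1_odds:
  assumes Q: "(0::ereal) < Q"
  shows "\<exists>!b. b \<in> {0<..1} \<and> ereal b / ereal (1 - b) = Q"
proof (cases Q)
  case PInf
  show ?thesis
  proof (rule ex1I[of _ 1])
    show "1 \<in> {0<..1::real} \<and> ereal 1 / ereal (1 - 1) = Q"
      by (simp add: PInf)
    fix b :: real assume b: "b \<in> {0<..1} \<and> ereal b / ereal (1 - b) = Q"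
    show "b = 1"
    proof (rule ccontr)
      assume "b \<noteq> 1"
      then have "ereal b / ereal (1 - b) = ereal (b / (1 - b))"
        by simp
      then show False
        using b PInf by simp
    qed
  qed
next
  case (real q)
  then have q: "0 < q"
    using Q by simp
  show ?thesis
  proof (rule ex1I[of _ "q / (1 + q)"])
    have eq: "1 - q / (1 + q) = 1 / (1 + q)"
      using q by (simp add: field_simps)
    show "q / (1 + q) \<in> {0<..1} \<and> ereal (q / (1 + q)) / ereal (1 - q / (1 + q)) = Q"
      unfolding eq using q real by simp
    fix b assume b: "b \<in> {0<..1} \<and> ereal b / ereal (1 - b) = Q"
    have "b \<noteq> 1"
      using b real by auto
    then have "b / (1 - b) = q"
      using b real by simp
    then have "b = q * (1 - b)"
      using \<open>b \<noteq> 1\<close> by (simp add: divide_eq_eq)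
    then show "b = q / (1 + q)"
      using q by (simp add: field_simps)
  qed
qed (use Q in simp)

context value_grid
begin

section \<open>Effect of the noise level on prices\<close>

lemma score_diff: "score \<beta> y j - score \<beta> y i = (1 - \<beta>) * (v j * tail K y j - v i * tail K y i)
    + \<beta> * ((weight j - weight i) / K * tail K y 1)"
  by (simp add: score_def algebra_simps diff_divide_distrib)

text \<open>Let \<open>A\<close> be the advantage of \<open>j\<close> without noise and
  \<open>D \<ge> 0\<close> its advantage in the noise. The hypothesis forces
  \<open>A \<le> 0 \<le> D\<close>, and less noise shifts weight from \<open>D\<close> to
  \<open>A\<close>.\<close>

lemma score_le_less_noise:
  assumes \<beta>: "0 \<le> \<beta>" "\<beta> \<le> \<beta>'" "\<beta>' < 1" and w: "weight i \<le> weight j" and y: "0 \<le> tail K y 1"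
    and le: "score \<beta>' y j \<le> score \<beta>' y i"
  shows "score \<beta> y j \<le> score \<beta> y i"
proof -
  define A D where "A = v j * tail K y j - v i * tail K y i" and "D = (weight j - weight i) / K * tail K y 1"
  have D: "0 \<le> D"
    using w y by (simp add: D_def)
  have 1: "(1 - \<beta>') * A + \<beta>' * D \<le> 0"
    using le score_diff[of \<beta>' y j i] by (simp add: A_def D_def)
  then have "(1 - \<beta>') * A \<le> 0"
    using D \<beta> by (smt (verit) mult_nonneg_nonneg)
  then have "A \<le> 0"
    using \<beta> by (simp add: mult_le_0_iff)
  then have "(\<beta>' - \<beta>) * (A - D) \<le> 0"
    using D \<beta> by (simp add: mult_le_0_iff)
  then have "(1 - \<beta>) * A + \<beta> * D \<le> 0"
    using 1 by (simp add: algebra_simps)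
  then show ?thesis
    using score_diff[of \<beta> y j i] by (simp add: A_def D_def)
qed

text \<open>Now \<open>D \<le> 0\<close>. If \<open>A \<le> 0\<close>, every mixture of the two is
  at most 0; otherwise more noise shifts weight from the positive \<open>A\<close> to
  \<open>D\<close>.\<close>

lemma score_le_more_noise:
  assumes \<beta>: "0 \<le> \<beta>" "\<beta> \<le> \<beta>'" "\<beta>' < 1" and w: "weight j \<le> weight i" and y: "0 \<le> tail K y 1"
    and le: "score \<beta> y j \<le> score \<beta> y i"
  shows "score \<beta>' y j \<le> score \<beta>' y i"
proof -
  define A D where "A = v j * tail K y j - v i * tail K y i" and "D = (weight j - weight i) / K * tail K y 1"
  have D: "D \<le> 0"
    using w y by (simp add: D_def mult_le_0_iff divide_le_0_iff)
  have 1: "(1 - \<beta>) * A + \<beta> * D \<le> 0"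
    using le score_diff[of \<beta> y j i] by (simp add: A_def D_def)
  have "(1 - \<beta>') * A + \<beta>' * D \<le> 0"
  proof (cases "A \<le> 0")
    case True
    then show ?thesis
      using D \<beta> by (intro add_nonpos_nonpos) (auto simp: mult_le_0_iff)
  next
    case False
    then have "(\<beta>' - \<beta>) * (D - A) \<le> 0"
      using D \<beta> by (simp add: mult_le_0_iff)
    then show ?thesis
      using 1 by (simp add: algebra_simps)
  qed
  then show ?thesis
    using score_diff[of \<beta>' y j i] by (simp add: A_def D_def)
qed

lemma noise_surplus_mono:
  assumes "xs \<in> markets K" "\<And>x. x \<in> markets K \<Longrightarrow> best \<beta> x \<le> best \<beta>' x"
  shows "noise_surplus \<beta>' xs \<le> noise_surplus \<beta> xs"
  unfolding noise_surplus_def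
proof (rule integral_mono)
  fix x assume "x \<in> space (unif_market K)"
  then show "surplus (best \<beta>' x) xs \<le> surplus (best \<beta> x) xs"
    using assms market_bounds best_range[of \<beta> x] best_range[of \<beta>' x]
    by (intro surplus_antimono) auto
qed (use integrable_surplus_best assms in auto)

section \<open>Increasing weights\<close>

lemma prob_best_less:
  assumes \<beta>: "0 \<le> \<beta>" "\<beta> < 1"
    and inc: "\<And>i j. 1 \<le> i \<Longrightarrow> i \<le> j \<Longrightarrow> j \<le> K \<Longrightarrow> weight i \<le> weight j"
    and r: "r \<in> {1..K}"
  shows "measure (unif_market K) {x \<in> markets K. best \<beta> x < r} \<le> (real r - 1) / K"
proof -
  interpret prob_space "unif_market K"
    by (rule prob_space_unif)
  have H: "{x \<in> markets K. high_mean K r x} \<in> sets (unif_market K)"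
    using r high_mean_sets[of r K] by simp
  define q where "q = (\<lambda>x i. tail K x i / (real K + 1 - real i))"
  \<comment> \<open>\<open>best\<close> takes the lower index when scores tie, so equal averages
    with equal weights would let a price below \<open>v r\<close> win.\<close>
  have "AE x in unif_market K. \<forall>l\<in>{1..<r}. \<forall>j\<in>{r..K}. q x j \<noteq> q x l"
  proof (intro AE_finite_allI)
    fix l j assume lj: "l \<in> {1..<r}" "j \<in> {r..K}"
    have "AE x in unif_market K. 1 / (real K + 1 - real j) * tail K x j \<noteq> 1 / (real K + 1 - real l) * tail K x l"
      using K lj by (intro AE_unif_market_no_tie) auto
    then show "AE x in unif_market K. q x j \<noteq> q x l"
      by (simp add: q_def)
  qed auto
  then have "AE x in unif_market K. x \<in> {x \<in> markets K. best \<beta> x < r} \<longrightarrow> x \<in> space (unif_market K) - {x \<in> markets K. high_mean K r x}"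
  proof (rule AE_mp, intro AE_I2 impI)
    fix x assume tie: "\<forall>l\<in>{1..<r}. \<forall>j\<in>{r..K}. q x j \<noteq> q x l" and x: "x \<in> {x \<in> markets K. best \<beta> x < r}"
    have x_nonneg: "0 \<le> x k" if "k \<in> {1..K}" for k
      using x that market_bounds[of x k] by simp
    have "\<not> high_mean K r x"
    proof
      assume "high_mean K r x"
      then obtain j where j: "j \<in> {r..K}" and le: "\<And>l. l \<in> {1..<r} \<Longrightarrow> q x l \<le> q x j"
        unfolding high_mean_def q_def by auto
      define l where "l = best \<beta> x"
      have l: "l \<in> {1..<r}"
        using x best_range[of \<beta> x] by (auto simp: l_def)
      have q_nonneg: "0 \<le> q x l"
        unfolding q_def using l r x_nonneg by (intro divide_nonneg_pos tail_nonneg) auto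
      have "q x l < q x j"
        using le[OF l] bspec[OF bspec[OF tie l] j] by simp
      then have less: "(1 - \<beta>) * q x l + \<beta> / K < (1 - \<beta>) * q x j + \<beta> / K"
        using \<beta> by simp
      \<comment> \<open>Both parts of the score share the factor \<open>weight i\<close>, and the
        other factor increases with the average \<open>q x i\<close>; so \<open>j\<close>, with the
        larger average and no smaller weight, beats \<open>l\<close>.\<close>
      have sc: "score \<beta> x i = weight i * ((1 - \<beta>) * q x i + \<beta> / K)" if "i \<in> {1..K}" for i
      proof -
        have "v i * tail K x i = weight i * q x i"
          using that by (simp add: weight_def q_def)
        then show ?thesis
          using x by (simp add: score_def tail_market algebra_simps)
      qed
      have "0 < weight j"
        using v_pos[of j] j r by (simp add: weight_def)
      have "score \<beta> x l \<le> weight j * ((1 - \<beta>) * q x l + \<beta> / K)"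
        using l j r \<beta> q_nonneg inc[of l j] by (subst sc) (auto intro!: mult_right_mono)
      also have "\<dots> < score \<beta> x j"
        using less \<open>0 < weight j\<close> j r by (subst sc) auto
      finally show False
        using score_le_best[of j \<beta> x] j r by (simp add: l_def)
    qed
    then show "x \<in> space (unif_market K) - {x \<in> markets K. high_mean K r x}"
      using x by simp
  qed
  then have "prob {x \<in> markets K. best \<beta> x < r} \<le> prob (space (unif_market K) - {x \<in> markets K. high_mean K r x})"
    by (rule finite_measure_mono_AE) (rule sets.compl_sets[OF H])
  also have "\<dots> = 1 - prob {x \<in> markets K. high_mean K r x}"
    by (rule prob_compl[OF H])
  also have "\<dots> \<le> 1 - (real K + 1 - real r) / K"
    using K r prob_high_mean[of K r] by auto
  also have "\<dots> = (real r - 1) / K"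
    using K by (simp add: field_simps)
  finally show ?thesis .
qed

text \<open>By \<open>surplus_tail\<close> the expected surplus is a sum over the events
  \<open>best \<beta> x < r\<close>, each bounded by \<open>prob_best_less\<close>.\<close>

lemma noise_surplus_le:
  assumes \<beta>: "0 \<le> \<beta>" "\<beta> < 1" and xs: "xs \<in> markets K"
    and inc: "\<And>i j. 1 \<le> i \<Longrightarrow> i \<le> j \<Longrightarrow> j \<le> K \<Longrightarrow> weight i \<le> weight j"
  shows "noise_surplus \<beta> xs \<le> (\<Sum>r=2..K. (v r - v (r - 1)) * tail K xs r * ((real r - 1) / K))"
proof -
  interpret prob_space "unif_market K"
    by (rule prob_space_unif)
  let ?B = "\<lambda>r. {x \<in> markets K. best \<beta> x < r}"
  have eq: "surplus (best \<beta> x) xs = (\<Sum>r=2..K. indicator (?B r) x * ((v r - v (r - 1)) * tail K xs r))"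
    if "x \<in> markets K" for x
    unfolding surplus_tail[OF best_range] using that best_range[of \<beta> x]
    by (intro sum.mono_neutral_cong_left) (auto simp: indicator_def)
  have B: "?B r \<in> sets (unif_market K)" for r
    using best_less_sets by simp
  have "noise_surplus \<beta> xs = (\<integral>x. (\<Sum>r=2..K. indicator (?B r) x * ((v r - v (r - 1)) * tail K xs r)) \<partial>unif_market K)"
    unfolding noise_surplus_def using eq by (intro Bochner_Integration.integral_cong) auto
  also have "\<dots> = (\<Sum>r=2..K. (\<integral>x. indicator (?B r) x * ((v r - v (r - 1)) * tail K xs r) \<partial>unif_market K))"
    using B by (intro Bochner_Integration.integral_sum integrable_mult_left integrable_real_indicator)
      (auto simp: emeasure_eq_measure)
  also have "\<dots> = (\<Sum>r=2..K. (v r - v (r - 1)) * tail K xs r * prob (?B r))"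
    using B by (simp add: Int_absorb2 Collect_subset mult.commute del: mult.assoc)
  also have "\<dots> \<le> (\<Sum>r=2..K. (v r - v (r - 1)) * tail K xs r * ((real r - 1) / K))"
  proof (rule sum_mono)
    fix r assume r: "r \<in> {2..K}"
    have "0 \<le> tail K xs r"
      using r market_bounds[OF xs] by (intro tail_nonneg) auto
    moreover have "v (r - 1) \<le> v r"
      using r by (intro v_le) auto
    ultimately show "(v r - v (r - 1)) * tail K xs r * prob (?B r) \<le> (v r - v (r - 1)) * tail K xs r * ((real r - 1) / K)"
      using r prob_best_less[OF \<beta> inc, of r] by (intro mult_left_mono) auto
  qed
  finally show ?thesis .
qed

lemma max_consumer_utility_antimono:
  assumes \<beta>: "0 \<le> \<beta>" "\<beta> \<le> \<beta>'" "\<beta>' < 1" and xs: "xs \<in> markets K"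
    and inc: "\<And>i j. 1 \<le> i \<Longrightarrow> i \<le> j \<Longrightarrow> j \<le> K \<Longrightarrow> weight i \<le> weight j"
    and small: "\<And>i j. 1 \<le> i \<Longrightarrow> i < j \<Longrightarrow> j \<le> K \<Longrightarrow> \<beta>' * (weight j - weight i) \<le> (1 - \<beta>') * (K * v i)"
    and opt: "\<And>j. j \<in> {1..K} \<Longrightarrow> v j * tail K xs j \<le> v 1"
  shows "max_consumer_utility K v xs \<beta>' \<le> max_consumer_utility K v xs \<beta>"
proof -
  have \<beta>1: "\<beta> < 1" and \<beta>'0: "0 \<le> \<beta>'"
    using \<beta> by auto
  obtain Y where Y_max: "\<And>Z. Z \<in> plans \<beta> xs \<Longrightarrow> plan_value Z \<le> plan_value Y"
    and Y_eq: "max_consumer_utility K v xs \<beta> = (1 - \<beta>) * plan_value Y + \<beta> * noise_surplus \<beta> xs"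
    using consumer_utilities[OF \<beta>(1) \<beta>1 xs] by metis
  obtain Y' where Y': "Y' \<in> plans \<beta>' xs"
    and Y'_eq: "max_consumer_utility K v xs \<beta>' = (1 - \<beta>') * plan_value Y' + \<beta>' * noise_surplus \<beta>' xs"
    using consumer_utilities[OF \<beta>'0 \<beta>(3) xs] by metis
  let ?G = "\<Sum>r=2..K. (v r - v (r - 1)) * tail K xs r * ((real r - 1) / K)"
  obtain Z where Z: "Z \<in> plans \<beta> xs" "(1 - \<beta>') * plan_value Y' + (\<beta>' - \<beta>) * ?G \<le> (1 - \<beta>) * plan_value Z"
    using plan_step[OF \<beta> xs inc small opt Y'] by blast
  have "best \<beta> x \<le> best \<beta>' x" if x: "x \<in> markets K" for x
  proof (rule best_le[OF best_range])
    fix j assume "j \<in> {best \<beta>' x<..K}"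
    then show "score \<beta> x j \<le> score \<beta> x (best \<beta>' x)"
      using best_range[of \<beta>' x] tail_market[OF x]
      by (intro score_le_less_noise[OF \<beta>] inc score_le_best) auto
  qed
  then have noise: "noise_surplus \<beta>' xs \<le> noise_surplus \<beta> xs"
    using xs by (intro noise_surplus_mono)
  \<comment> \<open>The share \<open>\<beta>\<close> remains noise and gains from the lower prices
    at \<open>\<beta>\<close>; the share \<open>\<beta>' - \<beta>\<close> is covered by
    \<open>plan_step\<close>.\<close>
  have "(1 - \<beta>') * plan_value Y' + \<beta>' * noise_surplus \<beta>' xs
      = (1 - \<beta>') * plan_value Y' + (\<beta>' - \<beta>) * noise_surplus \<beta>' xs + \<beta> * noise_surplus \<beta>' xs"
    by (simp add: algebra_simps)
  also have "\<dots> \<le> (1 - \<beta>') * plan_value Y' + (\<beta>' - \<beta>) * ?G + \<beta> * noise_surplus \<beta> xs"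
    using \<beta> noise noise_surplus_le[OF \<beta>'0 \<beta>(3) xs inc] by (intro add_mono mult_left_mono) auto
  also have "\<dots> \<le> (1 - \<beta>) * plan_value Y + \<beta> * noise_surplus \<beta> xs"
    using Z Y_max[OF Z(1)] \<beta>1 by (intro add_right_mono) (auto intro: order_trans mult_left_mono)
  finally show ?thesis
    unfolding Y_eq Y'_eq .
qed

section \<open>Decreasing weights\<close>

lemma plan_value_le:
  assumes \<beta>: "0 \<le> \<beta>" "\<beta> < 1" and xs: "xs \<in> markets K" and Y: "Y \<in> plans \<beta> xs"
    and dec: "\<And>i j. 1 \<le> i \<Longrightarrow> i \<le> j \<Longrightarrow> j \<le> K \<Longrightarrow> weight j \<le> weight i"
  shows "(1 - \<beta>) * plan_value Y \<le> (1 - \<beta>) * (v K * (1 - xs K)) + \<beta> * v 1"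
proof -
  have Y_nonneg: "0 \<le> Y i k" if "i \<in> {1..K}" "k \<in> {1..K}" for i k
    using Y that by (auto simp: plans_def)
  \<comment> \<open>Consumers get at most the value \<open>v K * t\<close> less the revenue of
    \<open>v i\<close>. As \<open>v i\<close> is no worse than \<open>v K\<close> on segment
    \<open>i\<close>, that revenue is at least \<open>v K * Y i K\<close> up to the noise, which is
    controlled by \<open>weight i / K \<le> v 1\<close>.\<close>
  have "(1 - \<beta>) * surplus i (Y i) \<le> (1 - \<beta>) * (v K * (tail K (Y i) 1 - Y i K)) + \<beta> * v 1 * tail K (Y i) 1"
    if i: "i \<in> {1..K}" for i
  proof -
    define t where "t = tail K (Y i) 1"
    have t: "0 \<le> t"
      unfolding t_def using i Y_nonneg by (intro tail_nonneg) auto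
    have "surplus i (Y i) = (\<Sum>k=i..K. Y i k * (v k - v i))"
      unfolding surplus_def
    proof (rule sum.mono_neutral_cong_right)
      show "\<forall>k\<in>{1..K} - {i..K}. Y i k * max 0 (v k - v i) = 0"
        using v_le[of _ i] i by auto
      show "Y i k * max 0 (v k - v i) = Y i k * (v k - v i)" if "k \<in> {i..K}" for k
        using v_le[of i k] i that by simp
    qed (use i in auto)
    also have "\<dots> = (\<Sum>k=i..K. Y i k * v k) - v i * tail K (Y i) i"
      by (simp add: tail_def right_diff_distrib sum_subtractf sum_distrib_left mult.commute)
    also have "(\<Sum>k=i..K. Y i k * v k) \<le> (\<Sum>k=1..K. Y i k * v K)"
    proof (rule order_trans)
      show "(\<Sum>k=i..K. Y i k * v k) \<le> (\<Sum>k=i..K. Y i k * v K)"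
        using i Y_nonneg v_le by (intro sum_mono mult_left_mono) auto
      show "(\<Sum>k=i..K. Y i k * v K) \<le> (\<Sum>k=1..K. Y i k * v K)"
        using i Y_nonneg v_pos[of K] K by (intro sum_mono2) (auto intro!: mult_nonneg_nonneg)
    qed
    also have "\<dots> = v K * t"
      by (simp add: t_def tail_def sum_distrib_left mult.commute)
    finally have s: "surplus i (Y i) \<le> v K * t - v i * tail K (Y i) i"
      by simp
    have "score \<beta> (Y i) K \<le> score \<beta> (Y i) i"
      using Y i K by (cases "i = K") (auto simp: plans_def)
    moreover have "tail K (Y i) K = Y i K"
      by (simp add: tail_def)
    ultimately have "(1 - \<beta>) * (v K * Y i K) + \<beta> * (weight K / K * t)
        \<le> (1 - \<beta>) * (v i * tail K (Y i) i) + \<beta> * (weight i / K * t)"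
      by (simp add: score_def t_def)
    moreover have "0 \<le> \<beta> * (weight K / K * t)"
      using \<beta> t weight_nonneg[of K] K by simp
    moreover have "\<beta> * (weight i / K * t) \<le> \<beta> * (v 1 * t)"
    proof -
      have "weight i / K \<le> v 1"
        using dec[of 1 i] i K by (simp add: weight_def divide_le_eq mult.commute)
      then show ?thesis
        using \<beta> t by (intro mult_left_mono mult_right_mono)
    qed
    ultimately have "(1 - \<beta>) * (v K * Y i K) \<le> (1 - \<beta>) * (v i * tail K (Y i) i) + \<beta> * (v 1 * t)"
      by linarith
    moreover have "(1 - \<beta>) * surplus i (Y i) \<le> (1 - \<beta>) * (v K * t - v i * tail K (Y i) i)"
      using s \<beta> by (intro mult_left_mono) auto
    ultimately show ?thesis
      by (simp add: t_def algebra_simps)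
  qed
  then have "(1 - \<beta>) * plan_value Y
      \<le> (\<Sum>i=1..K. (1 - \<beta>) * (v K * (tail K (Y i) 1 - Y i K)) + \<beta> * v 1 * tail K (Y i) 1)"
    unfolding plan_value_def sum_distrib_left by (intro sum_mono)
  also have "\<dots> = (1 - \<beta>) * (v K * ((\<Sum>i=1..K. tail K (Y i) 1) - (\<Sum>i=1..K. Y i K))) + \<beta> * v 1 * (\<Sum>i=1..K. tail K (Y i) 1)"
    by (simp add: sum.distrib sum_distrib_left sum_subtractf right_diff_distrib)
  also have "(\<Sum>i=1..K. Y i K) = xs K"
    using Y K by (simp add: plans_def)
  also have "(\<Sum>i=1..K. tail K (Y i) 1) = 1"
    using plan_tail_sum[OF Y, of 1] tail_market[OF xs] by simp
  finally show ?thesis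
    by simp
qed

text \<open>Counts only the consumers of value \<open>v K\<close>, and only the event that the
  random price is \<open>v 1\<close>.\<close>

lemma noise_surplus_ge:
  assumes xs: "xs \<in> markets K"
  shows "measure (unif_market K) {x \<in> markets K. best 0 x = 1} * ((v K - v 1) * xs K) \<le> noise_surplus 0 xs"
proof -
  interpret prob_space "unif_market K"
    by (rule prob_space_unif)
  let ?B = "{x \<in> markets K. best 0 x = 1}"
  have one: "1 \<in> {1..K}" "K \<in> {1..K}"
    using K by auto
  have B: "?B \<in> sets (unif_market K)"
    using best_eq_sets[OF one(1)] by simp
  have "(v K - v 1) * xs K \<le> surplus 1 xs"
  proof -
    have "xs K * max 0 (v K - v 1) \<le> (\<Sum>k=1..K. xs k * max 0 (v k - v 1))"
      using one market_bounds[OF xs] by (intro member_le_sum[of K "{1..K}" "\<lambda>k. xs k * max 0 (v k - v 1)"]) auto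
    then show ?thesis
      using v_le[of 1 K] K by (simp add: surplus_def mult.commute)
  qed
  then have "prob ?B * ((v K - v 1) * xs K) \<le> prob ?B * surplus 1 xs"
    by (intro mult_left_mono) auto
  also have "\<dots> = (\<integral>x. indicator ?B x * surplus 1 xs \<partial>unif_market K)"
    using B by (simp add: Int_absorb2 Collect_subset)
  also have "\<dots> \<le> noise_surplus 0 xs"
    unfolding noise_surplus_def
  proof (rule integral_mono)
    show "integrable (unif_market K) (\<lambda>x. indicator ?B x * surplus 1 xs)"
      using B by (intro integrable_mult_left integrable_real_indicator) (auto simp: emeasure_eq_measure)
    show "integrable (unif_market K) (\<lambda>x. surplus (best 0 x) xs)"
      using xs by (rule integrable_surplus_best)
    show "indicator ?B x * surplus 1 xs \<le> surplus (best 0 x) xs" for x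
      using surplus_bound[OF xs best_range] by (auto simp: indicator_def)
  qed
  finally show ?thesis .
qed

lemma prob_best_1_pos: "0 < measure (unif_market K) {x \<in> markets K. best 0 x = 1}"
proof -
  interpret prob_space "unif_market K"
    by (rule prob_space_unif)
  have one: "1 \<in> {1..K}"
    using K by auto
  \<comment> \<open>If \<open>v 1\<close> has mass at least \<open>1 - \<epsilon>\<close>, a higher
    price earns at most \<open>v K * \<epsilon> = v 1\<close>, the sure revenue of
    \<open>v 1\<close>.\<close>
  define \<epsilon> where "\<epsilon> = v 1 / v K"
  have \<epsilon>: "0 < \<epsilon>" "\<epsilon> \<le> 1" "\<epsilon> * v K = v 1"
    using v_pos[of K] v_1 v_le[of 1 K] K by (auto simp: \<epsilon>_def)
  have "0 < prob {x \<in> markets K. 1 - \<epsilon> \<le> x 1}"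
    using \<epsilon> K by (intro unif_market_corner_pos)
  also have "\<dots> \<le> prob {x \<in> markets K. best 0 x = 1}"
  proof (rule finite_measure_mono)
    show "{x \<in> markets K. best 0 x = 1} \<in> events"
      using best_eq_sets[OF one] by simp
    show "{x \<in> markets K. 1 - \<epsilon> \<le> x 1} \<subseteq> {x \<in> markets K. best 0 x = 1}"
    proof
      fix x assume "x \<in> {x \<in> markets K. 1 - \<epsilon> \<le> x 1}"
      then have x: "x \<in> markets K" "1 - \<epsilon> \<le> x 1"
        by auto
      have "best 0 x \<le> 1"
      proof (rule best_le[OF one])
        fix j assume j: "j \<in> {1<..K}"
        have "tail K x j \<le> tail K x 2"
          using j market_bounds[OF x(1)] by (intro tail_antimono) auto
        also have "\<dots> = 1 - x 1"
          using tail_rec[of 1 K x] tail_market[OF x(1)] K by (simp add: numeral_2_eq_2)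
        finally have "tail K x j \<le> \<epsilon>"
          using x by simp
        then have "v j * tail K x j \<le> v K * \<epsilon>"
          using j v_le[of j K] v_pos[of j] market_bounds[OF x(1)] v_pos[of K] K
          by (intro mult_mono) (auto intro!: tail_nonneg)
        then show "score 0 x j \<le> score 0 x 1"
          using \<epsilon> tail_market[OF x(1)] by (simp add: score_def mult.commute)
      qed
      then show "x \<in> {x \<in> markets K. best 0 x = 1}"
        using best_range[of 0 x] x by auto
    qed
  qed
  finally show ?thesis .
qed

text \<open>Plans stay feasible under more noise and the noise surplus grows, so it remains to see
  that shifting weight from the plan to the noise pays; comparison with the noise surplus at level
  0, the smallest one, settles this.\<close>

lemma max_consumer_utility_mono:
  assumes \<beta>: "0 \<le> \<beta>" "\<beta> \<le> \<beta>'" "\<beta>' < 1" and xs: "xs \<in> markets K"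
    and dec: "\<And>i j. 1 \<le> i \<Longrightarrow> i \<le> j \<Longrightarrow> j \<le> K \<Longrightarrow> weight j \<le> weight i"
    and noisy: "\<And>Y. Y \<in> plans \<beta> xs \<Longrightarrow> plan_value Y \<le> noise_surplus 0 xs"
  shows "max_consumer_utility K v xs \<beta> \<le> max_consumer_utility K v xs \<beta>'"
proof -
  have \<beta>1: "\<beta> < 1" and \<beta>'0: "0 \<le> \<beta>'"
    using \<beta> by auto
  obtain Y where Y: "Y \<in> plans \<beta> xs"
    and Y_eq: "max_consumer_utility K v xs \<beta> = (1 - \<beta>) * plan_value Y + \<beta> * noise_surplus \<beta> xs"
    using consumer_utilities[OF \<beta>(1) \<beta>1 xs] by metis
  obtain Y' where Y'_max: "\<And>Z. Z \<in> plans \<beta>' xs \<Longrightarrow> plan_value Z \<le> plan_value Y'"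
    and Y'_eq: "max_consumer_utility K v xs \<beta>' = (1 - \<beta>') * plan_value Y' + \<beta>' * noise_surplus \<beta>' xs"
    using consumer_utilities[OF \<beta>'0 \<beta>(3) xs] by metis
  have noise: "noise_surplus b xs \<le> noise_surplus b' xs" if b: "0 \<le> b" "b \<le> b'" "b' < 1" for b b'
  proof (rule noise_surplus_mono[OF xs])
    fix x assume x: "x \<in> markets K"
    show "best b' x \<le> best b x"
    proof (rule best_le[OF best_range])
      fix j assume "j \<in> {best b x<..K}"
      then show "score b' x j \<le> score b' x (best b x)"
        using best_range[of b x] tail_market[OF x]
        by (intro score_le_more_noise[OF b] dec score_le_best) auto
    qed
  qed
  have "Y \<in> plans \<beta>' xs"
    unfolding plans_def
  proof (intro CollectI conjI ballI)
    fix i j assume ij: "i \<in> {1..K}" "j \<in> {i<..K}"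
    then have "0 \<le> tail K (Y i) 1"
      using Y by (intro tail_nonneg) (auto simp: plans_def)
    then show "score \<beta>' (Y i) j \<le> score \<beta>' (Y i) i"
      using ij Y by (intro score_le_more_noise[OF \<beta>] dec) (auto simp: plans_def)
  qed (use Y in \<open>auto simp: plans_def\<close>)
  then have le: "plan_value Y \<le> plan_value Y'"
    by (rule Y'_max)
  have "plan_value Y \<le> noise_surplus \<beta> xs"
    using noisy[OF Y] noise[of 0 \<beta>] \<beta> by simp
  then have "(\<beta>' - \<beta>) * plan_value Y \<le> (\<beta>' - \<beta>) * noise_surplus \<beta> xs"
    using \<beta> by (intro mult_left_mono) auto
  then have "(1 - \<beta>) * plan_value Y + \<beta> * noise_surplus \<beta> xs
      \<le> (1 - \<beta>') * plan_value Y + \<beta>' * noise_surplus \<beta> xs"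
    by (simp add: algebra_simps)
  also have "\<dots> \<le> (1 - \<beta>') * plan_value Y' + \<beta>' * noise_surplus \<beta>' xs"
    using \<beta> le noise[OF \<beta>] by (intro add_mono mult_left_mono) auto
  finally show ?thesis
    unfolding Y_eq Y'_eq .
qed

lemma noise_beats_plans:
  assumes dec: "\<And>i j. 1 \<le> i \<Longrightarrow> i \<le> j \<Longrightarrow> j \<le> K \<Longrightarrow> weight j \<le> weight i"
    and b: "0 < b" "b \<le> 1"
  shows "\<exists>\<alpha>\<in>{0<..<1}. \<exists>\<beta>'>0. \<beta>' < b \<and> (\<forall>xs\<in>markets K. \<forall>\<beta>\<in>{0..\<beta>'}. \<forall>Y\<in>plans \<beta> xs.
    \<alpha> \<le> xs K \<longrightarrow> plan_value Y \<le> noise_surplus 0 xs)"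
proof -
  define c where "c = measure (unif_market K) {x \<in> markets K. best 0 x = 1} * (v K - v 1)"
  have c: "0 < c"
    unfolding c_def using prob_best_1_pos v_less[of 1 K] K by (intro mult_pos_pos) auto
  have vK: "0 < v K"
    using v_pos[of K] K by simp
  \<comment> \<open>The noise surplus is at least \<open>c * xs K \<ge> c / 2\<close>, the budget
    for the plan. \<open>\<alpha>\<close> keeps \<open>v K * (1 - xs K)\<close> below
    \<open>c / 4\<close>, and the 8 in \<open>\<beta>'\<close> gives
    \<open>\<beta> * v 1 \<le> (1 - \<beta>) * (c / 4)\<close> because
    \<open>\<beta> \<le> 1 / 2\<close>.\<close>
  define \<alpha> where "\<alpha> = 1 - min (1 / 2) (c / (4 * v K))"
  define \<beta>' where "\<beta>' = min (b / 2) (c / (8 * v 1))"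
  have \<alpha>: "1 / 2 \<le> \<alpha>" "\<alpha> < 1" "v K * (1 - \<alpha>) \<le> c / 4"
  proof -
    show "1 / 2 \<le> \<alpha>" "\<alpha> < 1"
      using c vK by (auto simp: \<alpha>_def)
    have "v K * (1 - \<alpha>) \<le> v K * (c / (4 * v K))"
      using vK by (intro mult_left_mono) (auto simp: \<alpha>_def)
    then show "v K * (1 - \<alpha>) \<le> c / 4"
      using vK by simp
  qed
  have \<beta>': "0 < \<beta>'" "\<beta>' < b" "\<beta>' \<le> 1 / 2" "\<beta>' * v 1 \<le> c / 8"
  proof -
    show "0 < \<beta>'"
      using b c v_1 by (simp add: \<beta>'_def)
    have "\<beta>' \<le> b / 2"
      by (simp add: \<beta>'_def)
    then show "\<beta>' < b" "\<beta>' \<le> 1 / 2"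
      using b by auto
    have "\<beta>' * v 1 \<le> c / (8 * v 1) * v 1"
      using v_1 by (intro mult_right_mono) (auto simp: \<beta>'_def)
    then show "\<beta>' * v 1 \<le> c / 8"
      using v_1 by simp
  qed
  have "plan_value Y \<le> noise_surplus 0 xs"
    if xs: "xs \<in> markets K" and \<beta>: "\<beta> \<in> {0..\<beta>'}" and Y: "Y \<in> plans \<beta> xs" and xK: "\<alpha> \<le> xs K" for xs \<beta> Y
  proof -
    have \<beta>2: "0 \<le> \<beta>" "\<beta> \<le> 1 / 2" "\<beta> < 1"
      using \<beta> \<beta>' by auto
    have "\<beta> * v 1 \<le> \<beta>' * v 1"
      using \<beta> v_1 by (intro mult_right_mono) auto
    moreover have "1 / 2 * (c / 4) \<le> (1 - \<beta>) * (c / 4)"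
      using \<beta>2 c by (intro mult_right_mono) auto
    ultimately have 1: "\<beta> * v 1 \<le> (1 - \<beta>) * (c / 4)"
      using \<beta>'(4) by linarith
    have "v K * (1 - xs K) \<le> v K * (1 - \<alpha>)"
      using xK vK by (intro mult_left_mono) auto
    then have "(1 - \<beta>) * (v K * (1 - xs K)) \<le> (1 - \<beta>) * (c / 4)"
      using \<alpha> \<beta>2 by (intro mult_left_mono) auto
    with 1 plan_value_le[OF \<beta>2(1,3) xs Y dec] have "(1 - \<beta>) * plan_value Y \<le> (1 - \<beta>) * (c / 4) + (1 - \<beta>) * (c / 4)"
      by linarith
    also have "\<dots> = (1 - \<beta>) * (c / 2)"
      by (simp add: algebra_simps)
    finally have "plan_value Y \<le> c / 2"
      using \<beta>2 by simp
    also have "\<dots> \<le> c * xs K"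
      using mult_left_mono[of "1 / 2" "xs K" c] c \<alpha> xK by simp
    also have "\<dots> \<le> noise_surplus 0 xs"
      using noise_surplus_ge[OF xs] by (simp add: c_def mult.assoc)
    finally show ?thesis .
  qed
  then show ?thesis
    using \<alpha> \<beta>' by (intro bexI[of _ \<alpha>] exI[of _ \<beta>']) auto
qed

text \<open>For \<open>j > i\<close> the term in the minimum is \<open>K * v i\<close> over the
  positive part of \<open>weight j - weight i\<close>. Cleared of denominators, the bound on the
  odds says that \<open>v i\<close> is no worse than \<open>v j\<close> on a point mass at
  \<open>v i\<close>.\<close>

lemma beta_bar_props:
  assumes i: "i \<in> {1..K}"
  shows "0 < beta_bar K v i" "beta_bar K v i \<le> 1"
    and "\<And>j \<beta>. i < j \<Longrightarrow> j \<le> K \<Longrightarrow> 0 \<le> \<beta> \<Longrightarrow> \<beta> < beta_bar K v i \<Longrightarrow>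
      \<beta> * (weight j - weight i) \<le> (1 - \<beta>) * (K * v i)"
proof -
  define T where "T = (\<lambda>j. ereal (real K * (v i - of_bool (j < i) * v j)) / ereal (max 0 (weight j - weight i)))"
  define Q where "Q = (MIN j\<in>{1..K}. T j)"
  have T_pos: "0 < T j" if j: "j \<in> {1..K}" for j
  proof -
    have "0 < real K * (v i - of_bool (j < i) * v j)"
      using v_pos[of i] v_less[of j i] i j K by (cases "j < i") auto
    then show ?thesis
      using K by (cases "weight j - weight i \<le> 0") (auto simp: T_def max_def zero_ereal_def)
  qed
  have "Q \<in> T ` {1..K}"
    unfolding Q_def using K by (intro Min_in) auto
  then have "0 < Q"
    using T_pos by auto
  from ex1_odds[OF this]
  have "\<exists>!b. b \<in> {0<..1} \<and> ereal b / ereal (1 - b) = Q" .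
  from theI'[OF this] have bb: "beta_bar K v i \<in> {0<..1}"
    "ereal (beta_bar K v i) / ereal (1 - beta_bar K v i) = Q"
    by (simp_all add: beta_bar_def Q_def T_def weight_def)
  then show "0 < beta_bar K v i" "beta_bar K v i \<le> 1"
    by auto
  fix j \<beta> assume j: "i < j" "j \<le> K" and \<beta>: "0 \<le> \<beta>" "\<beta> < beta_bar K v i"
  define b where "b = beta_bar K v i"
  define d where "d = weight j - weight i"
  have vi: "0 < K * v i"
    using v_pos[of i] i K by simp
  show "\<beta> * (weight j - weight i) \<le> (1 - \<beta>) * (K * v i)"
  proof (cases "d \<le> 0")
    case True
    then have "\<beta> * d \<le> 0"
      using \<beta> by (simp add: mult_le_0_iff)
    moreover have "0 \<le> 1 - \<beta>"
      using \<beta> bb(1) by auto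
    then have "0 \<le> (1 - \<beta>) * (K * v i)"
      using less_imp_le[OF vi] by (rule mult_nonneg_nonneg)
    ultimately show ?thesis
      by (simp add: d_def)
  next
    case False
    have "Q \<le> T j"
      unfolding Q_def using i j by (intro Min_le) auto
    then have le: "ereal b / ereal (1 - b) \<le> ereal (K * v i / d)"
      using bb(2) j False by (simp add: T_def b_def d_def max_def)
    \<comment> \<open>At \<open>b = 1\<close> the odds would be infinite, but the term for
      \<open>j\<close> is finite.\<close>
    have "b < 1"
    proof (rule ccontr)
      assume "\<not> b < 1"
      then have "b = 1"
        using bb(1) by (simp add: b_def)
      then show False
        using le by simp
    qed
    then have "b / (1 - b) \<le> K * v i / d"
      using le by simp
    then have *: "b * d \<le> (1 - b) * (K * v i)"
      using \<open>b < 1\<close> False by (simp add: field_simps)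
    have "\<beta> * d \<le> b * d"
      using \<beta> False by (intro mult_right_mono) (auto simp: b_def)
    moreover have "(1 - b) * (K * v i) \<le> (1 - \<beta>) * (K * v i)"
      using \<beta> vi by (intro mult_right_mono) (auto simp: b_def)
    ultimately show ?thesis
      using * by (simp add: d_def)
  qed
qed

lemma weight_step:
  assumes i: "i \<in> {1..K - 1}"
  shows "(real K + 1 - real i) / (real K - real i) * v i \<le> v (i + 1) \<longleftrightarrow> weight i \<le> weight (Suc i)"
    and "v (i + 1) \<le> (real K + 1 - real i) / (real K - real i) * v i \<longleftrightarrow> weight (Suc i) \<le> weight i"
proof -
  have pos: "0 < real K - real i"
    using i by auto
  have w: "weight (Suc i) = v (i + 1) * (real K - real i)"
    by (simp add: weight_def Suc_eq_plus1)
  show "(real K + 1 - real i) / (real K - real i) * v i \<le> v (i + 1) \<longleftrightarrow> weight i \<le> weight (Suc i)"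
    unfolding w weight_def[of i] times_divide_eq_left pos_divide_le_eq[OF pos] ..
  show "v (i + 1) \<le> (real K + 1 - real i) / (real K - real i) * v i \<longleftrightarrow> weight (Suc i) \<le> weight i"
    unfolding w weight_def[of i] times_divide_eq_left pos_le_divide_eq[OF pos] ..
qed

end

theorem proposition6:
  fixes K :: nat and v :: "nat \<Rightarrow> real"
  assumes K: "2 \<le> K"
    and v_pos: "0 < v 1"
    and v_mono: "strict_mono_on {1..K} v"
  defines "b \<equiv> (MIN k\<in>{1..K}. beta_bar K v k)"
  shows
    "(\<forall>xs\<in>markets K. \<forall>\<beta>\<in>{0..<b}.
        \<exists>u\<in>fst ` utility_set K v xs \<beta>. \<forall>w\<in>fst ` utility_set K v xs \<beta>. w \<le> u)
     \<and>
     (\<forall>xs\<in>markets K.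
        is_arg_max (\<lambda>p. producer_utility K v p xs) (\<lambda>p. p \<in> v ` {1..K}) (v 1) \<longrightarrow>
        (\<forall>i\<in>{1..K-1}. v (i + 1) \<ge> (real K + 1 - real i) / (real K - real i) * v i) \<longrightarrow>
        antimono_on {0..<b} (max_consumer_utility K v xs))
     \<and>
     ((\<forall>i\<in>{1..K-1}. v (i + 1) \<le> (real K + 1 - real i) / (real K - real i) * v i) \<longrightarrow>
        (\<exists>\<alpha>\<in>{0<..<1}. \<exists>\<beta>'>0. \<beta>' < b \<and>
           (\<forall>xs\<in>markets K.
              is_arg_max (\<lambda>p. producer_utility K v p xs) (\<lambda>p. p \<in> v ` {1..K}) (v K) \<longrightarrow>
              xs K \<ge> \<alpha> \<longrightarrow>
              mono_on {0..\<beta>'} (max_consumer_utility K v xs))))"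
proof -
  interpret value_grid K v
    using K v_pos v_mono by unfold_locales
  have b_le: "b \<le> beta_bar K v i" if "i \<in> {1..K}" for i
    unfolding b_def using that by (intro Min_le) auto
  have "b \<in> beta_bar K v ` {1..K}"
    unfolding b_def using K by (intro Min_in) auto
  then have b: "0 < b" "b \<le> 1"
    using beta_bar_props by auto
  have small: "\<beta> * (weight j - weight i) \<le> (1 - \<beta>) * (K * v i)"
    if "\<beta> \<in> {0..<b}" "1 \<le> i" "i < j" "j \<le> K" for \<beta> i j
    using that b_le[of i] by (intro beta_bar_props(3)) auto
  have 1: "\<exists>u\<in>fst ` utility_set K v xs \<beta>. \<forall>w\<in>fst ` utility_set K v xs \<beta>. w \<le> u"
    if "xs \<in> markets K" "\<beta> \<in> {0..<b}" for xs \<beta>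
  proof -
    have "0 \<le> \<beta>" "\<beta> < 1"
      using that b by auto
    from consumer_utilities[OF this that(1)] show ?thesis
      by metis
  qed
  have 2: "antimono_on {0..<b} (max_consumer_utility K v xs)"
    if xs: "xs \<in> markets K" and arg: "is_arg_max (\<lambda>p. producer_utility K v p xs) (\<lambda>p. p \<in> v ` {1..K}) (v 1)"
      and step: "\<forall>i\<in>{1..K-1}. v (i + 1) \<ge> (real K + 1 - real i) / (real K - real i) * v i" for xs
  proof (rule monotone_onI)
    have inc: "weight i \<le> weight j" if "1 \<le> i" "i \<le> j" "j \<le> K" for i j
      using that(2,1,3)
    proof (induction j rule: dec_induct)
      case (step j)
      then show ?case
        using \<open>\<forall>i\<in>{1..K-1}. _ i\<close> weight_step(1)[of j] by fastforce
    qed simp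
    have opt: "v j * tail K xs j \<le> v 1" if j: "j \<in> {1..K}" for j
    proof -
      have "1 \<in> {1..K}"
        using K by auto
      moreover have "\<not> producer_utility K v (v j) xs > producer_utility K v (v 1) xs"
        using arg j by (auto simp: is_arg_max_def)
      ultimately show ?thesis
        using j tail_market[OF xs] by (simp add: producer_utility_grid not_less)
    qed
    fix \<beta> \<beta>' assume *: "\<beta> \<in> {0..<b}" "\<beta>' \<in> {0..<b}" "\<beta> \<le> \<beta>'"
    have \<beta>: "0 \<le> \<beta>" "\<beta>' < 1"
      using * b by auto
    show "max_consumer_utility K v xs \<beta>' \<le> max_consumer_utility K v xs \<beta>"
      by (rule max_consumer_utility_antimono[OF \<beta>(1) *(3) \<beta>(2) xs inc small[OF *(2)] opt])
  qed
  have 3: "\<exists>\<alpha>\<in>{0<..<1}. \<exists>\<beta>'>0. \<beta>' < b \<and> (\<forall>xs\<in>markets K. xs K \<ge> \<alpha> \<longrightarrow>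
      mono_on {0..\<beta>'} (max_consumer_utility K v xs))"
    if step: "\<forall>i\<in>{1..K-1}. v (i + 1) \<le> (real K + 1 - real i) / (real K - real i) * v i"
  proof -
    have dec: "weight j \<le> weight i" if "1 \<le> i" "i \<le> j" "j \<le> K" for i j
      using that(2,1,3)
    proof (induction j rule: dec_induct)
      case (step j)
      then show ?case
        using \<open>\<forall>i\<in>{1..K-1}. _ i\<close> weight_step(2)[of j] by fastforce
    qed simp
    obtain \<alpha> \<beta>' where \<alpha>: "\<alpha> \<in> {0<..<1}" and \<beta>': "0 < \<beta>'" "\<beta>' < b"
      and noisy: "\<And>xs \<beta> Y. xs \<in> markets K \<Longrightarrow> \<beta> \<in> {0..\<beta>'} \<Longrightarrow> Y \<in> plans \<beta> xs \<Longrightarrow> \<alpha> \<le> xs K \<Longrightarrow>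
        plan_value Y \<le> noise_surplus 0 xs"
      using noise_beats_plans[OF dec b] by blast
    have "mono_on {0..\<beta>'} (max_consumer_utility K v xs)" if xs: "xs \<in> markets K" "\<alpha> \<le> xs K" for xs
    proof (rule monotone_onI)
      fix s t assume st: "s \<in> {0..\<beta>'}" "t \<in> {0..\<beta>'}" "s \<le> t"
      then have "0 \<le> s" "t < 1"
        using \<beta>' b by auto
      then show "max_consumer_utility K v xs s \<le> max_consumer_utility K v xs t"
        by (rule max_consumer_utility_mono[OF _ st(3) _ xs(1) dec noisy[OF xs(1) st(1) _ xs(2)]])
    qed
    then show ?thesis
      using \<alpha> \<beta>' by blast
  qed
  show ?thesis
    using 1 2 3 by blast
qed

end
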